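(* Let $\mathcal{V}$ be a complete and cocomplete symmetric monoidal closed category with locally small underlying category. Given a small $\mathcal{V}$-category $\mathcal{P}$ and a cocomplete $\mathcal{V}$-category $\mathcal{L}$, the $\mathcal{V}$-functor $[H,1]\colon[\mathcal{P},\mathcal{L}]\to[\mathrm{ob}\mathcal{P},\mathcal{L}]$ induced by the inclusion $H\colon\mathrm{ob}\mathcal{P}\to\mathcal{P}$ is strictly monadic for the $\mathcal{V}$-monad $T=[H,1]\,\mathrm{Lan}_H$ given by the Kan adjunction $\mathrm{Lan}_H\dashv[H,1]$. In particular, the functor $\mathcal{V}$-category $[\mathcal{P},\mathcal{L}]$ is isomorphic as a $\mathcal{V}$-category to the Eilenberg–Moore object $[\mathrm{ob}\mathcal{P},\mathcal{L}]^T$ in $\mathcal{V}\text{-}\mathrm{CAT}$.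
   Context: $\mathrm{ob}\mathcal{P}$ is the discrete $\mathcal{V}$-category on the objects of $\mathcal{P}$: its hom objects are $(\mathrm{ob}\mathcal{P})(P,P)=I$ and the initial object $\emptyset$ for distinct objects. $H$ is the unique $\mathcal{V}$-functor that is the identity on objects. $[H,1]$ is precomposition with $H$; its left adjoint is $\mathrm{Lan}_H$, left Kan extension along $H$. Cocomplete means having all small indexed (weighted) colimits. $\mathcal{V}\text{-}\mathrm{CAT}$ is the 2-category of $\mathcal{V}$-categories, $\mathcal{V}$-functors and $\mathcal{V}$-natural transformations. For a $\mathcal{V}$-monad $T$ on $\mathcal{M}$, the Eilenberg–Moore object $\mathcal{M}^T$ is the $\mathcal{V}$-category of $T$-algebras $(A,a\colon TA\to A)$ with hom object $\mathcal{M}^T((A,a),(B,b))$ the equalizer of $\mathcal{M}(a,1)$ and $\mathcal{M}(1,b)T_{A,B}\colon\mathcal{M}(A,B)\to\mathcal{M}(TA,B)$. Strictly monadic means that the comparison $\mathcal{V}$-functor to the Eilenberg–Moore object of the induced monad is an isomorphism of $\mathcal{V}$-categories (compatible with the forgetful functor and $[H,1]$). *)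

theory Defs
  imports Main
begin

section \<open>Ordinary categories, smallness, limits\<close>

record ('o, 'm) cat =
  Obj :: "'o set"
  Arr :: "'m set"
  Dom :: "'m \<Rightarrow> 'o"
  Cod :: "'m \<Rightarrow> 'o"
  Idn :: "'o \<Rightarrow> 'm"
  Cmp :: "'m \<Rightarrow> 'm \<Rightarrow> 'm"  (infixr "\<cdot>\<index>" 70)

definition hom :: "('o, 'm, 'z) cat_scheme \<Rightarrow> 'o \<Rightarrow> 'o \<Rightarrow> 'm set" where
  "hom C A B = {f \<in> Arr C. Dom C f = A \<and> Cod C f = B}"

locale category =
  fixes C :: "('o, 'm, 'z) cat_scheme" (structure)
  assumes Dom_in: "f \<in> Arr C \<Longrightarrow> Dom C f \<in> Obj C"
    and Cod_in: "f \<in> Arr C \<Longrightarrow> Cod C f \<in> Obj C"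
    and Idn_in: "A \<in> Obj C \<Longrightarrow> Idn C A \<in> hom C A A"
    and Cmp_in: "\<lbrakk>f \<in> hom C A B; g \<in> hom C B D\<rbrakk> \<Longrightarrow> g \<cdot> f \<in> hom C A D"
    and Cmp_Idn_left: "f \<in> hom C A B \<Longrightarrow> Idn C B \<cdot> f = f"
    and Cmp_Idn_right: "f \<in> hom C A B \<Longrightarrow> f \<cdot> Idn C A = f"
    and Cmp_assoc: "\<lbrakk>f \<in> hom C A B; g \<in> hom C B D; h \<in> hom C D E\<rbrakk>
      \<Longrightarrow> (h \<cdot> g) \<cdot> f = h \<cdot> (g \<cdot> f)"

definition op_cat :: "('o, 'm, 'z) cat_scheme \<Rightarrow> ('o, 'm) cat" where
  "op_cat C = \<lparr>Obj = Obj C, Arr = Arr C, Dom = Cod C, Cod = Dom C, Idn = Idn C,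
     Cmp = (\<lambda>g f. f \<cdot>\<^bsub>C\<^esub> g)\<rparr>"

definition is_inverse :: "('o, 'm, 'z) cat_scheme \<Rightarrow> 'm \<Rightarrow> 'm \<Rightarrow> bool" where
  "is_inverse C f g \<longleftrightarrow> f \<in> Arr C \<and> g \<in> hom C (Cod C f) (Dom C f) \<and>
     g \<cdot>\<^bsub>C\<^esub> f = Idn C (Dom C f) \<and> f \<cdot>\<^bsub>C\<^esub> g = Idn C (Cod C f)"

definition is_iso :: "('o, 'm, 'z) cat_scheme \<Rightarrow> 'm \<Rightarrow> bool" where
  "is_iso C f \<longleftrightarrow> (\<exists>g. is_inverse C f g)"

definition inverse_arr :: "('o, 'm, 'z) cat_scheme \<Rightarrow> 'm \<Rightarrow> 'm" where
  "inverse_arr C f = (THE g. is_inverse C f g)"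

text \<open>
  The universe of small sets is given by a set \<open>U\<close> whose cardinality is an infinite regular
  strong limit cardinal: a set of any type is small if it has fewer elements than \<open>U\<close>.
  Apart from the case where \<open>U\<close> is countable (small = finite), which is not excluded, these are
  the sizes of Grothendieck universes.  Up to isomorphism, every small category has its
  objects and arrows in the type of the elements of \<open>U\<close>, so that quantifying over
  small categories of that type is quantifying over all small categories.
\<close>

context includes cardinal_syntax begin

definition small :: "'u set \<Rightarrow> 'x set \<Rightarrow> bool" where
  "small U A \<longleftrightarrow> |A| <o |U|"

definition size_universe :: "'u set \<Rightarrow> bool" where
  "size_universe U \<longleftrightarrow> infinite U \<and> regularCard |U| \<and>
     (\<forall>A :: 'u set. small U A \<longrightarrow> small U (Pow A))"

end

definition locally_small :: "'u set \<Rightarrow> ('o, 'm, 'z) cat_scheme \<Rightarrow> bool" where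
  "locally_small U C \<longleftrightarrow> (\<forall>A \<in> Obj C. \<forall>B \<in> Obj C. small U (hom C A B))"

definition is_functor ::
  "('j, 'k, 'y) cat_scheme \<Rightarrow> ('o, 'm, 'z) cat_scheme \<Rightarrow> ('j \<Rightarrow> 'o) \<Rightarrow> ('k \<Rightarrow> 'm) \<Rightarrow> bool" where
  "is_functor J C Do Da \<longleftrightarrow>
     (\<forall>i \<in> Obj J. Do i \<in> Obj C \<and> Da (Idn J i) = Idn C (Do i)) \<and>
     (\<forall>u \<in> Arr J. Da u \<in> hom C (Do (Dom J u)) (Do (Cod J u))) \<and>
     (\<forall>u \<in> Arr J. \<forall>v \<in> Arr J. Dom J v = Cod J u \<longrightarrow> Da (v \<cdot>\<^bsub>J\<^esub> u) = Da v \<cdot>\<^bsub>C\<^esub> Da u)"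

definition is_cone ::
  "('j, 'k, 'y) cat_scheme \<Rightarrow> ('o, 'm, 'z) cat_scheme \<Rightarrow> ('j \<Rightarrow> 'o) \<Rightarrow> ('k \<Rightarrow> 'm)
    \<Rightarrow> 'o \<Rightarrow> ('j \<Rightarrow> 'm) \<Rightarrow> bool" where
  "is_cone J C Do Da X p \<longleftrightarrow> X \<in> Obj C \<and> (\<forall>i \<in> Obj J. p i \<in> hom C X (Do i)) \<and>
     (\<forall>u \<in> Arr J. Da u \<cdot>\<^bsub>C\<^esub> p (Dom J u) = p (Cod J u))"

definition is_limit ::
  "('j, 'k, 'y) cat_scheme \<Rightarrow> ('o, 'm, 'z) cat_scheme \<Rightarrow> ('j \<Rightarrow> 'o) \<Rightarrow> ('k \<Rightarrow> 'm)
    \<Rightarrow> 'o \<Rightarrow> ('j \<Rightarrow> 'm) \<Rightarrow> bool" where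
  "is_limit J C Do Da X p \<longleftrightarrow> is_cone J C Do Da X p \<and>
     (\<forall>Y q. is_cone J C Do Da Y q \<longrightarrow> (\<exists>!f. f \<in> hom C Y X \<and> (\<forall>i \<in> Obj J. p i \<cdot>\<^bsub>C\<^esub> f = q i)))"

definition complete_cat :: "'u set \<Rightarrow> ('o, 'm, 'z) cat_scheme \<Rightarrow> bool" where
  "complete_cat U C \<longleftrightarrow>
     (\<forall>(J :: ('u, 'u) cat) Do Da.
        category J \<and> small U (Obj J) \<and> small U (Arr J) \<and> is_functor J C Do Da
        \<longrightarrow> (\<exists>X p. is_limit J C Do Da X p))"

definition cocomplete_cat :: "'u set \<Rightarrow> ('o, 'm, 'z) cat_scheme \<Rightarrow> bool" where
  "cocomplete_cat U C \<longleftrightarrow> complete_cat U (op_cat C)"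

definition is_equalizer :: "('o, 'm, 'z) cat_scheme \<Rightarrow> 'm \<Rightarrow> 'm \<Rightarrow> 'o \<Rightarrow> 'm \<Rightarrow> bool" where
  "is_equalizer C f g E e \<longleftrightarrow> e \<in> hom C E (Dom C f) \<and> f \<cdot>\<^bsub>C\<^esub> e = g \<cdot>\<^bsub>C\<^esub> e \<and>
     (\<forall>X x. x \<in> hom C X (Dom C f) \<and> f \<cdot>\<^bsub>C\<^esub> x = g \<cdot>\<^bsub>C\<^esub> x
        \<longrightarrow> (\<exists>!h. h \<in> hom C X E \<and> e \<cdot>\<^bsub>C\<^esub> h = x))"

definition equalizer :: "('o, 'm, 'z) cat_scheme \<Rightarrow> 'm \<Rightarrow> 'm \<Rightarrow> 'o \<times> 'm" where
  "equalizer C f g = (SOME (E, e). is_equalizer C f g E e)"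

definition initial_obj :: "('o, 'm, 'z) cat_scheme \<Rightarrow> 'o" where
  "initial_obj C = (SOME Z. Z \<in> Obj C \<and> (\<forall>A \<in> Obj C. \<exists>!f. f \<in> hom C Z A))"

section \<open>Symmetric monoidal closed categories\<close>

record ('o, 'm) smc = "('o, 'm) cat" +
  ten :: "'o \<Rightarrow> 'o \<Rightarrow> 'o"  (infixr "\<odot>\<index>" 75)
  tena :: "'m \<Rightarrow> 'm \<Rightarrow> 'm"  (infixr "\<otimes>\<index>" 75)
  munit :: 'o  ("\<one>\<index>")
  assoc :: "'o \<Rightarrow> 'o \<Rightarrow> 'o \<Rightarrow> 'm"
  lunit :: "'o \<Rightarrow> 'm"
  runit :: "'o \<Rightarrow> 'm"
  sym :: "'o \<Rightarrow> 'o \<Rightarrow> 'm"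
  ihom :: "'o \<Rightarrow> 'o \<Rightarrow> 'o"
  ev :: "'o \<Rightarrow> 'o \<Rightarrow> 'm"

text \<open>
  The coherence axioms are those of Mac Lane.  Closedness is the universal property of the
  evaluations \<open>ev B D : ihom B D \<odot> B \<rightarrow> D\<close>, that is, \<open>ihom B\<close> is right adjoint to
  tensoring with \<open>B\<close>.
\<close>

locale sym_monoidal_closed = category V for V :: "('o, 'm) smc" (structure) +
  assumes ten_in: "\<lbrakk>A \<in> Obj V; B \<in> Obj V\<rbrakk> \<Longrightarrow> A \<odot> B \<in> Obj V"
    and tena_in: "\<lbrakk>f \<in> hom V A B; g \<in> hom V A' B'\<rbrakk> \<Longrightarrow> f \<otimes> g \<in> hom V (A \<odot> A') (B \<odot> B')"
    and tena_Idn: "\<lbrakk>A \<in> Obj V; B \<in> Obj V\<rbrakk> \<Longrightarrow> Idn V A \<otimes> Idn V B = Idn V (A \<odot> B)"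
    and tena_Cmp: "\<lbrakk>f \<in> hom V A B; g \<in> hom V B D; f' \<in> hom V A' B'; g' \<in> hom V B' D'\<rbrakk>
      \<Longrightarrow> (g \<cdot> f) \<otimes> (g' \<cdot> f') = (g \<otimes> g') \<cdot> (f \<otimes> f')"
    and munit_in: "\<one> \<in> Obj V"
    and assoc_in: "\<lbrakk>A \<in> Obj V; B \<in> Obj V; D \<in> Obj V\<rbrakk>
      \<Longrightarrow> assoc V A B D \<in> hom V ((A \<odot> B) \<odot> D) (A \<odot> (B \<odot> D))"
    and assoc_iso: "\<lbrakk>A \<in> Obj V; B \<in> Obj V; D \<in> Obj V\<rbrakk> \<Longrightarrow> is_iso V (assoc V A B D)"
    and assoc_natural: "\<lbrakk>f \<in> hom V A A'; g \<in> hom V B B'; h \<in> hom V D D'\<rbrakk>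
      \<Longrightarrow> assoc V A' B' D' \<cdot> ((f \<otimes> g) \<otimes> h) = (f \<otimes> (g \<otimes> h)) \<cdot> assoc V A B D"
    and lunit_in: "A \<in> Obj V \<Longrightarrow> lunit V A \<in> hom V (\<one> \<odot> A) A"
    and lunit_iso: "A \<in> Obj V \<Longrightarrow> is_iso V (lunit V A)"
    and lunit_natural: "f \<in> hom V A B \<Longrightarrow> lunit V B \<cdot> (Idn V \<one> \<otimes> f) = f \<cdot> lunit V A"
    and runit_in: "A \<in> Obj V \<Longrightarrow> runit V A \<in> hom V (A \<odot> \<one>) A"
    and runit_iso: "A \<in> Obj V \<Longrightarrow> is_iso V (runit V A)"
    and runit_natural: "f \<in> hom V A B \<Longrightarrow> runit V B \<cdot> (f \<otimes> Idn V \<one>) = f \<cdot> runit V A"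
    and sym_in: "\<lbrakk>A \<in> Obj V; B \<in> Obj V\<rbrakk> \<Longrightarrow> sym V A B \<in> hom V (A \<odot> B) (B \<odot> A)"
    and sym_natural: "\<lbrakk>f \<in> hom V A A'; g \<in> hom V B B'\<rbrakk>
      \<Longrightarrow> sym V A' B' \<cdot> (f \<otimes> g) = (g \<otimes> f) \<cdot> sym V A B"
    and sym_sym: "\<lbrakk>A \<in> Obj V; B \<in> Obj V\<rbrakk> \<Longrightarrow> sym V B A \<cdot> sym V A B = Idn V (A \<odot> B)"
    and pentagon: "\<lbrakk>A \<in> Obj V; B \<in> Obj V; D \<in> Obj V; E \<in> Obj V\<rbrakk>
      \<Longrightarrow> assoc V A B (D \<odot> E) \<cdot> assoc V (A \<odot> B) D E
        = (Idn V A \<otimes> assoc V B D E) \<cdot> assoc V A (B \<odot> D) E \<cdot> (assoc V A B D \<otimes> Idn V E)"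
    and triangle: "\<lbrakk>A \<in> Obj V; B \<in> Obj V\<rbrakk>
      \<Longrightarrow> (Idn V A \<otimes> lunit V B) \<cdot> assoc V A \<one> B = runit V A \<otimes> Idn V B"
    and lunit_munit: "lunit V \<one> = runit V \<one>"
    and hexagon: "\<lbrakk>A \<in> Obj V; B \<in> Obj V; D \<in> Obj V\<rbrakk>
      \<Longrightarrow> assoc V B D A \<cdot> sym V A (B \<odot> D) \<cdot> assoc V A B D
        = (Idn V B \<otimes> sym V A D) \<cdot> assoc V B A D \<cdot> (sym V A B \<otimes> Idn V D)"
    and lunit_sym: "A \<in> Obj V \<Longrightarrow> lunit V A \<cdot> sym V A \<one> = runit V A"
    and ihom_in: "\<lbrakk>B \<in> Obj V; D \<in> Obj V\<rbrakk> \<Longrightarrow> ihom V B D \<in> Obj V"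
    and ev_in: "\<lbrakk>B \<in> Obj V; D \<in> Obj V\<rbrakk> \<Longrightarrow> ev V B D \<in> hom V (ihom V B D \<odot> B) D"
    and closed: "\<lbrakk>A \<in> Obj V; B \<in> Obj V; D \<in> Obj V; f \<in> hom V (A \<odot> B) D\<rbrakk>
      \<Longrightarrow> \<exists>!g. g \<in> hom V A (ihom V B D) \<and> ev V B D \<cdot> (g \<otimes> Idn V B) = f"

definition curry :: "('o, 'm) smc \<Rightarrow> 'o \<Rightarrow> 'o \<Rightarrow> 'o \<Rightarrow> 'm \<Rightarrow> 'm" where
  "curry V A B D f =
     (THE g. g \<in> hom V A (ihom V B D) \<and> ev V B D \<cdot>\<^bsub>V\<^esub> (g \<otimes>\<^bsub>V\<^esub> Idn V B) = f)"

text \<open>The element \<open>\<one> \<rightarrow> ihom A B\<close> corresponding to an arrow \<open>f : A \<rightarrow> B\<close>.\<close>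

definition arr_name :: "('o, 'm) smc \<Rightarrow> 'o \<Rightarrow> 'o \<Rightarrow> 'm \<Rightarrow> 'm" where
  "arr_name V A B f = curry V \<one>\<^bsub>V\<^esub> A B (f \<cdot>\<^bsub>V\<^esub> lunit V A)"

section \<open>V-categories, V-functors, V-natural transformations\<close>

text \<open>
  \<open>VCmp A a b c\<close> is the composition \<open>A(b,c) \<odot> A(a,b) \<rightarrow> A(a,c)\<close>.  Elements of a hom object
  \<open>A(a,b)\<close> are arrows \<open>\<one> \<rightarrow> A(a,b)\<close>, i.e. arrows of the underlying category.
\<close>

record ('a, 'o, 'm) vcat =
  VOb :: "'a set"
  VHom :: "'a \<Rightarrow> 'a \<Rightarrow> 'o"
  VId :: "'a \<Rightarrow> 'm"
  VCmp :: "'a \<Rightarrow> 'a \<Rightarrow> 'a \<Rightarrow> 'm"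

locale vcategory = sym_monoidal_closed V
  for V :: "('o, 'm) smc" (structure) and A :: "('a, 'o, 'm) vcat" +
  assumes VHom_in: "\<lbrakk>a \<in> VOb A; b \<in> VOb A\<rbrakk> \<Longrightarrow> VHom A a b \<in> Obj V"
    and VId_in: "a \<in> VOb A \<Longrightarrow> VId A a \<in> hom V \<one> (VHom A a a)"
    and VCmp_in: "\<lbrakk>a \<in> VOb A; b \<in> VOb A; c \<in> VOb A\<rbrakk>
      \<Longrightarrow> VCmp A a b c \<in> hom V (VHom A b c \<odot> VHom A a b) (VHom A a c)"
    and VCmp_assoc: "\<lbrakk>a \<in> VOb A; b \<in> VOb A; c \<in> VOb A; d \<in> VOb A\<rbrakk>
      \<Longrightarrow> VCmp A a b d \<cdot> (VCmp A b c d \<otimes> Idn V (VHom A a b))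
        = VCmp A a c d \<cdot> (Idn V (VHom A c d) \<otimes> VCmp A a b c)
            \<cdot> assoc V (VHom A c d) (VHom A b c) (VHom A a b)"
    and VId_left: "\<lbrakk>a \<in> VOb A; b \<in> VOb A\<rbrakk>
      \<Longrightarrow> VCmp A a b b \<cdot> (VId A b \<otimes> Idn V (VHom A a b)) = lunit V (VHom A a b)"
    and VId_right: "\<lbrakk>a \<in> VOb A; b \<in> VOb A\<rbrakk>
      \<Longrightarrow> VCmp A a a b \<cdot> (Idn V (VHom A a b) \<otimes> VId A a) = runit V (VHom A a b)"

text \<open>
  V-functors are extensional (undefined off the objects), so that equality of the records is
  equality of V-functors.
\<close>

record ('a, 'b, 'm) vfun =
  FOb :: "'a \<Rightarrow> 'b"
  FHom :: "'a \<Rightarrow> 'a \<Rightarrow> 'm"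

locale vfunctor = vcategory V A + B: vcategory V B
  for V :: "('o, 'm) smc" (structure)
    and A :: "('a, 'o, 'm) vcat" and B :: "('b, 'o, 'm) vcat" +
  fixes F :: "('a, 'b, 'm) vfun"
  assumes FOb_in: "a \<in> VOb A \<Longrightarrow> FOb F a \<in> VOb B"
    and FHom_in: "\<lbrakk>a \<in> VOb A; b \<in> VOb A\<rbrakk>
      \<Longrightarrow> FHom F a b \<in> hom V (VHom A a b) (VHom B (FOb F a) (FOb F b))"
    and FHom_VCmp: "\<lbrakk>a \<in> VOb A; b \<in> VOb A; c \<in> VOb A\<rbrakk>
      \<Longrightarrow> FHom F a c \<cdot> VCmp A a b c
        = VCmp B (FOb F a) (FOb F b) (FOb F c) \<cdot> (FHom F b c \<otimes> FHom F a b)"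
    and FHom_VId: "a \<in> VOb A \<Longrightarrow> FHom F a a \<cdot> VId A a = VId B (FOb F a)"
    and FOb_ext: "a \<notin> VOb A \<Longrightarrow> FOb F a = undefined"
    and FHom_ext: "a \<notin> VOb A \<or> b \<notin> VOb A \<Longrightarrow> FHom F a b = undefined"

definition mk_vfun ::
  "('a, 'o, 'm) vcat \<Rightarrow> ('a \<Rightarrow> 'b) \<Rightarrow> ('a \<Rightarrow> 'a \<Rightarrow> 'm) \<Rightarrow> ('a, 'b, 'm) vfun" where
  "mk_vfun A fo fh = \<lparr>FOb = (\<lambda>a. if a \<in> VOb A then fo a else undefined),
     FHom = (\<lambda>a b. if a \<in> VOb A \<and> b \<in> VOb A then fh a b else undefined)\<rparr>"

definition vfun_id :: "('o, 'm) smc \<Rightarrow> ('a, 'o, 'm) vcat \<Rightarrow> ('a, 'a, 'm) vfun" where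
  "vfun_id V A = mk_vfun A (\<lambda>a. a) (\<lambda>a b. Idn V (VHom A a b))"

text \<open>\<open>vfun_comp V A G F\<close> is the composite of \<open>F : A \<rightarrow> B\<close> and \<open>G : B \<rightarrow> D\<close>.\<close>

definition vfun_comp :: "('o, 'm) smc \<Rightarrow> ('a, 'o, 'm) vcat \<Rightarrow> ('b, 'd, 'm) vfun
    \<Rightarrow> ('a, 'b, 'm) vfun \<Rightarrow> ('a, 'd, 'm) vfun" where
  "vfun_comp V A G F = mk_vfun A (\<lambda>a. FOb G (FOb F a))
     (\<lambda>a b. FHom G (FOb F a) (FOb F b) \<cdot>\<^bsub>V\<^esub> FHom F a b)"

definition iso_vfunctor ::
  "('o, 'm) smc \<Rightarrow> ('a, 'o, 'm) vcat \<Rightarrow> ('b, 'o, 'm) vcat \<Rightarrow> ('a, 'b, 'm) vfun \<Rightarrow> bool" where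
  "iso_vfunctor V A B F \<longleftrightarrow> vfunctor V A B F \<and>
     (\<exists>G. vfunctor V B A G \<and> vfun_comp V A G F = vfun_id V A \<and> vfun_comp V B F G = vfun_id V B)"

definition isomorphic_vcat ::
  "('o, 'm) smc \<Rightarrow> ('a, 'o, 'm) vcat \<Rightarrow> ('b, 'o, 'm) vcat \<Rightarrow> bool" where
  "isomorphic_vcat V A B \<longleftrightarrow> (\<exists>F. iso_vfunctor V A B F)"

text \<open>\<open>B(f,1) : B(y,z) \<rightarrow> B(x,z)\<close> for an element \<open>f : \<one> \<rightarrow> B(x,y)\<close>.\<close>

definition vpre :: "('o, 'm) smc \<Rightarrow> ('b, 'o, 'm) vcat \<Rightarrow> 'b \<Rightarrow> 'b \<Rightarrow> 'b \<Rightarrow> 'm \<Rightarrow> 'm" where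
  "vpre V B x y z f =
     VCmp B x y z \<cdot>\<^bsub>V\<^esub> (Idn V (VHom B y z) \<otimes>\<^bsub>V\<^esub> f) \<cdot>\<^bsub>V\<^esub> inverse_arr V (runit V (VHom B y z))"

text \<open>\<open>B(1,g) : B(x,y) \<rightarrow> B(x,z)\<close> for an element \<open>g : \<one> \<rightarrow> B(y,z)\<close>.\<close>

definition vpost :: "('o, 'm) smc \<Rightarrow> ('b, 'o, 'm) vcat \<Rightarrow> 'b \<Rightarrow> 'b \<Rightarrow> 'b \<Rightarrow> 'm \<Rightarrow> 'm" where
  "vpost V B x y z g =
     VCmp B x y z \<cdot>\<^bsub>V\<^esub> (g \<otimes>\<^bsub>V\<^esub> Idn V (VHom B x y)) \<cdot>\<^bsub>V\<^esub> inverse_arr V (lunit V (VHom B x y))"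

text \<open>Composition \<open>g f : \<one> \<rightarrow> B(x,z)\<close> in the underlying category of \<open>B\<close>.\<close>

definition vcomp :: "('o, 'm) smc \<Rightarrow> ('b, 'o, 'm) vcat \<Rightarrow> 'b \<Rightarrow> 'b \<Rightarrow> 'b \<Rightarrow> 'm \<Rightarrow> 'm \<Rightarrow> 'm" where
  "vcomp V B x y z g f =
     VCmp B x y z \<cdot>\<^bsub>V\<^esub> (g \<otimes>\<^bsub>V\<^esub> f) \<cdot>\<^bsub>V\<^esub> inverse_arr V (lunit V \<one>\<^bsub>V\<^esub>)"

locale vnat = F: vfunctor V A B F + G: vfunctor V A B G
  for V :: "('o, 'm) smc" (structure)
    and A :: "('a, 'o, 'm) vcat" and B :: "('b, 'o, 'm) vcat" and F G +
  fixes \<alpha> :: "'a \<Rightarrow> 'm"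
  assumes vnat_in: "a \<in> VOb A \<Longrightarrow> \<alpha> a \<in> hom V \<one> (VHom B (FOb F a) (FOb G a))"
    and vnat_natural: "\<lbrakk>a \<in> VOb A; b \<in> VOb A\<rbrakk>
      \<Longrightarrow> vpost V B (FOb F a) (FOb F b) (FOb G b) (\<alpha> b) \<cdot> FHom F a b
        = vpre V B (FOb F a) (FOb G a) (FOb G b) (\<alpha> a) \<cdot> FHom G a b"

section \<open>Functor V-categories\<close>

text \<open>
  The hom object \<open>[A,B](F,G)\<close> is the end of \<open>B(F-,G-)\<close>, i.e. the universal V-natural family
  \<open>\<beta>\<^sub>a : X \<rightarrow> B(Fa,Ga)\<close>.  V-naturality of such a family is the equality of two arrows
  \<open>A(a,b) \<rightarrow> ihom X (B(Fa,Gb))\<close>; here both sides are transposed to arrows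
  \<open>A(a,b) \<odot> X \<rightarrow> B(Fa,Gb)\<close>.
\<close>

definition vnat_family :: "('o, 'm) smc \<Rightarrow> ('a, 'o, 'm) vcat \<Rightarrow> ('b, 'o, 'm) vcat
    \<Rightarrow> ('a, 'b, 'm) vfun \<Rightarrow> ('a, 'b, 'm) vfun \<Rightarrow> 'o \<Rightarrow> ('a \<Rightarrow> 'm) \<Rightarrow> bool" where
  "vnat_family V A B F G X \<beta> \<longleftrightarrow> X \<in> Obj V \<and>
     (\<forall>a \<in> VOb A. \<beta> a \<in> hom V X (VHom B (FOb F a) (FOb G a))) \<and>
     (\<forall>a \<in> VOb A. \<forall>b \<in> VOb A.
        VCmp B (FOb F a) (FOb G a) (FOb G b) \<cdot>\<^bsub>V\<^esub> (FHom G a b \<otimes>\<^bsub>V\<^esub> \<beta> a)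
        = VCmp B (FOb F a) (FOb F b) (FOb G b) \<cdot>\<^bsub>V\<^esub> (\<beta> b \<otimes>\<^bsub>V\<^esub> FHom F a b)
            \<cdot>\<^bsub>V\<^esub> sym V (VHom A a b) X)"

definition is_end :: "('o, 'm) smc \<Rightarrow> ('a, 'o, 'm) vcat \<Rightarrow> ('b, 'o, 'm) vcat
    \<Rightarrow> ('a, 'b, 'm) vfun \<Rightarrow> ('a, 'b, 'm) vfun \<Rightarrow> 'o \<Rightarrow> ('a \<Rightarrow> 'm) \<Rightarrow> bool" where
  "is_end V A B F G E p \<longleftrightarrow> vnat_family V A B F G E p \<and>
     (\<forall>X \<beta>. vnat_family V A B F G X \<beta>
        \<longrightarrow> (\<exists>!f. f \<in> hom V X E \<and> (\<forall>a \<in> VOb A. p a \<cdot>\<^bsub>V\<^esub> f = \<beta> a)))"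

definition fun_end :: "('o, 'm) smc \<Rightarrow> ('a, 'o, 'm) vcat \<Rightarrow> ('b, 'o, 'm) vcat
    \<Rightarrow> ('a, 'b, 'm) vfun \<Rightarrow> ('a, 'b, 'm) vfun \<Rightarrow> 'o \<times> ('a \<Rightarrow> 'm)" where
  "fun_end V A B F G = (SOME (E, p). is_end V A B F G E p)"

abbreviation fun_hom :: "('o, 'm) smc \<Rightarrow> ('a, 'o, 'm) vcat \<Rightarrow> ('b, 'o, 'm) vcat
    \<Rightarrow> ('a, 'b, 'm) vfun \<Rightarrow> ('a, 'b, 'm) vfun \<Rightarrow> 'o" where
  "fun_hom V A B F G \<equiv> fst (fun_end V A B F G)"

abbreviation fun_proj :: "('o, 'm) smc \<Rightarrow> ('a, 'o, 'm) vcat \<Rightarrow> ('b, 'o, 'm) vcat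
    \<Rightarrow> ('a, 'b, 'm) vfun \<Rightarrow> ('a, 'b, 'm) vfun \<Rightarrow> 'a \<Rightarrow> 'm" where
  "fun_proj V A B F G \<equiv> snd (fun_end V A B F G)"

definition functor_vcat :: "('o, 'm) smc \<Rightarrow> ('a, 'o, 'm) vcat \<Rightarrow> ('b, 'o, 'm) vcat
    \<Rightarrow> (('a, 'b, 'm) vfun, 'o, 'm) vcat" where
  "functor_vcat V A B = \<lparr>
     VOb = {F. vfunctor V A B F},
     VHom = fun_hom V A B,
     VId = (\<lambda>F. THE i. i \<in> hom V \<one>\<^bsub>V\<^esub> (fun_hom V A B F F) \<and>
        (\<forall>a \<in> VOb A. fun_proj V A B F F a \<cdot>\<^bsub>V\<^esub> i = VId B (FOb F a))),
     VCmp = (\<lambda>F G K. THE c.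
        c \<in> hom V (fun_hom V A B G K \<odot>\<^bsub>V\<^esub> fun_hom V A B F G) (fun_hom V A B F K) \<and>
        (\<forall>a \<in> VOb A. fun_proj V A B F K a \<cdot>\<^bsub>V\<^esub> c
           = VCmp B (FOb F a) (FOb G a) (FOb K a)
               \<cdot>\<^bsub>V\<^esub> (fun_proj V A B G K a \<otimes>\<^bsub>V\<^esub> fun_proj V A B F G a)))\<rparr>"

text \<open>Precomposition \<open>[J,1] : [C,B] \<rightarrow> [A,B]\<close> with a V-functor \<open>J : A \<rightarrow> C\<close>.\<close>

definition precomp :: "('o, 'm) smc \<Rightarrow> ('a, 'o, 'm) vcat \<Rightarrow> ('c, 'o, 'm) vcat \<Rightarrow> ('b, 'o, 'm) vcat
    \<Rightarrow> ('a, 'c, 'm) vfun \<Rightarrow> (('c, 'b, 'm) vfun, ('a, 'b, 'm) vfun, 'm) vfun" where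
  "precomp V A C B J = mk_vfun (functor_vcat V C B) (\<lambda>F. vfun_comp V A F J)
     (\<lambda>F G. THE f.
        f \<in> hom V (fun_hom V C B F G) (fun_hom V A B (vfun_comp V A F J) (vfun_comp V A G J)) \<and>
        (\<forall>a \<in> VOb A. fun_proj V A B (vfun_comp V A F J) (vfun_comp V A G J) a \<cdot>\<^bsub>V\<^esub> f
           = fun_proj V C B F G (FOb J a)))"

section \<open>Weighted colimits and Kan extensions\<close>

definition self_vcat :: "('o, 'm) smc \<Rightarrow> ('o, 'o, 'm) vcat" where
  "self_vcat V = \<lparr>VOb = Obj V, VHom = ihom V,
     VId = (\<lambda>X. curry V \<one>\<^bsub>V\<^esub> X X (lunit V X)),
     VCmp = (\<lambda>X Y Z. curry V (ihom V Y Z \<odot>\<^bsub>V\<^esub> ihom V X Y) X Z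
        (ev V Y Z \<cdot>\<^bsub>V\<^esub> (Idn V (ihom V Y Z) \<otimes>\<^bsub>V\<^esub> ev V X Y)
           \<cdot>\<^bsub>V\<^esub> assoc V (ihom V Y Z) (ihom V X Y) X))\<rparr>"

definition op_vcat :: "('o, 'm) smc \<Rightarrow> ('a, 'o, 'm) vcat \<Rightarrow> ('a, 'o, 'm) vcat" where
  "op_vcat V A = \<lparr>VOb = VOb A, VHom = (\<lambda>a b. VHom A b a), VId = VId A,
     VCmp = (\<lambda>a b c. VCmp A c b a \<cdot>\<^bsub>V\<^esub> sym V (VHom A c b) (VHom A b a))\<rparr>"

definition op_vfun :: "('a, 'b, 'm) vfun \<Rightarrow> ('a, 'b, 'm) vfun" where
  "op_vfun F = \<lparr>FOb = FOb F, FHom = (\<lambda>a b. FHom F b a)\<rparr>"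

text \<open>The representable V-functors \<open>B(x,-) : B \<rightarrow> V\<close> and \<open>B(-,x) : B\<^sup>o\<^sup>p \<rightarrow> V\<close>.\<close>

definition hom_from :: "('o, 'm) smc \<Rightarrow> ('b, 'o, 'm) vcat \<Rightarrow> 'b \<Rightarrow> ('b, 'o, 'm) vfun" where
  "hom_from V B x = mk_vfun B (VHom B x)
     (\<lambda>y z. curry V (VHom B y z) (VHom B x y) (VHom B x z) (VCmp B x y z))"

definition hom_into :: "('o, 'm) smc \<Rightarrow> ('b, 'o, 'm) vcat \<Rightarrow> 'b \<Rightarrow> ('b, 'o, 'm) vfun" where
  "hom_into V B x = mk_vfun B (\<lambda>y. VHom B y x)
     (\<lambda>y z. curry V (VHom B z y) (VHom B y x) (VHom B z x)
        (VCmp B z y x \<cdot>\<^bsub>V\<^esub> sym V (VHom B z y) (VHom B y x)))"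

definition hom_into_along :: "('o, 'm) smc \<Rightarrow> ('a, 'o, 'm) vcat \<Rightarrow> ('b, 'o, 'm) vcat
    \<Rightarrow> ('a, 'b, 'm) vfun \<Rightarrow> 'b \<Rightarrow> ('a, 'o, 'm) vfun" where
  "hom_into_along V A B D x = vfun_comp V (op_vcat V A) (hom_into V B x) (op_vfun D)"

text \<open>
  \<open>c\<close> is the colimit of \<open>D : K \<rightarrow> L\<close> weighted by \<open>W : K\<^sup>o\<^sup>p \<rightarrow> V\<close>, with unit
  \<open>\<nu> : W \<rightarrow> L(D-,c)\<close>.  The last conjunct says that the arrows
  \<open>L(c,x) \<rightarrow> ihom (L(Dk,c)) (L(Dk,x)) \<rightarrow> ihom (W k) (L(Dk,x))\<close> induced by \<open>\<nu>\<close> exhibit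
  \<open>L(c,x)\<close> as the hom object \<open>[K\<^sup>o\<^sup>p,V](W, L(D-,x))\<close>.
\<close>

definition is_wcolim :: "('o, 'm) smc \<Rightarrow> ('k, 'o, 'm) vcat \<Rightarrow> ('l, 'o, 'm) vcat
    \<Rightarrow> ('k, 'o, 'm) vfun \<Rightarrow> ('k, 'l, 'm) vfun \<Rightarrow> 'l \<Rightarrow> ('k \<Rightarrow> 'm) \<Rightarrow> bool" where
  "is_wcolim V K L W D c \<nu> \<longleftrightarrow>
     vfunctor V (op_vcat V K) (self_vcat V) W \<and> vfunctor V K L D \<and> c \<in> VOb L \<and>
     vnat V (op_vcat V K) (self_vcat V) W (hom_into_along V K L D c) \<nu> \<and>
     (\<forall>x \<in> VOb L. is_end V (op_vcat V K) (self_vcat V) W (hom_into_along V K L D x) (VHom L c x)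
        (\<lambda>k. vpre V (self_vcat V) (FOb W k) (VHom L (FOb D k) c) (VHom L (FOb D k) x) (\<nu> k)
           \<cdot>\<^bsub>V\<^esub> FHom (hom_from V L (FOb D k)) c x))"

definition cocomplete_vcat :: "'u set \<Rightarrow> ('o, 'm) smc \<Rightarrow> ('l, 'o, 'm) vcat \<Rightarrow> bool" where
  "cocomplete_vcat U V L \<longleftrightarrow>
     (\<forall>(K :: ('u, 'o, 'm) vcat) W D.
        vcategory V K \<and> small U (VOb K) \<and>
        vfunctor V (op_vcat V K) (self_vcat V) W \<and> vfunctor V K L D
        \<longrightarrow> (\<exists>c \<nu>. is_wcolim V K L W D c \<nu>))"

text \<open>
  \<open>N : C \<rightarrow> L\<close> with \<open>\<phi> : F \<rightarrow> N J\<close> is the (pointwise) left Kan extension of \<open>F : A \<rightarrow> L\<close> along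
  \<open>J : A \<rightarrow> C\<close>: each \<open>N c\<close> is the colimit of \<open>F\<close> weighted by \<open>C(J-,c)\<close>, with unit
  \<open>C(Ja,c) \<rightarrow> L(NJa,Nc) \<rightarrow> L(Fa,Nc)\<close>.
\<close>

definition is_left_kan :: "('o, 'm) smc \<Rightarrow> ('a, 'o, 'm) vcat \<Rightarrow> ('c, 'o, 'm) vcat
    \<Rightarrow> ('l, 'o, 'm) vcat \<Rightarrow> ('a, 'c, 'm) vfun \<Rightarrow> ('a, 'l, 'm) vfun \<Rightarrow> ('c, 'l, 'm) vfun
    \<Rightarrow> ('a \<Rightarrow> 'm) \<Rightarrow> bool" where
  "is_left_kan V A C L J F N \<phi> \<longleftrightarrow>
     vfunctor V A C J \<and> vfunctor V C L N \<and> vnat V A L F (vfun_comp V A N J) \<phi> \<and>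
     (\<forall>c \<in> VOb C. is_wcolim V A L (hom_into_along V A C J c) F (FOb N c)
        (\<lambda>a. arr_name V (VHom C (FOb J a) c) (VHom L (FOb F a) (FOb N c))
           (vpre V L (FOb F a) (FOb N (FOb J a)) (FOb N c) (\<phi> a) \<cdot>\<^bsub>V\<^esub> FHom N (FOb J a) c)))"

section \<open>V-adjunctions, V-monads, Eilenberg-Moore objects\<close>

text \<open>\<open>F : M \<rightarrow> B\<close> is left adjoint to \<open>G : B \<rightarrow> M\<close>.\<close>

locale vadjunction = F: vfunctor V M B F + G: vfunctor V B M G +
    unit: vnat V M M "vfun_id V M" "vfun_comp V M G F" \<eta> +
    counit: vnat V B B "vfun_comp V B F G" "vfun_id V B" \<epsilon>
  for V :: "('o, 'm) smc" and M :: "('x, 'o, 'm) vcat" and B :: "('b, 'o, 'm) vcat"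
    and F G \<eta> \<epsilon> +
  assumes triangle_F: "x \<in> VOb M \<Longrightarrow>
      vcomp V B (FOb F x) (FOb F (FOb G (FOb F x))) (FOb F x)
        (\<epsilon> (FOb F x)) (FHom F x (FOb G (FOb F x)) \<cdot>\<^bsub>V\<^esub> \<eta> x) = VId B (FOb F x)"
    and triangle_G: "b \<in> VOb B \<Longrightarrow>
      vcomp V M (FOb G b) (FOb G (FOb F (FOb G b))) (FOb G b)
        (FHom G (FOb F (FOb G b)) b \<cdot>\<^bsub>V\<^esub> \<epsilon> b) (\<eta> (FOb G b)) = VId M (FOb G b)"

locale vmonad = T: vfunctor V M M T +
    unit: vnat V M M "vfun_id V M" T \<eta> +
    mult: vnat V M M "vfun_comp V M T T" T \<mu>
  for V :: "('o, 'm) smc" and M :: "('x, 'o, 'm) vcat" and T \<eta> \<mu> +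
  assumes mult_assoc: "x \<in> VOb M \<Longrightarrow>
      vcomp V M (FOb T (FOb T (FOb T x))) (FOb T (FOb T x)) (FOb T x)
        (\<mu> x) (FHom T (FOb T (FOb T x)) (FOb T x) \<cdot>\<^bsub>V\<^esub> \<mu> x)
      = vcomp V M (FOb T (FOb T (FOb T x))) (FOb T (FOb T x)) (FOb T x) (\<mu> x) (\<mu> (FOb T x))"
    and mult_unit_left: "x \<in> VOb M \<Longrightarrow>
      vcomp V M (FOb T x) (FOb T (FOb T x)) (FOb T x) (\<mu> x) (\<eta> (FOb T x)) = VId M (FOb T x)"
    and mult_unit_right: "x \<in> VOb M \<Longrightarrow>
      vcomp V M (FOb T x) (FOb T (FOb T x)) (FOb T x) (\<mu> x) (FHom T x (FOb T x) \<cdot>\<^bsub>V\<^esub> \<eta> x)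
      = VId M (FOb T x)"

definition is_algebra :: "('o, 'm) smc \<Rightarrow> ('x, 'o, 'm) vcat \<Rightarrow> ('x, 'x, 'm) vfun \<Rightarrow> ('x \<Rightarrow> 'm)
    \<Rightarrow> ('x \<Rightarrow> 'm) \<Rightarrow> 'x \<Rightarrow> 'm \<Rightarrow> bool" where
  "is_algebra V M T \<eta> \<mu> x h \<longleftrightarrow> x \<in> VOb M \<and> h \<in> hom V \<one>\<^bsub>V\<^esub> (VHom M (FOb T x) x) \<and>
     vcomp V M x (FOb T x) x h (\<eta> x) = VId M x \<and>
     vcomp V M (FOb T (FOb T x)) (FOb T x) x h (\<mu> x)
       = vcomp V M (FOb T (FOb T x)) (FOb T x) x h (FHom T (FOb T x) x \<cdot>\<^bsub>V\<^esub> h)"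

definition em_equalizer :: "('o, 'm) smc \<Rightarrow> ('x, 'o, 'm) vcat \<Rightarrow> ('x, 'x, 'm) vfun
    \<Rightarrow> 'x \<times> 'm \<Rightarrow> 'x \<times> 'm \<Rightarrow> 'o \<times> 'm" where
  "em_equalizer V M T = (\<lambda>(x, h) (y, k). equalizer V
     (vpre V M (FOb T x) x y h)
     (vpost V M (FOb T x) (FOb T y) y k \<cdot>\<^bsub>V\<^esub> FHom T x y))"

abbreviation em_hom :: "('o, 'm) smc \<Rightarrow> ('x, 'o, 'm) vcat \<Rightarrow> ('x, 'x, 'm) vfun
    \<Rightarrow> 'x \<times> 'm \<Rightarrow> 'x \<times> 'm \<Rightarrow> 'o" where
  "em_hom V M T p q \<equiv> fst (em_equalizer V M T p q)"

abbreviation em_incl :: "('o, 'm) smc \<Rightarrow> ('x, 'o, 'm) vcat \<Rightarrow> ('x, 'x, 'm) vfun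
    \<Rightarrow> 'x \<times> 'm \<Rightarrow> 'x \<times> 'm \<Rightarrow> 'm" where
  "em_incl V M T p q \<equiv> snd (em_equalizer V M T p q)"

definition em_vcat :: "('o, 'm) smc \<Rightarrow> ('x, 'o, 'm) vcat \<Rightarrow> ('x, 'x, 'm) vfun \<Rightarrow> ('x \<Rightarrow> 'm)
    \<Rightarrow> ('x \<Rightarrow> 'm) \<Rightarrow> ('x \<times> 'm, 'o, 'm) vcat" where
  "em_vcat V M T \<eta> \<mu> = \<lparr>
     VOb = {(x, h). is_algebra V M T \<eta> \<mu> x h},
     VHom = em_hom V M T,
     VId = (\<lambda>p. THE i. i \<in> hom V \<one>\<^bsub>V\<^esub> (em_hom V M T p p) \<and>
        em_incl V M T p p \<cdot>\<^bsub>V\<^esub> i = VId M (fst p)),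
     VCmp = (\<lambda>p q r. THE c.
        c \<in> hom V (em_hom V M T q r \<odot>\<^bsub>V\<^esub> em_hom V M T p q) (em_hom V M T p r) \<and>
        em_incl V M T p r \<cdot>\<^bsub>V\<^esub> c
          = VCmp M (fst p) (fst q) (fst r) \<cdot>\<^bsub>V\<^esub> (em_incl V M T q r \<otimes>\<^bsub>V\<^esub> em_incl V M T p q))\<rparr>"

definition em_forget :: "('o, 'm) smc \<Rightarrow> ('x, 'o, 'm) vcat \<Rightarrow> ('x, 'x, 'm) vfun \<Rightarrow> ('x \<Rightarrow> 'm)
    \<Rightarrow> ('x \<Rightarrow> 'm) \<Rightarrow> ('x \<times> 'm, 'x, 'm) vfun" where
  "em_forget V M T \<eta> \<mu> = mk_vfun (em_vcat V M T \<eta> \<mu>) fst (em_incl V M T)"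

text \<open>The monad \<open>(G F, \<eta>, G \<epsilon> F)\<close> on \<open>M\<close> induced by an adjunction.\<close>

definition adj_mult :: "('o, 'm) smc \<Rightarrow> ('x, 'b, 'm) vfun \<Rightarrow> ('b, 'x, 'm) vfun \<Rightarrow> ('b \<Rightarrow> 'm)
    \<Rightarrow> 'x \<Rightarrow> 'm" where
  "adj_mult V F G \<epsilon> = (\<lambda>x. FHom G (FOb F (FOb G (FOb F x))) (FOb F x) \<cdot>\<^bsub>V\<^esub> \<epsilon> (FOb F x))"

definition adj_em :: "('o, 'm) smc \<Rightarrow> ('x, 'o, 'm) vcat \<Rightarrow> ('x, 'b, 'm) vfun \<Rightarrow> ('b, 'x, 'm) vfun
    \<Rightarrow> ('x \<Rightarrow> 'm) \<Rightarrow> ('b \<Rightarrow> 'm) \<Rightarrow> ('x \<times> 'm, 'o, 'm) vcat" where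
  "adj_em V M F G \<eta> \<epsilon> = em_vcat V M (vfun_comp V M G F) \<eta> (adj_mult V F G \<epsilon>)"

text \<open>The comparison V-functor sends \<open>b\<close> to the algebra \<open>(G b, G \<epsilon>\<^sub>b)\<close>.\<close>

definition comparison_ob :: "('o, 'm) smc \<Rightarrow> ('x, 'b, 'm) vfun \<Rightarrow> ('b, 'x, 'm) vfun
    \<Rightarrow> ('b \<Rightarrow> 'm) \<Rightarrow> 'b \<Rightarrow> 'x \<times> 'm" where
  "comparison_ob V F G \<epsilon> b = (FOb G b, FHom G (FOb F (FOb G b)) b \<cdot>\<^bsub>V\<^esub> \<epsilon> b)"

definition comparison :: "('o, 'm) smc \<Rightarrow> ('x, 'o, 'm) vcat \<Rightarrow> ('b, 'o, 'm) vcat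
    \<Rightarrow> ('x, 'b, 'm) vfun \<Rightarrow> ('b, 'x, 'm) vfun \<Rightarrow> ('b \<Rightarrow> 'm) \<Rightarrow> ('b, 'x \<times> 'm, 'm) vfun" where
  "comparison V M B F G \<epsilon> = mk_vfun B (comparison_ob V F G \<epsilon>)
     (\<lambda>b d. let p = comparison_ob V F G \<epsilon> b; q = comparison_ob V F G \<epsilon> d; T = vfun_comp V M G F in
        THE k. k \<in> hom V (VHom B b d) (em_hom V M T p q) \<and> em_incl V M T p q \<cdot>\<^bsub>V\<^esub> k = FHom G b d)"

definition strictly_monadic :: "('o, 'm) smc \<Rightarrow> ('x, 'o, 'm) vcat \<Rightarrow> ('b, 'o, 'm) vcat
    \<Rightarrow> ('x, 'b, 'm) vfun \<Rightarrow> ('b, 'x, 'm) vfun \<Rightarrow> ('x \<Rightarrow> 'm) \<Rightarrow> ('b \<Rightarrow> 'm) \<Rightarrow> bool" where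
  "strictly_monadic V M B F G \<eta> \<epsilon> \<longleftrightarrow>
     vadjunction V M B F G \<eta> \<epsilon> \<and>
     vmonad V M (vfun_comp V M G F) \<eta> (adj_mult V F G \<epsilon>) \<and>
     iso_vfunctor V B (adj_em V M F G \<eta> \<epsilon>) (comparison V M B F G \<epsilon>) \<and>
     vfun_comp V B (em_forget V M (vfun_comp V M G F) \<eta> (adj_mult V F G \<epsilon>))
       (comparison V M B F G \<epsilon>) = G"

section \<open>The discrete V-category on the objects and the Kan adjunction\<close>

text \<open>
  If one of the two hom objects is initial then so is their tensor product, hence the
  composition given by \<open>THE\<close> is the only arrow of its type.
\<close>

definition discrete_vcat :: "('o, 'm) smc \<Rightarrow> 'a set \<Rightarrow> ('a, 'o, 'm) vcat" where
  "discrete_vcat V S =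
     (let h = (\<lambda>a b. if a = b then \<one>\<^bsub>V\<^esub> else initial_obj V) in
      \<lparr>VOb = S, VHom = h, VId = (\<lambda>a. Idn V \<one>\<^bsub>V\<^esub>),
       VCmp = (\<lambda>a b c. if a = b \<and> b = c then lunit V \<one>\<^bsub>V\<^esub>
                 else (THE f. f \<in> hom V (h b c \<odot>\<^bsub>V\<^esub> h a b) (h a c)))\<rparr>)"

definition ob_vcat :: "('o, 'm) smc \<Rightarrow> ('a, 'o, 'm) vcat \<Rightarrow> ('a, 'o, 'm) vcat" where
  "ob_vcat V P = discrete_vcat V (VOb P)"

definition ob_incl :: "('o, 'm) smc \<Rightarrow> ('a, 'o, 'm) vcat \<Rightarrow> ('a, 'a, 'm) vfun" where
  "ob_incl V P = mk_vfun (ob_vcat V P) (\<lambda>a. a)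
     (\<lambda>a b. if a = b then VId P a else (THE f. f \<in> hom V (initial_obj V) (VHom P a b)))"

definition ob_restrict :: "('o, 'm) smc \<Rightarrow> ('p, 'o, 'm) vcat \<Rightarrow> ('l, 'o, 'm) vcat
    \<Rightarrow> (('p, 'l, 'm) vfun, ('p, 'l, 'm) vfun, 'm) vfun" where
  "ob_restrict V P L = precomp V (ob_vcat V P) P L (ob_incl V P)"

text \<open>
  The adjunction between left Kan extension along the inclusion of objects and restriction;
  \<open>\<eta> F\<close> is an element of a hom object of the functor V-category, whose components are
  obtained by composing with the projections of the end.
\<close>

definition kan_adjunction :: "('o, 'm) smc \<Rightarrow> ('p, 'o, 'm) vcat \<Rightarrow> ('l, 'o, 'm) vcat
    \<Rightarrow> (('p, 'l, 'm) vfun, ('p, 'l, 'm) vfun, 'm) vfun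
    \<Rightarrow> (('p, 'l, 'm) vfun \<Rightarrow> 'm) \<Rightarrow> (('p, 'l, 'm) vfun \<Rightarrow> 'm) \<Rightarrow> bool" where
  "kan_adjunction V P L Lan \<eta> \<epsilon> \<longleftrightarrow>
     vadjunction V (functor_vcat V (ob_vcat V P) L) (functor_vcat V P L)
       Lan (ob_restrict V P L) \<eta> \<epsilon> \<and>
     (\<forall>F. vfunctor V (ob_vcat V P) L F \<longrightarrow>
        is_left_kan V (ob_vcat V P) P L (ob_incl V P) F (FOb Lan F)
          (\<lambda>a. fun_proj V (ob_vcat V P) L F (vfun_comp V (ob_vcat V P) (FOb Lan F) (ob_incl V P)) a
             \<cdot>\<^bsub>V\<^esub> \<eta> F))"

end

theory Submission
  imports Defs
begin

text \<open>
  Write \<open>M = [ob P, L]\<close>, \<open>B = [P, L]\<close> and \<open>G = [H,1] : B \<rightarrow> M\<close>.  An object of \<open>M\<close> is just a family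
  of objects of \<open>L\<close>, and a V-functor \<open>b : P \<rightarrow> L\<close> is such a family together with an action
  \<open>P(a,c) \<rightarrow> L(b a, b c)\<close>.  An action transposes to arrows \<open>P(a,c) \<odot> b a \<rightarrow> b c\<close>, so it is the same
  thing as an arrow \<open>T b \<rightarrow> b\<close> where \<open>T x\<close> is the family of coproducts of copowers
  \<open>(T x) c = \<Sum>\<^sub>a P(a,c) \<odot> x a\<close>; the unit and associativity laws of an algebra are the functor axioms.
  This is why \<open>G\<close> is monadic, and the comparison is an isomorphism, not only an equivalence, because
  nothing but the action is added to the underlying family.

  The Kan adjunction exists for the following reason.  A hom object of \<open>ob P\<close> between distinct objects
  is initial and tensoring preserves initial objects, so V-naturality over \<open>ob P\<close> is an empty condition.
  A colimit \<open>N c\<close> of \<open>x\<close> weighted by \<open>P(-,c)\<close> therefore has a plain universal property: arrows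
  \<open>Z \<rightarrow> L(N c, y)\<close> correspond to families \<open>Z \<odot> P(a,c) \<rightarrow> L(x a, y)\<close> (\<open>is_wcolim_discrete_iff\<close>).  Through
  this property composition in \<open>P\<close> makes \<open>N\<close> a V-functor (\<open>lan_exists\<close>) and gives
  \<open>B(N,b) \<cong> M(x, G b)\<close> (\<open>lan_transpose_iso\<close>).  Such universal arrows assemble to a V-adjunction (locale
  \<open>universal_arrows\<close>).  The hom objects of \<open>B\<close> and \<open>M\<close> are ends, which exist because each is a single
  small limit (\<open>end_exists\<close>).

  Monadicity is then proved for an arbitrary V-adjunction \<open>Lan \<stileturn> G\<close> with unit \<open>\<eta>\<close> and counit
  \<open>\<epsilon>\<close>.  The coprojections \<open>P(a,c) \<rightarrow> L(x a, (Lan x) c)\<close> are obtained by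
  letting \<open>Lan x\<close> act and precomposing with \<open>\<eta>\<close>.  Two facts carry the argument.
  \<^item> Postcomposing the coprojections of \<open>G b\<close> with \<open>\<epsilon>\<^sub>b\<close> gives back the action of \<open>b\<close>
    (\<open>counit_lan_coproj\<close>).  Hence \<open>b\<close> is determined by its comparison algebra, and a generalized element of
    \<open>M(G b, G d)\<close> that satisfies the equation of algebra homomorphisms is V-natural over \<open>P\<close>
    (\<open>equalizing_family\<close>), so that \<open>G\<close> exhibits \<open>B(b,d)\<close> as the hom object of algebras.
  \<^item> Conversely, postcomposing the coprojections with the structure \<open>h\<close> of an algebra defines an
    action, for which \<open>h\<close> is V-natural; as \<open>h\<close> and the counit have the same transpose, they agree
    (\<open>algebra_is_comparison\<close>).

  All computations take place in the category \<open>V\<close>.  Global elements \<open>\<one> \<rightarrow> A(a,b)\<close> act on hom objects by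
  \<open>vpost\<close> and \<open>vpre\<close>, and the rules relating these to composition (\<open>VCmp_vpost\<close>, \<open>VCmp_vpre\<close>,
  \<open>VCmp_middle\<close>) absorb the unit coherence; the hexagon is needed only where two generalized elements
  change places, in \<open>composite_family\<close> and \<open>lan_transpose_iso\<close>.
\<close>

section \<open>Arrows and isomorphisms in a category\<close>

context category begin

lemma in_hom_iff [simp]: "f \<in> hom C A B \<longleftrightarrow> f \<in> Arr C \<and> Dom C f = A \<and> Cod C f = B"
  by (simp add: hom_def)

lemma Dom_Cod_in [simp]: "f \<in> Arr C \<Longrightarrow> Dom C f \<in> Obj C" "f \<in> Arr C \<Longrightarrow> Cod C f \<in> Obj C"
  by (simp_all add: Dom_in Cod_in)

lemma Idn_types [simp]:
  assumes "A \<in> Obj C"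
  shows "Idn C A \<in> Arr C" "Dom C (Idn C A) = A" "Cod C (Idn C A) = A"
  using Idn_in[OF assms] by simp_all

lemma Cmp_types [simp]:
  assumes "f \<in> Arr C" "g \<in> Arr C" "Dom C g = Cod C f"
  shows "g \<cdot> f \<in> Arr C" "Dom C (g \<cdot> f) = Dom C f" "Cod C (g \<cdot> f) = Cod C g"
  using Cmp_in[of f "Dom C f" "Cod C f" g "Cod C g"] assms by simp_all

lemma comp_assoc [simp]:
  assumes "f \<in> Arr C" "g \<in> Arr C" "h \<in> Arr C" "Dom C g = Cod C f" "Dom C h = Cod C g"
  shows "(h \<cdot> g) \<cdot> f = h \<cdot> (g \<cdot> f)"
  using Cmp_assoc[of f "Dom C f" "Cod C f" g "Cod C g" h "Cod C h"] assms by simp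

lemma comp_Idn [simp]:
  assumes "f \<in> Arr C"
  shows "Cod C f = B \<Longrightarrow> Idn C B \<cdot> f = f" "Dom C f = A \<Longrightarrow> f \<cdot> Idn C A = f"
  using Cmp_Idn_left[of f "Dom C f" "Cod C f"] Cmp_Idn_right[of f "Dom C f" "Cod C f"] assms
  by auto

text \<open>
  Composites are kept in right-associated form; this lemma and the next apply an equation to the
  first two factors of a longer composite.
\<close>

lemma comp_tail:
  assumes "f \<cdot> g = h" "f \<in> Arr C" "g \<in> Arr C" "Dom C f = Cod C g" "x \<in> Arr C" "Cod C x = Dom C g"
  shows "f \<cdot> (g \<cdot> x) = h \<cdot> x"
  using comp_assoc[of x g f] assms by metis

lemma comp_cong_tail:
  assumes "f \<cdot> g = h \<cdot> k" "f \<in> Arr C" "g \<in> Arr C" "Dom C f = Cod C g"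
    "h \<in> Arr C" "k \<in> Arr C" "Dom C h = Cod C k" "x \<in> Arr C" "Cod C x = Dom C g"
  shows "f \<cdot> (g \<cdot> x) = h \<cdot> (k \<cdot> x)"
proof -
  have "Dom C (f \<cdot> g) = Dom C (h \<cdot> k)" using assms(1) by simp
  hence "Dom C k = Dom C g" using assms(2-7) by simp
  thus ?thesis using comp_assoc[of x g f] comp_assoc[of x k h] assms by metis
qed

lemma is_inverse_unique:
  assumes "is_inverse C f g" "is_inverse C f h"
  shows "g = h"
proof -
  have t: "f \<in> Arr C" "g \<in> Arr C" "Dom C g = Cod C f" "Cod C g = Dom C f"
    "h \<in> Arr C" "Dom C h = Cod C f" "Cod C h = Dom C f" "g \<cdot> f = Idn C (Dom C f)"
    "f \<cdot> h = Idn C (Cod C f)"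
    using assms by (auto simp: is_inverse_def)
  have "g = g \<cdot> (f \<cdot> h)" using t by simp
  also have "\<dots> = (g \<cdot> f) \<cdot> h" using t(1-7) by simp
  also have "\<dots> = h" using t by simp
  finally show ?thesis .
qed

lemma is_inverseI:
  assumes "f \<in> Arr C" "g \<in> Arr C" "Dom C g = Cod C f" "Cod C g = Dom C f"
    "g \<cdot> f = Idn C (Dom C f)" "f \<cdot> g = Idn C (Cod C f)"
  shows "is_inverse C f g"
  using assms by (simp add: is_inverse_def)

lemma inverse_arr:
  assumes "is_iso C f"
  shows "is_inverse C f (inverse_arr C f)"
proof -
  obtain g where g: "is_inverse C f g" using assms by (auto simp: is_iso_def)
  show ?thesis unfolding inverse_arr_def
    using theI[of "is_inverse C f", OF g] is_inverse_unique[OF _ g] by blast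
qed

lemma inverse_types:
  assumes "is_iso C f"
  shows "inverse_arr C f \<in> Arr C" "Dom C (inverse_arr C f) = Cod C f"
    "Cod C (inverse_arr C f) = Dom C f"
  using inverse_arr[OF assms] by (simp_all add: is_inverse_def)

lemma inverse_cancel:
  assumes "is_iso C f"
  shows "inverse_arr C f \<cdot> f = Idn C (Dom C f)" "f \<cdot> inverse_arr C f = Idn C (Cod C f)"
  using inverse_arr[OF assms] by (simp_all add: is_inverse_def)

lemma iso_arr: "is_iso C f \<Longrightarrow> f \<in> Arr C"
  by (auto simp: is_iso_def is_inverse_def)

lemma is_iso_inverse [simp]:
  assumes "is_iso C f"
  shows "is_iso C (inverse_arr C f)"
  unfolding is_iso_def
  by (intro exI[of _ f] is_inverseI)
     (simp_all add: inverse_types[OF assms] inverse_cancel[OF assms] iso_arr[OF assms])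

lemma inverse_cancel_tail:
  assumes "is_iso C f" "x \<in> Arr C"
  shows "Cod C x = Dom C f \<Longrightarrow> inverse_arr C f \<cdot> (f \<cdot> x) = x"
    "Cod C x = Cod C f \<Longrightarrow> f \<cdot> (inverse_arr C f \<cdot> x) = x"
  using comp_tail[OF inverse_cancel(1)[OF assms(1)], of x]
    comp_tail[OF inverse_cancel(2)[OF assms(1)], of x] assms(2)
  by (simp_all add: inverse_types[OF assms(1)] iso_arr[OF assms(1)])

lemma iso_epi:
  assumes "f \<cdot> i = g \<cdot> i" "is_iso C i" "f \<in> Arr C" "g \<in> Arr C" "Dom C f = Cod C i" "Dom C g = Cod C i"
  shows "f = g"
proof -
  have "(f \<cdot> i) \<cdot> inverse_arr C i = (g \<cdot> i) \<cdot> inverse_arr C i" using assms by simp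
  thus ?thesis using assms(2-) by (simp add: inverse_types inverse_cancel iso_arr)
qed

lemma iso_mono:
  assumes "i \<cdot> f = i \<cdot> g" "is_iso C i" "f \<in> Arr C" "g \<in> Arr C" "Cod C f = Dom C i" "Cod C g = Dom C i"
  shows "f = g"
proof -
  have "inverse_arr C i \<cdot> (i \<cdot> f) = inverse_arr C i \<cdot> (i \<cdot> g)" using assms by simp
  thus ?thesis using assms(2-) by (simp add: inverse_cancel_tail)
qed

lemma move_iso_left:
  assumes "i \<cdot> f = g" "is_iso C i" "f \<in> Arr C" "Cod C f = Dom C i"
  shows "f = inverse_arr C i \<cdot> g"
  using assms by (auto simp: inverse_cancel_tail)

lemma is_iso_comp:
  assumes "is_iso C f" "is_iso C g" "Dom C g = Cod C f"
  shows "is_iso C (g \<cdot> f)"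
  using assms unfolding is_iso_def[of C "g \<cdot> f"]
  by (intro exI[of _ "inverse_arr C f \<cdot> inverse_arr C g"] is_inverseI)
     (simp_all add: inverse_types inverse_cancel inverse_cancel_tail iso_arr)

end

section \<open>Coherence in a symmetric monoidal category\<close>

context sym_monoidal_closed begin

abbreviation linv :: "'o \<Rightarrow> 'm" where "linv X \<equiv> inverse_arr V (lunit V X)"
abbreviation rinv :: "'o \<Rightarrow> 'm" where "rinv X \<equiv> inverse_arr V (runit V X)"
abbreviation ainv :: "'o \<Rightarrow> 'o \<Rightarrow> 'o \<Rightarrow> 'm" where "ainv X Y Z \<equiv> inverse_arr V (assoc V X Y Z)"

lemma obj_types [simp]:
  "\<lbrakk>A \<in> Obj V; B \<in> Obj V\<rbrakk> \<Longrightarrow> A \<odot> B \<in> Obj V" "\<one> \<in> Obj V"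
  "\<lbrakk>A \<in> Obj V; B \<in> Obj V\<rbrakk> \<Longrightarrow> ihom V A B \<in> Obj V"
  by (simp_all add: ten_in munit_in ihom_in)

lemma tena_types [simp]:
  assumes "f \<in> Arr V" "g \<in> Arr V"
  shows "f \<otimes> g \<in> Arr V" "Dom V (f \<otimes> g) = Dom V f \<odot> Dom V g" "Cod V (f \<otimes> g) = Cod V f \<odot> Cod V g"
  using tena_in[of f "Dom V f" "Cod V f" g "Dom V g" "Cod V g"] assms by simp_all

lemma structure_types [simp]:
  assumes A: "A \<in> Obj V"
  shows "lunit V A \<in> Arr V" "Dom V (lunit V A) = \<one> \<odot> A" "Cod V (lunit V A) = A"
    "runit V A \<in> Arr V" "Dom V (runit V A) = A \<odot> \<one>" "Cod V (runit V A) = A"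
    "linv A \<in> Arr V" "Cod V (linv A) = \<one> \<odot> A" "Dom V (linv A) = A"
    "rinv A \<in> Arr V" "Cod V (rinv A) = A \<odot> \<one>" "Dom V (rinv A) = A"
    "B \<in> Obj V \<Longrightarrow> sym V A B \<in> Arr V" "B \<in> Obj V \<Longrightarrow> Dom V (sym V A B) = A \<odot> B"
    "B \<in> Obj V \<Longrightarrow> Cod V (sym V A B) = B \<odot> A"
    "B \<in> Obj V \<Longrightarrow> ev V A B \<in> Arr V" "B \<in> Obj V \<Longrightarrow> Dom V (ev V A B) = ihom V A B \<odot> A"
    "B \<in> Obj V \<Longrightarrow> Cod V (ev V A B) = B"
  using A lunit_in[OF A] runit_in[OF A] inverse_types[OF lunit_iso[OF A]]
    inverse_types[OF runit_iso[OF A]] sym_in[OF A] ev_in[OF A] by simp_all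

lemma assoc_types [simp]:
  assumes "A \<in> Obj V" "B \<in> Obj V" "D \<in> Obj V"
  shows "assoc V A B D \<in> Arr V" "Dom V (assoc V A B D) = (A \<odot> B) \<odot> D"
    "Cod V (assoc V A B D) = A \<odot> (B \<odot> D)"
    "ainv A B D \<in> Arr V" "Cod V (ainv A B D) = (A \<odot> B) \<odot> D"
    "Dom V (ainv A B D) = A \<odot> (B \<odot> D)"
  using assoc_in[OF assms] inverse_types[OF assoc_iso[OF assms]] by simp_all

lemma Idn_tena [simp]: "\<lbrakk>A \<in> Obj V; B \<in> Obj V\<rbrakk> \<Longrightarrow> Idn V A \<otimes> Idn V B = Idn V (A \<odot> B)"
  by (rule tena_Idn)

lemma interchange [simp]:
  assumes "f \<in> Arr V" "g \<in> Arr V" "f' \<in> Arr V" "g' \<in> Arr V" "Dom V g = Cod V f" "Dom V g' = Cod V f'"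
  shows "(g \<otimes> g') \<cdot> (f \<otimes> f') = (g \<cdot> f) \<otimes> (g' \<cdot> f')"
  using tena_Cmp[of f "Dom V f" "Cod V f" g "Cod V g" f' "Dom V f'" "Cod V f'" g' "Cod V g'"] assms
  by simp

lemma interchange_tail [simp]:
  assumes "f \<in> Arr V" "g \<in> Arr V" "f' \<in> Arr V" "g' \<in> Arr V" "Dom V g = Cod V f" "Dom V g' = Cod V f'"
    "x \<in> Arr V" "Cod V x = Dom V f \<odot> Dom V f'"
  shows "(g \<otimes> g') \<cdot> ((f \<otimes> f') \<cdot> x) = ((g \<cdot> f) \<otimes> (g' \<cdot> f')) \<cdot> x"
  using comp_tail[OF interchange[OF assms(1-6)], of x] assms by simp

lemma is_iso_tena:
  assumes "is_iso V f" "is_iso V g"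
  shows "is_iso V (f \<otimes> g)"
  using assms unfolding is_iso_def[of V "f \<otimes> g"]
  by (intro exI[of _ "inverse_arr V f \<otimes> inverse_arr V g"] is_inverseI)
     (simp_all add: inverse_types inverse_cancel iso_arr)

lemma is_iso_Idn [simp]: "A \<in> Obj V \<Longrightarrow> is_iso V (Idn V A)"
  unfolding is_iso_def by (intro exI[of _ "Idn V A"] is_inverseI) simp_all

lemma is_iso_sym [simp]: "\<lbrakk>A \<in> Obj V; B \<in> Obj V\<rbrakk> \<Longrightarrow> is_iso V (sym V A B)"
  unfolding is_iso_def by (intro exI[of _ "sym V B A"] is_inverseI) (simp_all add: sym_sym)

lemma structure_iso [simp]:
  "A \<in> Obj V \<Longrightarrow> is_iso V (lunit V A)" "A \<in> Obj V \<Longrightarrow> is_iso V (runit V A)"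
  "\<lbrakk>A \<in> Obj V; B \<in> Obj V; D \<in> Obj V\<rbrakk> \<Longrightarrow> is_iso V (assoc V A B D)"
  by (simp_all add: lunit_iso runit_iso assoc_iso)

lemma structure_cancel [simp]:
  assumes A: "A \<in> Obj V"
  shows "linv A \<cdot> lunit V A = Idn V (\<one> \<odot> A)" "lunit V A \<cdot> linv A = Idn V A"
    "rinv A \<cdot> runit V A = Idn V (A \<odot> \<one>)" "runit V A \<cdot> rinv A = Idn V A"
    "\<lbrakk>x \<in> Arr V; Cod V x = \<one> \<odot> A\<rbrakk> \<Longrightarrow> linv A \<cdot> (lunit V A \<cdot> x) = x"
    "\<lbrakk>x \<in> Arr V; Cod V x = A\<rbrakk> \<Longrightarrow> lunit V A \<cdot> (linv A \<cdot> x) = x"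
    "\<lbrakk>x \<in> Arr V; Cod V x = A \<odot> \<one>\<rbrakk> \<Longrightarrow> rinv A \<cdot> (runit V A \<cdot> x) = x"
    "\<lbrakk>x \<in> Arr V; Cod V x = A\<rbrakk> \<Longrightarrow> runit V A \<cdot> (rinv A \<cdot> x) = x"
    "B \<in> Obj V \<Longrightarrow> sym V B A \<cdot> sym V A B = Idn V (A \<odot> B)"
    "\<lbrakk>B \<in> Obj V; x \<in> Arr V; Cod V x = A \<odot> B\<rbrakk> \<Longrightarrow> sym V B A \<cdot> (sym V A B \<cdot> x) = x"
  using A inverse_cancel[OF lunit_iso[OF A]] inverse_cancel[OF runit_iso[OF A]]
    inverse_cancel_tail[OF lunit_iso[OF A]] inverse_cancel_tail[OF runit_iso[OF A]]
    sym_sym[OF A] comp_tail[OF sym_sym[OF A], of B x] by simp_all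

lemma assoc_cancel [simp]:
  assumes "A \<in> Obj V" "B \<in> Obj V" "D \<in> Obj V"
  shows "ainv A B D \<cdot> assoc V A B D = Idn V ((A \<odot> B) \<odot> D)"
    "assoc V A B D \<cdot> ainv A B D = Idn V (A \<odot> (B \<odot> D))"
    "\<lbrakk>x \<in> Arr V; Cod V x = (A \<odot> B) \<odot> D\<rbrakk> \<Longrightarrow> ainv A B D \<cdot> (assoc V A B D \<cdot> x) = x"
    "\<lbrakk>x \<in> Arr V; Cod V x = A \<odot> (B \<odot> D)\<rbrakk> \<Longrightarrow> assoc V A B D \<cdot> (ainv A B D \<cdot> x) = x"
  using assms inverse_cancel[OF assoc_iso[OF assms]] inverse_cancel_tail[OF assoc_iso[OF assms]]
  by simp_all

lemma assoc_nat:
  assumes "f \<in> Arr V" "g \<in> Arr V" "h \<in> Arr V" "Cod V f = A" "Cod V g = B" "Cod V h = D"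
  shows "assoc V A B D \<cdot> ((f \<otimes> g) \<otimes> h)
    = (f \<otimes> (g \<otimes> h)) \<cdot> assoc V (Dom V f) (Dom V g) (Dom V h)"
  using assoc_natural[of f "Dom V f" A g "Dom V g" B h "Dom V h" D] assms by simp

lemma assoc_nat_tail:
  assumes "f \<in> Arr V" "g \<in> Arr V" "h \<in> Arr V" "Cod V f = A" "Cod V g = B" "Cod V h = D"
    "x \<in> Arr V" "Cod V x = (Dom V f \<odot> Dom V g) \<odot> Dom V h"
  shows "assoc V A B D \<cdot> (((f \<otimes> g) \<otimes> h) \<cdot> x)
    = (f \<otimes> (g \<otimes> h)) \<cdot> (assoc V (Dom V f) (Dom V g) (Dom V h) \<cdot> x)"
  by (rule comp_cong_tail[OF assoc_nat]) (use assms in auto)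

lemma lunit_nat:
  "f \<in> Arr V \<Longrightarrow> Cod V f = B \<Longrightarrow> lunit V B \<cdot> (Idn V \<one> \<otimes> f) = f \<cdot> lunit V (Dom V f)"
  using lunit_natural[of f "Dom V f" B] by simp

lemma runit_nat:
  "f \<in> Arr V \<Longrightarrow> Cod V f = B \<Longrightarrow> runit V B \<cdot> (f \<otimes> Idn V \<one>) = f \<cdot> runit V (Dom V f)"
  using runit_natural[of f "Dom V f" B] by simp

lemma sym_nat:
  assumes "f \<in> Arr V" "g \<in> Arr V" "Cod V f = A" "Cod V g = B"
  shows "sym V A B \<cdot> (f \<otimes> g) = (g \<otimes> f) \<cdot> sym V (Dom V f) (Dom V g)"
  using sym_natural[of f "Dom V f" A g "Dom V g" B] assms by simp

lemma linv_nat: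
  assumes "f \<in> Arr V" "Cod V f = B"
  shows "linv B \<cdot> f = (Idn V \<one> \<otimes> f) \<cdot> linv (Dom V f)"
proof -
  have "linv B \<cdot> f = linv B \<cdot> ((f \<cdot> lunit V (Dom V f)) \<cdot> linv (Dom V f))"
    using assms by auto
  also have "\<dots> = linv B \<cdot> ((lunit V B \<cdot> (Idn V \<one> \<otimes> f)) \<cdot> linv (Dom V f))"
    using lunit_nat[OF assms] by simp
  also have "\<dots> = (Idn V \<one> \<otimes> f) \<cdot> linv (Dom V f)" using assms by auto
  finally show ?thesis .
qed

lemma rinv_nat:
  assumes "f \<in> Arr V" "Cod V f = B"
  shows "rinv B \<cdot> f = (f \<otimes> Idn V \<one>) \<cdot> rinv (Dom V f)"
proof -
  have "rinv B \<cdot> f = rinv B \<cdot> ((f \<cdot> runit V (Dom V f)) \<cdot> rinv (Dom V f))"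
    using assms by auto
  also have "\<dots> = rinv B \<cdot> ((runit V B \<cdot> (f \<otimes> Idn V \<one>)) \<cdot> rinv (Dom V f))"
    using runit_nat[OF assms] by simp
  also have "\<dots> = (f \<otimes> Idn V \<one>) \<cdot> rinv (Dom V f)" using assms by auto
  finally show ?thesis .
qed

lemma tena_left_unit_faithful:
  assumes "Idn V \<one> \<otimes> f = Idn V \<one> \<otimes> g" "f \<in> Arr V" "g \<in> Arr V" "Dom V f = Dom V g" "Cod V f = Cod V g"
  shows "f = g"
proof -
  have "f \<cdot> lunit V (Dom V f) = g \<cdot> lunit V (Dom V f)"
    using lunit_nat[of f "Cod V f"] lunit_nat[of g "Cod V f"] assms by simp
  thus ?thesis by (rule iso_epi) (use assms in simp_all)
qed

lemma tena_right_unit_faithful: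
  assumes "f \<otimes> Idn V \<one> = g \<otimes> Idn V \<one>" "f \<in> Arr V" "g \<in> Arr V" "Dom V f = Dom V g" "Cod V f = Cod V g"
  shows "f = g"
proof -
  have "f \<cdot> runit V (Dom V f) = g \<cdot> runit V (Dom V f)"
    using runit_nat[of f "Cod V f"] runit_nat[of g "Cod V f"] assms by simp
  thus ?thesis by (rule iso_epi) (use assms in simp_all)
qed

text \<open>
  Since \<open>\<one> \<odot> -\<close> is faithful, it may be checked after
  tensoring with \<open>\<one>\<close> on the left, where it follows from the pentagon for \<open>\<one>, \<one>, A, B\<close> and two triangles.
\<close>

lemma lunit_tensor:
  assumes [simp]: "A \<in> Obj V" "B \<in> Obj V"
  shows "lunit V (A \<odot> B) \<cdot> assoc V \<one> A B = lunit V A \<otimes> Idn V B"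
proof -
  let ?i = "assoc V \<one> (\<one> \<odot> A) B \<cdot> (assoc V \<one> \<one> A \<otimes> Idn V B)"
  have iso: "is_iso V ?i" by (intro is_iso_comp is_iso_tena) simp_all
  have "(Idn V \<one> \<otimes> (lunit V (A \<odot> B) \<cdot> assoc V \<one> A B)) \<cdot> ?i
    = (Idn V \<one> \<otimes> lunit V (A \<odot> B)) \<cdot> ((Idn V \<one> \<otimes> assoc V \<one> A B) \<cdot> ?i)"
    by simp
  also have "\<dots> = (Idn V \<one> \<otimes> lunit V (A \<odot> B)) \<cdot> (assoc V \<one> \<one> (A \<odot> B) \<cdot> assoc V (\<one> \<odot> \<one>) A B)"
    using pentagon[of \<one> \<one> A B] by simp
  also have "\<dots> = (runit V \<one> \<otimes> (Idn V A \<otimes> Idn V B)) \<cdot> assoc V (\<one> \<odot> \<one>) A B"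
    using comp_tail[OF triangle[of \<one> "A \<odot> B"], of "assoc V (\<one> \<odot> \<one>) A B"] by simp
  also have "\<dots> = assoc V \<one> A B \<cdot> ((runit V \<one> \<otimes> Idn V A) \<otimes> Idn V B)"
    using assoc_nat[of "runit V \<one>" "Idn V A" "Idn V B"] by simp
  also have "\<dots> = assoc V \<one> A B \<cdot> (((Idn V \<one> \<otimes> lunit V A) \<cdot> assoc V \<one> \<one> A) \<otimes> Idn V B)"
    using triangle[of \<one> A] by simp
  also have "\<dots> = assoc V \<one> A B \<cdot> (((Idn V \<one> \<otimes> lunit V A) \<otimes> Idn V B) \<cdot> (assoc V \<one> \<one> A \<otimes> Idn V B))"
    by simp
  also have "\<dots> = (Idn V \<one> \<otimes> (lunit V A \<otimes> Idn V B)) \<cdot> ?i"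
    using assoc_nat_tail[of "Idn V \<one>" "lunit V A" "Idn V B" \<one> A B "assoc V \<one> \<one> A \<otimes> Idn V B"]
    by (simp del: interchange interchange_tail)
  finally have "Idn V \<one> \<otimes> (lunit V (A \<odot> B) \<cdot> assoc V \<one> A B) = Idn V \<one> \<otimes> (lunit V A \<otimes> Idn V B)"
    by (rule iso_epi[OF _ iso]) simp_all
  thus ?thesis by (rule tena_left_unit_faithful) simp_all
qed

text \<open>
  The mirror image of \<open>lunit_tensor\<close>, checked after tensoring with \<open>\<one>\<close> on the right.
\<close>

lemma runit_tensor:
  assumes [simp]: "A \<in> Obj V" "B \<in> Obj V"
  shows "(Idn V A \<otimes> runit V B) \<cdot> assoc V A B \<one> = runit V (A \<odot> B)"
proof -
  have "assoc V A B \<one> \<cdot> (runit V (A \<odot> B) \<otimes> Idn V \<one>)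
    = assoc V A B \<one> \<cdot> (((Idn V A \<otimes> Idn V B) \<otimes> lunit V \<one>) \<cdot> assoc V (A \<odot> B) \<one> \<one>)"
    using triangle[of "A \<odot> B" \<one>] by simp
  also have "\<dots> = (Idn V A \<otimes> (Idn V B \<otimes> lunit V \<one>)) \<cdot> (assoc V A B (\<one> \<odot> \<one>) \<cdot> assoc V (A \<odot> B) \<one> \<one>)"
    using assoc_nat_tail[of "Idn V A" "Idn V B" "lunit V \<one>" A B \<one> "assoc V (A \<odot> B) \<one> \<one>"]
    by (simp del: interchange interchange_tail)
  also have "\<dots> = (Idn V A \<otimes> (Idn V B \<otimes> lunit V \<one>)) \<cdot> ((Idn V A \<otimes> assoc V B \<one> \<one>) \<cdot>
      (assoc V A (B \<odot> \<one>) \<one> \<cdot> (assoc V A B \<one> \<otimes> Idn V \<one>)))"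
    using pentagon[of A B \<one> \<one>] by simp
  also have "\<dots> = (Idn V A \<otimes> (runit V B \<otimes> Idn V \<one>)) \<cdot>
      (assoc V A (B \<odot> \<one>) \<one> \<cdot> (assoc V A B \<one> \<otimes> Idn V \<one>))"
    using triangle[of B \<one>] by simp
  also have "\<dots> = assoc V A B \<one> \<cdot> (((Idn V A \<otimes> runit V B) \<cdot> assoc V A B \<one>) \<otimes> Idn V \<one>)"
    using assoc_nat_tail[of "Idn V A" "runit V B" "Idn V \<one>" A B \<one> "assoc V A B \<one> \<otimes> Idn V \<one>"]
    by simp
  finally have "runit V (A \<odot> B) \<otimes> Idn V \<one> = ((Idn V A \<otimes> runit V B) \<cdot> assoc V A B \<one>) \<otimes> Idn V \<one>"
    by (rule iso_mono) simp_all
  from tena_right_unit_faithful[OF this] show ?thesis by simp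
qed

lemma linv_tensor:
  assumes [simp]: "A \<in> Obj V" "B \<in> Obj V"
  shows "assoc V \<one> A B \<cdot> (linv A \<otimes> Idn V B) = linv (A \<odot> B)"
proof -
  have "lunit V (A \<odot> B) \<cdot> (assoc V \<one> A B \<cdot> (linv A \<otimes> Idn V B)) = Idn V (A \<odot> B)"
    using comp_tail[OF lunit_tensor[of A B], of "linv A \<otimes> Idn V B"] by simp
  from move_iso_left[OF this] show ?thesis by simp
qed

lemma rinv_tensor:
  assumes [simp]: "A \<in> Obj V" "B \<in> Obj V"
  shows "assoc V A B \<one> \<cdot> rinv (A \<odot> B) = Idn V A \<otimes> rinv B"
proof -
  have "(Idn V A \<otimes> rinv B) \<cdot> ((Idn V A \<otimes> runit V B) \<cdot> (assoc V A B \<one> \<cdot> rinv (A \<odot> B)))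
     = Idn V A \<otimes> rinv B"
    using comp_tail[OF runit_tensor[of A B], of "rinv (A \<odot> B)"]
    by (simp del: interchange interchange_tail)
  thus ?thesis by simp
qed

lemma triangle_inv:
  assumes [simp]: "A \<in> Obj V" "B \<in> Obj V"
  shows "assoc V A \<one> B \<cdot> (rinv A \<otimes> Idn V B) = Idn V A \<otimes> linv B"
proof -
  have "(Idn V A \<otimes> linv B) \<cdot> ((Idn V A \<otimes> lunit V B) \<cdot> (assoc V A \<one> B \<cdot> (rinv A \<otimes> Idn V B)))
     = Idn V A \<otimes> linv B"
    using comp_tail[OF triangle[of A B], of "rinv A \<otimes> Idn V B"]
    by (simp del: interchange_tail)
  thus ?thesis by simp
qed

lemma linv_munit: "linv \<one> = rinv \<one>" by (simp add: lunit_munit)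

lemma sym_rinv:
  assumes [simp]: "A \<in> Obj V"
  shows "sym V A \<one> \<cdot> rinv A = linv A"
proof -
  have "lunit V A \<cdot> (sym V A \<one> \<cdot> rinv A) = Idn V A"
    using comp_tail[OF lunit_sym[of A], of "rinv A"] by simp
  from move_iso_left[OF this] show ?thesis by simp
qed

lemma runit_sym:
  assumes [simp]: "A \<in> Obj V"
  shows "runit V A \<cdot> sym V \<one> A = lunit V A"
  using lunit_sym[OF assms, symmetric] by simp

text \<open>
  The hexagon, arranged for comparing a step that moves \<open>A\<close> past \<open>D\<close> alone with one that moves it past
  \<open>B \<odot> D\<close>.
\<close>

lemma sym_hexagon:
  assumes [simp]: "A \<in> Obj V" "B \<in> Obj V" "D \<in> Obj V"
  shows "sym V A (B \<odot> D) \<cdot> (assoc V A B D \<cdot> (sym V B A \<otimes> Idn V D))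
    = ainv B D A \<cdot> ((Idn V B \<otimes> sym V A D) \<cdot> assoc V B A D)"
proof -
  have "assoc V B D A \<cdot> (sym V A (B \<odot> D) \<cdot> (assoc V A B D \<cdot> (sym V B A \<otimes> Idn V D)))
    = (assoc V B D A \<cdot> (sym V A (B \<odot> D) \<cdot> assoc V A B D)) \<cdot> (sym V B A \<otimes> Idn V D)"
    by simp
  also have "\<dots> = (Idn V B \<otimes> sym V A D) \<cdot> assoc V B A D"
    unfolding hexagon[OF assms] by simp
  finally show ?thesis by (rule move_iso_left) simp_all
qed

end

section \<open>The action of global elements on hom objects\<close>

context vcategory begin

lemma VHom_type [simp]: "\<lbrakk>a \<in> VOb A; b \<in> VOb A\<rbrakk> \<Longrightarrow> VHom A a b \<in> Obj V"
  by (rule VHom_in)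

lemma VId_types [simp]:
  assumes "a \<in> VOb A"
  shows "VId A a \<in> Arr V" "Dom V (VId A a) = \<one>" "Cod V (VId A a) = VHom A a a"
  using VId_in[OF assms] by simp_all

lemma VCmp_types [simp]:
  assumes "a \<in> VOb A" "b \<in> VOb A" "c \<in> VOb A"
  shows "VCmp A a b c \<in> Arr V" "Dom V (VCmp A a b c) = VHom A b c \<odot> VHom A a b"
    "Cod V (VCmp A a b c) = VHom A a c"
  using VCmp_in[OF assms] by simp_all

text \<open>
  Associativity for generalized elements \<open>f, g, h\<close> with arbitrary domains; names ending in
  \<open>_el\<close> mark statements about generalized elements.
\<close>

lemma VCmp_assoc_el:
  assumes [simp]: "a \<in> VOb A" "b \<in> VOb A" "c \<in> VOb A" "d \<in> VOb A"
    "f \<in> Arr V" "Cod V f = VHom A a b" "g \<in> Arr V" "Cod V g = VHom A b c"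
    "h \<in> Arr V" "Cod V h = VHom A c d"
  shows "VCmp A a b d \<cdot> ((VCmp A b c d \<cdot> (h \<otimes> g)) \<otimes> f)
    = VCmp A a c d \<cdot> ((h \<otimes> (VCmp A a b c \<cdot> (g \<otimes> f))) \<cdot> assoc V (Dom V h) (Dom V g) (Dom V f))"
proof -
  have "VCmp A a b d \<cdot> ((VCmp A b c d \<cdot> (h \<otimes> g)) \<otimes> f)
    = (VCmp A a b d \<cdot> (VCmp A b c d \<otimes> Idn V (VHom A a b))) \<cdot> ((h \<otimes> g) \<otimes> f)" by simp
  also have "\<dots> = VCmp A a c d \<cdot> ((Idn V (VHom A c d) \<otimes> VCmp A a b c)
      \<cdot> (assoc V (VHom A c d) (VHom A b c) (VHom A a b) \<cdot> ((h \<otimes> g) \<otimes> f)))"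
    unfolding VCmp_assoc[OF assms(1-4)] by simp
  also have "\<dots> = VCmp A a c d \<cdot> ((h \<otimes> (VCmp A a b c \<cdot> (g \<otimes> f))) \<cdot> assoc V (Dom V h) (Dom V g) (Dom V f))"
    by (simp add: assoc_nat)
  finally show ?thesis .
qed

lemma VId_left_el [simp]:
  assumes [simp]: "a \<in> VOb A" "b \<in> VOb A" "f \<in> Arr V" "Cod V f = VHom A a b"
  shows "VCmp A a b b \<cdot> (VId A b \<otimes> f) = f \<cdot> lunit V (Dom V f)"
proof -
  have "VCmp A a b b \<cdot> (VId A b \<otimes> f) = (VCmp A a b b \<cdot> (VId A b \<otimes> Idn V (VHom A a b))) \<cdot> (Idn V \<one> \<otimes> f)"
    by simp
  also have "\<dots> = f \<cdot> lunit V (Dom V f)" unfolding VId_left[OF assms(1,2)] by (simp add: lunit_nat)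
  finally show ?thesis .
qed

lemma VId_right_el [simp]:
  assumes [simp]: "a \<in> VOb A" "b \<in> VOb A" "f \<in> Arr V" "Cod V f = VHom A a b"
  shows "VCmp A a a b \<cdot> (f \<otimes> VId A a) = f \<cdot> runit V (Dom V f)"
proof -
  have "VCmp A a a b \<cdot> (f \<otimes> VId A a) = (VCmp A a a b \<cdot> (Idn V (VHom A a b) \<otimes> VId A a)) \<cdot> (f \<otimes> Idn V \<one>)"
    by simp
  also have "\<dots> = f \<cdot> runit V (Dom V f)" unfolding VId_right[OF assms(1,2)] by (simp add: runit_nat)
  finally show ?thesis .
qed

lemma VId_tail [simp]:
  assumes [simp]: "a \<in> VOb A" "b \<in> VOb A" "f \<in> Arr V" "Cod V f = VHom A a b" "x \<in> Arr V"
  shows "Cod V x = \<one> \<odot> Dom V f \<Longrightarrow> VCmp A a b b \<cdot> ((VId A b \<otimes> f) \<cdot> x) = f \<cdot> (lunit V (Dom V f) \<cdot> x)"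
    "Cod V x = Dom V f \<odot> \<one> \<Longrightarrow> VCmp A a a b \<cdot> ((f \<otimes> VId A a) \<cdot> x) = f \<cdot> (runit V (Dom V f) \<cdot> x)"
  using comp_cong_tail[OF VId_left_el[of a b f], of x] comp_cong_tail[OF VId_right_el[of a b f], of x]
  by simp_all

lemma vpost_types [simp]:
  assumes "a \<in> VOb A" "b \<in> VOb A" "c \<in> VOb A" "e \<in> Arr V" "Dom V e = \<one>" "Cod V e = VHom A b c"
  shows "vpost V A a b c e \<in> Arr V" "Dom V (vpost V A a b c e) = VHom A a b"
    "Cod V (vpost V A a b c e) = VHom A a c"
  using assms by (simp_all add: vpost_def)

lemma vpre_types [simp]:
  assumes "a \<in> VOb A" "b \<in> VOb A" "c \<in> VOb A" "e \<in> Arr V" "Dom V e = \<one>" "Cod V e = VHom A a b"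
  shows "vpre V A a b c e \<in> Arr V" "Dom V (vpre V A a b c e) = VHom A b c"
    "Cod V (vpre V A a b c e) = VHom A a c"
  using assms by (simp_all add: vpre_def)

lemma vpost_el:
  assumes "a \<in> VOb A" "b \<in> VOb A" "c \<in> VOb A" "e \<in> Arr V" "Dom V e = \<one>" "Cod V e = VHom A b c"
    "f \<in> Arr V" "Cod V f = VHom A a b"
  shows "vpost V A a b c e \<cdot> f = VCmp A a b c \<cdot> ((e \<otimes> f) \<cdot> linv (Dom V f))"
  using assms by (simp add: vpost_def linv_nat)

lemma vpre_el:
  assumes "a \<in> VOb A" "b \<in> VOb A" "c \<in> VOb A" "e \<in> Arr V" "Dom V e = \<one>" "Cod V e = VHom A a b"
    "f \<in> Arr V" "Cod V f = VHom A b c"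
  shows "vpre V A a b c e \<cdot> f = VCmp A a b c \<cdot> ((f \<otimes> e) \<cdot> rinv (Dom V f))"
  using assms by (simp add: vpre_def rinv_nat)

text \<open>
  This and the next two lemmas are associativity where one of the three elements is global.  Each
  costs one unit coherence: \<open>linv_tensor\<close> if the global element stands on the left, \<open>rinv_tensor\<close> if it
  stands on the right, and the triangle if it stands in the middle.
\<close>

lemma VCmp_vpost:
  assumes [simp]: "a \<in> VOb A" "b \<in> VOb A" "c \<in> VOb A" "d \<in> VOb A"
    "e \<in> Arr V" "Dom V e = \<one>" "Cod V e = VHom A c d"
    "f \<in> Arr V" "Cod V f = VHom A b c" "g \<in> Arr V" "Cod V g = VHom A a b"
  shows "VCmp A a b d \<cdot> ((vpost V A b c d e \<cdot> f) \<otimes> g)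
    = vpost V A a c d e \<cdot> (VCmp A a b c \<cdot> (f \<otimes> g))"
proof -
  have "VCmp A a b d \<cdot> ((vpost V A b c d e \<cdot> f) \<otimes> g)
    = (VCmp A a b d \<cdot> ((VCmp A b c d \<cdot> (e \<otimes> f)) \<otimes> g)) \<cdot> (linv (Dom V f) \<otimes> Idn V (Dom V g))"
    by (simp add: vpost_el)
  also have "\<dots> = VCmp A a c d \<cdot> ((e \<otimes> (VCmp A a b c \<cdot> (f \<otimes> g)))
     \<cdot> (assoc V \<one> (Dom V f) (Dom V g) \<cdot> (linv (Dom V f) \<otimes> Idn V (Dom V g))))"
    by (subst VCmp_assoc_el[of a b c d g f e]) simp_all
  also have "\<dots> = VCmp A a c d \<cdot> ((e \<otimes> (VCmp A a b c \<cdot> (f \<otimes> g))) \<cdot> linv (Dom V f \<odot> Dom V g))"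
    by (simp only: linv_tensor Dom_Cod_in assms)
  also have "\<dots> = vpost V A a c d e \<cdot> (VCmp A a b c \<cdot> (f \<otimes> g))" by (simp add: vpost_el)
  finally show ?thesis .
qed

lemma VCmp_vpre:
  assumes [simp]: "a \<in> VOb A" "b \<in> VOb A" "c \<in> VOb A" "d \<in> VOb A"
    "e \<in> Arr V" "Dom V e = \<one>" "Cod V e = VHom A a b"
    "f \<in> Arr V" "Cod V f = VHom A c d" "g \<in> Arr V" "Cod V g = VHom A b c"
  shows "VCmp A a c d \<cdot> (f \<otimes> (vpre V A a b c e \<cdot> g))
    = vpre V A a b d e \<cdot> (VCmp A b c d \<cdot> (f \<otimes> g))"
proof -
  have "vpre V A a b d e \<cdot> (VCmp A b c d \<cdot> (f \<otimes> g))
     = (VCmp A a b d \<cdot> ((VCmp A b c d \<cdot> (f \<otimes> g)) \<otimes> e)) \<cdot> rinv (Dom V f \<odot> Dom V g)"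
    by (simp add: vpre_el)
  also have "\<dots> = VCmp A a c d \<cdot> ((f \<otimes> (VCmp A a b c \<cdot> (g \<otimes> e)))
     \<cdot> (assoc V (Dom V f) (Dom V g) \<one> \<cdot> rinv (Dom V f \<odot> Dom V g)))"
    by (subst VCmp_assoc_el[of a b c d e g f]) simp_all
  also have "\<dots> = VCmp A a c d \<cdot> ((f \<otimes> (VCmp A a b c \<cdot> (g \<otimes> e))) \<cdot> (Idn V (Dom V f) \<otimes> rinv (Dom V g)))"
    by (simp only: rinv_tensor Dom_Cod_in assms)
  also have "\<dots> = VCmp A a c d \<cdot> (f \<otimes> (vpre V A a b c e \<cdot> g))" by (simp add: vpre_el)
  finally show ?thesis by simp
qed

lemma VCmp_middle:
  assumes [simp]: "a \<in> VOb A" "b \<in> VOb A" "c \<in> VOb A" "d \<in> VOb A"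
    "e \<in> Arr V" "Dom V e = \<one>" "Cod V e = VHom A b c"
    "f \<in> Arr V" "Cod V f = VHom A c d" "g \<in> Arr V" "Cod V g = VHom A a b"
  shows "VCmp A a b d \<cdot> ((vpre V A b c d e \<cdot> f) \<otimes> g)
    = VCmp A a c d \<cdot> (f \<otimes> (vpost V A a b c e \<cdot> g))"
proof -
  have "VCmp A a b d \<cdot> ((vpre V A b c d e \<cdot> f) \<otimes> g)
     = (VCmp A a b d \<cdot> ((VCmp A b c d \<cdot> (f \<otimes> e)) \<otimes> g)) \<cdot> (rinv (Dom V f) \<otimes> Idn V (Dom V g))"
    by (simp add: vpre_el)
  also have "\<dots> = VCmp A a c d \<cdot> ((f \<otimes> (VCmp A a b c \<cdot> (e \<otimes> g)))
     \<cdot> (assoc V (Dom V f) \<one> (Dom V g) \<cdot> (rinv (Dom V f) \<otimes> Idn V (Dom V g))))"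
    by (subst VCmp_assoc_el[of a b c d g e f]) simp_all
  also have "\<dots> = VCmp A a c d \<cdot> ((f \<otimes> (VCmp A a b c \<cdot> (e \<otimes> g))) \<cdot> (Idn V (Dom V f) \<otimes> linv (Dom V g)))"
    by (simp only: triangle_inv Dom_Cod_in assms)
  also have "\<dots> = VCmp A a c d \<cdot> (f \<otimes> (vpost V A a b c e \<cdot> g))" by (simp add: vpost_el)
  finally show ?thesis .
qed

text \<open>
  The next three lemmas say that \<open>A(-,-)\<close> is a bifunctor on the underlying category; they follow from
  the preceding ones by writing out the inner action as a composition.
\<close>

lemma vpost_vpre:
  assumes [simp]: "a \<in> VOb A" "b \<in> VOb A" "c \<in> VOb A" "d \<in> VOb A"
    "e \<in> Arr V" "Dom V e = \<one>" "Cod V e = VHom A c d"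
    "e' \<in> Arr V" "Dom V e' = \<one>" "Cod V e' = VHom A a b"
    "f \<in> Arr V" "Cod V f = VHom A b c"
  shows "vpost V A a c d e \<cdot> (vpre V A a b c e' \<cdot> f) = vpre V A a b d e' \<cdot> (vpost V A b c d e \<cdot> f)"
proof -
  have "vpost V A a c d e \<cdot> (vpre V A a b c e' \<cdot> f)
    = (vpost V A a c d e \<cdot> (VCmp A a b c \<cdot> (f \<otimes> e'))) \<cdot> rinv (Dom V f)"
    by (simp add: vpre_el[of a b c])
  also have "\<dots> = (VCmp A a b d \<cdot> ((vpost V A b c d e \<cdot> f) \<otimes> e')) \<cdot> rinv (Dom V f)"
    by (subst VCmp_vpost) simp_all
  also have "\<dots> = vpre V A a b d e' \<cdot> (vpost V A b c d e \<cdot> f)"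
    by (simp add: vpre_el[of a b d])
  finally show ?thesis .
qed

lemma vpost_vpost:
  assumes [simp]: "a \<in> VOb A" "b \<in> VOb A" "c \<in> VOb A" "d \<in> VOb A"
    "e \<in> Arr V" "Dom V e = \<one>" "Cod V e = VHom A c d"
    "e' \<in> Arr V" "Dom V e' = \<one>" "Cod V e' = VHom A b c"
    "f \<in> Arr V" "Cod V f = VHom A a b"
  shows "vpost V A a c d e \<cdot> (vpost V A a b c e' \<cdot> f) = vpost V A a b d (vpost V A b c d e \<cdot> e') \<cdot> f"
proof -
  have "vpost V A a c d e \<cdot> (vpost V A a b c e' \<cdot> f)
    = (vpost V A a c d e \<cdot> (VCmp A a b c \<cdot> (e' \<otimes> f))) \<cdot> linv (Dom V f)"
    by (simp add: vpost_el[of a b c])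
  also have "\<dots> = (VCmp A a b d \<cdot> ((vpost V A b c d e \<cdot> e') \<otimes> f)) \<cdot> linv (Dom V f)"
    by (subst VCmp_vpost) simp_all
  also have "\<dots> = vpost V A a b d (vpost V A b c d e \<cdot> e') \<cdot> f"
    by (simp add: vpost_el[of a b d])
  finally show ?thesis .
qed

lemma vpre_vpre:
  assumes [simp]: "a \<in> VOb A" "b \<in> VOb A" "c \<in> VOb A" "d \<in> VOb A"
    "e \<in> Arr V" "Dom V e = \<one>" "Cod V e = VHom A a b"
    "e' \<in> Arr V" "Dom V e' = \<one>" "Cod V e' = VHom A b c"
    "f \<in> Arr V" "Cod V f = VHom A c d"
  shows "vpre V A a b d e \<cdot> (vpre V A b c d e' \<cdot> f) = vpre V A a c d (vpre V A a b c e \<cdot> e') \<cdot> f"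
proof -
  have "vpre V A a b d e \<cdot> (vpre V A b c d e' \<cdot> f)
    = (vpre V A a b d e \<cdot> (VCmp A b c d \<cdot> (f \<otimes> e'))) \<cdot> rinv (Dom V f)"
    by (simp add: vpre_el[of b c d])
  also have "\<dots> = (VCmp A a c d \<cdot> (f \<otimes> (vpre V A a b c e \<cdot> e'))) \<cdot> rinv (Dom V f)"
    by (subst VCmp_vpre) simp_all
  also have "\<dots> = vpre V A a c d (vpre V A a b c e \<cdot> e') \<cdot> f"
    by (simp add: vpre_el[of a c d])
  finally show ?thesis .
qed

lemma vpost_eq_vpre:
  assumes [simp]: "a \<in> VOb A" "b \<in> VOb A" "c \<in> VOb A"
    "g \<in> Arr V" "Dom V g = \<one>" "Cod V g = VHom A b c"
    "f \<in> Arr V" "Dom V f = \<one>" "Cod V f = VHom A a b"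
  shows "vpost V A a b c g \<cdot> f = vpre V A a b c f \<cdot> g"
  by (simp add: vpost_el vpre_el linv_munit)

lemma vcomp_eq_vpost:
  assumes [simp]: "a \<in> VOb A" "b \<in> VOb A" "c \<in> VOb A"
    "g \<in> Arr V" "Dom V g = \<one>" "Cod V g = VHom A b c"
    "f \<in> Arr V" "Dom V f = \<one>" "Cod V f = VHom A a b"
  shows "vcomp V A a b c g f = vpost V A a b c g \<cdot> f"
  by (simp add: vcomp_def vpost_el)

lemma vpost_VId [simp]:
  assumes [simp]: "a \<in> VOb A" "b \<in> VOb A"
  shows "vpost V A a b b (VId A b) = Idn V (VHom A a b)"
    "vpre V A a a b (VId A a) = Idn V (VHom A a b)"
  using comp_tail[OF VId_left[OF assms], of "linv (VHom A a b)"]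
    comp_tail[OF VId_right[OF assms], of "rinv (VHom A a b)"]
  by (simp_all add: vpost_def vpre_def)

lemma vpost_at_VId [simp]:
  assumes [simp]: "a \<in> VOb A" "b \<in> VOb A" "e \<in> Arr V" "Dom V e = \<one>" "Cod V e = VHom A a b"
  shows "vpost V A a a b e \<cdot> VId A a = e" "vpre V A a b b e \<cdot> VId A b = e"
  using vpost_eq_vpre[of a a b e "VId A a"] vpost_eq_vpre[of a b b "VId A b" e] by simp_all

end

section \<open>V-functors and V-natural transformations\<close>

lemma mk_vfun_simps [simp]:
  "a \<in> VOb A \<Longrightarrow> FOb (mk_vfun A fo fh) a = fo a"
  "\<lbrakk>a \<in> VOb A; b \<in> VOb A\<rbrakk> \<Longrightarrow> FHom (mk_vfun A fo fh) a b = fh a b"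
  by (simp_all add: mk_vfun_def)

lemma mk_vfun_ext [simp]:
  "a \<notin> VOb A \<Longrightarrow> FOb (mk_vfun A fo fh) a = undefined"
  "a \<notin> VOb A \<or> b \<notin> VOb A \<Longrightarrow> FHom (mk_vfun A fo fh) a b = undefined"
  by (auto simp add: mk_vfun_def)

lemma (in sym_monoidal_closed) vfunctor_mk_vfun:
  assumes A: "vcategory V A" and B: "vcategory V B"
    and "\<And>a. a \<in> VOb A \<Longrightarrow> fo a \<in> VOb B"
    and "\<And>a b. \<lbrakk>a \<in> VOb A; b \<in> VOb A\<rbrakk> \<Longrightarrow> fh a b \<in> hom V (VHom A a b) (VHom B (fo a) (fo b))"
    and "\<And>a b c. \<lbrakk>a \<in> VOb A; b \<in> VOb A; c \<in> VOb A\<rbrakk>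
      \<Longrightarrow> fh a c \<cdot> VCmp A a b c = VCmp B (fo a) (fo b) (fo c) \<cdot> (fh b c \<otimes> fh a b)"
    and "\<And>a. a \<in> VOb A \<Longrightarrow> fh a a \<cdot> VId A a = VId B (fo a)"
  shows "vfunctor V A B (mk_vfun A fo fh)"
proof -
  interpret A: vcategory V A by fact
  interpret B: vcategory V B by fact
  show ?thesis
    by unfold_locales (use assms(3-6) in auto)
qed

lemma vfun_eqI:
  assumes "vfunctor V A B F" "vfunctor V A B G"
    and "\<And>a. a \<in> VOb A \<Longrightarrow> FOb F a = FOb G a"
    and "\<And>a b. \<lbrakk>a \<in> VOb A; b \<in> VOb A\<rbrakk> \<Longrightarrow> FHom F a b = FHom G a b"
  shows "F = G"
proof -
  interpret F: vfunctor V A B F by fact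
  interpret G: vfunctor V A B G by fact
  have "FOb F a = FOb G a" "FHom F a b = FHom G a b" for a b
    using assms(3,4) F.FOb_ext G.FOb_ext F.FHom_ext G.FHom_ext by metis+
  hence "FOb F = FOb G" "FHom F = FHom G" by (auto intro!: ext)
  thus ?thesis by (intro vfun.equality) auto
qed

context vfunctor begin

lemma FOb_type [simp]: "a \<in> VOb A \<Longrightarrow> FOb F a \<in> VOb B"
  by (rule FOb_in)

lemma FHom_types [simp]:
  assumes "a \<in> VOb A" "b \<in> VOb A"
  shows "FHom F a b \<in> Arr V" "Dom V (FHom F a b) = VHom A a b"
    "Cod V (FHom F a b) = VHom B (FOb F a) (FOb F b)"
  using FHom_in[OF assms] by simp_all

lemma FHom_VCmp_el:
  assumes [simp]: "a \<in> VOb A" "b \<in> VOb A" "c \<in> VOb A" "g \<in> Arr V" "Cod V g = VHom A b c"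
    "f \<in> Arr V" "Cod V f = VHom A a b"
  shows "FHom F a c \<cdot> (VCmp A a b c \<cdot> (g \<otimes> f))
    = VCmp B (FOb F a) (FOb F b) (FOb F c) \<cdot> ((FHom F b c \<cdot> g) \<otimes> (FHom F a b \<cdot> f))"
  using comp_cong_tail[OF FHom_VCmp[of a b c], where x = "g \<otimes> f"] by simp

lemma FHom_VId_el [simp]:
  assumes "a \<in> VOb A" shows "FHom F a a \<cdot> VId A a = VId B (FOb F a)"
  using FHom_VId assms by simp

lemma FHom_vpost:
  assumes [simp]: "a \<in> VOb A" "b \<in> VOb A" "c \<in> VOb A"
    "e \<in> Arr V" "Dom V e = \<one>" "Cod V e = VHom A b c" "f \<in> Arr V" "Cod V f = VHom A a b"
  shows "FHom F a c \<cdot> (vpost V A a b c e \<cdot> f)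
    = vpost V B (FOb F a) (FOb F b) (FOb F c) (FHom F b c \<cdot> e) \<cdot> (FHom F a b \<cdot> f)"
  using comp_cong_tail[OF FHom_VCmp_el[of a b c e f], where x = "linv (Dom V f)"]
  by (simp add: vpost_el B.vpost_el)

lemma FHom_vpre:
  assumes [simp]: "a \<in> VOb A" "b \<in> VOb A" "c \<in> VOb A"
    "e \<in> Arr V" "Dom V e = \<one>" "Cod V e = VHom A a b" "f \<in> Arr V" "Cod V f = VHom A b c"
  shows "FHom F a c \<cdot> (vpre V A a b c e \<cdot> f)
    = vpre V B (FOb F a) (FOb F b) (FOb F c) (FHom F a b \<cdot> e) \<cdot> (FHom F b c \<cdot> f)"
  using comp_cong_tail[OF FHom_VCmp_el[of a b c f e], where x = "rinv (Dom V f)"]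
  by (simp add: vpre_el B.vpre_el)

end

context vnat begin

lemma vnat_types [simp]:
  assumes "a \<in> VOb A"
  shows "\<alpha> a \<in> Arr V" "Dom V (\<alpha> a) = \<one>" "Cod V (\<alpha> a) = VHom B (FOb F a) (FOb G a)"
  using vnat_in[OF assms] by simp_all

lemma vnat_natural_el:
  assumes [simp]: "a \<in> VOb A" "b \<in> VOb A" "f \<in> Arr V" "Cod V f = VHom A a b"
  shows "vpost V B (FOb F a) (FOb F b) (FOb G b) (\<alpha> b) \<cdot> (FHom F a b \<cdot> f)
    = vpre V B (FOb F a) (FOb G a) (FOb G b) (\<alpha> a) \<cdot> (FHom G a b \<cdot> f)"
  using F.comp_cong_tail[OF vnat_natural[of a b], where x = f] by simp

end

context vcategory begin

lemma vfun_id_simps [simp]: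
  "a \<in> VOb A \<Longrightarrow> FOb (vfun_id V A) a = a"
  "\<lbrakk>a \<in> VOb A; b \<in> VOb A\<rbrakk> \<Longrightarrow> FHom (vfun_id V A) a b = Idn V (VHom A a b)"
  by (simp_all add: vfun_id_def)

lemma vfunctor_vfun_id: "vfunctor V A A (vfun_id V A)"
  unfolding vfun_id_def by (rule vfunctor_mk_vfun) (simp_all add: vcategory_axioms)

end

lemma vfun_comp_simps [simp]:
  "a \<in> VOb A \<Longrightarrow> FOb (vfun_comp V A G F) a = FOb G (FOb F a)"
  "\<lbrakk>a \<in> VOb A; b \<in> VOb A\<rbrakk> \<Longrightarrow> FHom (vfun_comp V A G F) a b
     = FHom G (FOb F a) (FOb F b) \<cdot>\<^bsub>V\<^esub> FHom F a b"
  by (simp_all add: vfun_comp_def)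

lemma vfunctor_vfun_comp:
  assumes "vfunctor V A B F" "vfunctor V B D G"
  shows "vfunctor V A D (vfun_comp V A G F)"
proof -
  interpret F: vfunctor V A B F by fact
  interpret G: vfunctor V B D G by fact
  show ?thesis unfolding vfun_comp_def
    by (rule F.vfunctor_mk_vfun)
       (simp_all add: F.vcategory_axioms G.B.vcategory_axioms F.FHom_VCmp G.FHom_VCmp_el)
qed

text \<open>
  The inverses of the hom arrows preserve composition and identities because this may be tested
  after applying the invertible hom arrows of \<open>F\<close>.
\<close>

lemma iso_vfunctorI:
  assumes F: "vfunctor V A B F"
    and bij: "bij_betw (FOb F) (VOb A) (VOb B)"
    and iso: "\<And>a b. \<lbrakk>a \<in> VOb A; b \<in> VOb A\<rbrakk> \<Longrightarrow> is_iso V (FHom F a b)"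
  shows "iso_vfunctor V A B F"
proof -
  interpret F: vfunctor V A B F by fact
  define go where "go = inv_into (VOb A) (FOb F)"
  define gh where "gh x y = inverse_arr V (FHom F (go x) (go y))" for x y
  have go [simp]: "x \<in> VOb B \<Longrightarrow> go x \<in> VOb A" "x \<in> VOb B \<Longrightarrow> FOb F (go x) = x"
      "a \<in> VOb A \<Longrightarrow> go (FOb F a) = a" for x a
    using bij by (auto simp: go_def bij_betw_def inv_into_into f_inv_into_f)
  have gh [simp]: "gh x y \<in> Arr V" "Dom V (gh x y) = VHom B x y" "Cod V (gh x y) = VHom A (go x) (go y)"
    "Cmp V (FHom F (go x) (go y)) (gh x y) = Idn V (VHom B x y)"
    "Cmp V (gh x y) (FHom F (go x) (go y)) = Idn V (VHom A (go x) (go y))"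
    if "x \<in> VOb B" "y \<in> VOb B" for x y
    using that F.inverse_types[OF iso] F.inverse_cancel[OF iso] by (simp_all add: gh_def)
  define G where "G = mk_vfun B go gh"
  have G: "vfunctor V B A G" unfolding G_def
  proof (rule F.vfunctor_mk_vfun)
    fix a b c assume [simp]: "a \<in> VOb B" "b \<in> VOb B" "c \<in> VOb B"
    have "Cmp V (FHom F (go a) (go c)) (Cmp V (gh a c) (VCmp B a b c))
      = Cmp V (FHom F (go a) (go c)) (Cmp V (VCmp A (go a) (go b) (go c)) (tena V (gh b c) (gh a b)))"
      using F.comp_tail[OF gh(4)[of a c], of "VCmp B a b c"] by (simp add: F.FHom_VCmp_el)
    thus "Cmp V (gh a c) (VCmp B a b c) = Cmp V (VCmp A (go a) (go b) (go c)) (tena V (gh b c) (gh a b))"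
      by (rule F.iso_mono) (simp_all add: iso)
  next
    fix a assume [simp]: "a \<in> VOb B"
    have "Cmp V (FHom F (go a) (go a)) (Cmp V (gh a a) (VId B a)) = Cmp V (FHom F (go a) (go a)) (VId A (go a))"
      using F.comp_tail[OF gh(4)[of a a], of "VId B a"] by simp
    thus "Cmp V (gh a a) (VId B a) = VId A (go a)"
      by (rule F.iso_mono) (simp_all add: iso)
  qed (simp_all add: F.vcategory_axioms F.B.vcategory_axioms)
  interpret G: vfunctor V B A G by fact
  have Gs [simp]: "x \<in> VOb B \<Longrightarrow> FOb G x = go x"
    "x \<in> VOb B \<Longrightarrow> y \<in> VOb B \<Longrightarrow> FHom G x y = gh x y" for x y by (simp_all add: G_def)
  have "vfun_comp V A G F = vfun_id V A"
  proof (rule vfun_eqI[OF vfunctor_vfun_comp[OF F G] F.vfunctor_vfun_id])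
    fix a b assume "a \<in> VOb A" "b \<in> VOb A"
    thus "FHom (vfun_comp V A G F) a b = FHom (vfun_id V A) a b"
      using gh(5)[of "FOb F a" "FOb F b"] by simp
  qed simp
  moreover have "vfun_comp V B F G = vfun_id V B"
    by (rule vfun_eqI[OF vfunctor_vfun_comp[OF G F] F.B.vfunctor_vfun_id]) simp_all
  ultimately show ?thesis using F G by (auto simp: iso_vfunctor_def)
qed

section \<open>Functor V-categories and restriction\<close>

context sym_monoidal_closed begin

text \<open>
  The axioms of a V-category are equations between arrows into hom objects, so they are inherited
  along a jointly monic family of projections that respects identities and composition.  For functor
  V-categories the projections are the components, for the Eilenberg-Moore object there is one
  projection, the inclusion of the equalizer.
\<close>

lemma vcategory_of_projections:
  assumes B: "vcategory V B"
    and fo [simp]: "\<And>s p. \<lbrakk>s \<in> S; p \<in> VOb A\<rbrakk> \<Longrightarrow> fo s p \<in> VOb B"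
    and H [simp]: "\<And>p q. \<lbrakk>p \<in> VOb A; q \<in> VOb A\<rbrakk> \<Longrightarrow> VHom A p q \<in> Obj V"
    and pr: "\<And>s p q. \<lbrakk>s \<in> S; p \<in> VOb A; q \<in> VOb A\<rbrakk>
      \<Longrightarrow> pr s p q \<in> hom V (VHom A p q) (VHom B (fo s p) (fo s q))"
    and mono: "\<And>p q f g. \<lbrakk>p \<in> VOb A; q \<in> VOb A; f \<in> Arr V; g \<in> Arr V; Dom V f = Dom V g;
        Cod V f = VHom A p q; Cod V g = VHom A p q; \<And>s. s \<in> S \<Longrightarrow> pr s p q \<cdot> f = pr s p q \<cdot> g\<rbrakk> \<Longrightarrow> f = g"
    and Id: "\<And>p. p \<in> VOb A \<Longrightarrow> VId A p \<in> hom V \<one> (VHom A p p)"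
    and pr_Id [simp]: "\<And>s p. \<lbrakk>s \<in> S; p \<in> VOb A\<rbrakk> \<Longrightarrow> pr s p p \<cdot> VId A p = VId B (fo s p)"
    and Cm: "\<And>p q r. \<lbrakk>p \<in> VOb A; q \<in> VOb A; r \<in> VOb A\<rbrakk>
      \<Longrightarrow> VCmp A p q r \<in> hom V (VHom A q r \<odot> VHom A p q) (VHom A p r)"
    and pr_Cm: "\<And>s p q r. \<lbrakk>s \<in> S; p \<in> VOb A; q \<in> VOb A; r \<in> VOb A\<rbrakk>
      \<Longrightarrow> pr s p r \<cdot> VCmp A p q r = VCmp B (fo s p) (fo s q) (fo s r) \<cdot> (pr s q r \<otimes> pr s p q)"
  shows "vcategory V A" "s \<in> S \<Longrightarrow> vfunctor V A B (mk_vfun A (fo s) (pr s))"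
proof -
  interpret B: vcategory V B by fact
  have prt [simp]: "pr s p q \<in> Arr V" "Dom V (pr s p q) = VHom A p q"
      "Cod V (pr s p q) = VHom B (fo s p) (fo s q)"
    if "s \<in> S" "p \<in> VOb A" "q \<in> VOb A" for s p q
    using pr[OF that] by simp_all
  have Idt [simp]: "VId A p \<in> Arr V" "Dom V (VId A p) = \<one>" "Cod V (VId A p) = VHom A p p"
    if "p \<in> VOb A" for p using Id[OF that] by simp_all
  have Cmt [simp]: "VCmp A p q r \<in> Arr V" "Dom V (VCmp A p q r) = VHom A q r \<odot> VHom A p q"
      "Cod V (VCmp A p q r) = VHom A p r"
    if "p \<in> VOb A" "q \<in> VOb A" "r \<in> VOb A" for p q r using Cm[OF that] by simp_all
  have pr_Cm' [simp]: "pr s p r \<cdot> (VCmp A p q r \<cdot> (g \<otimes> f))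
      = VCmp B (fo s p) (fo s q) (fo s r) \<cdot> ((pr s q r \<cdot> g) \<otimes> (pr s p q \<cdot> f))"
    if "s \<in> S" "p \<in> VOb A" "q \<in> VOb A" "r \<in> VOb A"
      "g \<in> Arr V" "Cod V g = VHom A q r" "f \<in> Arr V" "Cod V f = VHom A p q" for s p q r g f
    using comp_cong_tail[OF pr_Cm[of s p q r], where x = "g \<otimes> f"] that by simp
  show A: "vcategory V A"
  proof unfold_locales
    fix p q r t assume [simp]: "p \<in> VOb A" "q \<in> VOb A" "r \<in> VOb A" "t \<in> VOb A"
    show "VCmp A p q t \<cdot> (VCmp A q r t \<otimes> Idn V (VHom A p q))
        = VCmp A p r t \<cdot> (Idn V (VHom A r t) \<otimes> VCmp A p q r)
            \<cdot> assoc V (VHom A r t) (VHom A q r) (VHom A p q)"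
    proof (rule mono[of p t])
      fix s assume [simp]: "s \<in> S"
      have "pr s p t \<cdot> (VCmp A p r t \<cdot> ((Idn V (VHom A r t) \<otimes> VCmp A p q r)
            \<cdot> assoc V (VHom A r t) (VHom A q r) (VHom A p q)))
        = (pr s p t \<cdot> (VCmp A p r t \<cdot> (Idn V (VHom A r t) \<otimes> VCmp A p q r)))
            \<cdot> assoc V (VHom A r t) (VHom A q r) (VHom A p q)" by (simp del: pr_Cm')
      also have "\<dots> = VCmp B (fo s p) (fo s r) (fo s t) \<cdot> ((pr s r t \<otimes>
          (VCmp B (fo s p) (fo s q) (fo s r) \<cdot> (pr s q r \<otimes> pr s p q)))
            \<cdot> assoc V (VHom A r t) (VHom A q r) (VHom A p q))"
        by (simp add: pr_Cm)
      also have "\<dots> = VCmp B (fo s p) (fo s q) (fo s t) \<cdot>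
          ((VCmp B (fo s q) (fo s r) (fo s t) \<cdot> (pr s r t \<otimes> pr s q r)) \<otimes> pr s p q)"
        by (subst B.VCmp_assoc_el) simp_all
      also have "\<dots> = pr s p t \<cdot> (VCmp A p q t \<cdot> (VCmp A q r t \<otimes> Idn V (VHom A p q)))"
        by (simp add: pr_Cm)
      finally show "pr s p t \<cdot> (VCmp A p q t \<cdot> (VCmp A q r t \<otimes> Idn V (VHom A p q)))
        = pr s p t \<cdot> (VCmp A p r t \<cdot> ((Idn V (VHom A r t) \<otimes> VCmp A p q r)
            \<cdot> assoc V (VHom A r t) (VHom A q r) (VHom A p q)))" by simp
    qed simp_all
  next
    fix p q assume [simp]: "p \<in> VOb A" "q \<in> VOb A"
    show "VCmp A p q q \<cdot> (VId A q \<otimes> Idn V (VHom A p q)) = lunit V (VHom A p q)"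
      by (rule mono[of p q]) simp_all
    show "VCmp A p p q \<cdot> (Idn V (VHom A p q) \<otimes> VId A p) = runit V (VHom A p q)"
      by (rule mono[of p q]) simp_all
  qed simp_all
  show "vfunctor V A B (mk_vfun A (fo s) (pr s))" if "s \<in> S"
    by (rule vfunctor_mk_vfun[OF A B]) (use that in \<open>simp_all add: pr_Cm\<close>)
qed

lemma vnat_family_el:
  assumes "vnat_family V A B F G X \<beta>" and F: "vfunctor V A B F" and G: "vfunctor V A B G"
    and [simp]: "a \<in> VOb A" "b \<in> VOb A" "g \<in> Arr V" "Cod V g = VHom A a b" "f \<in> Arr V" "Cod V f = X"
  shows "VCmp B (FOb F a) (FOb G a) (FOb G b) \<cdot> ((FHom G a b \<cdot> g) \<otimes> (\<beta> a \<cdot> f))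
    = VCmp B (FOb F a) (FOb F b) (FOb G b) \<cdot> (((\<beta> b \<cdot> f) \<otimes> (FHom F a b \<cdot> g)) \<cdot> sym V (Dom V g) (Dom V f))"
proof -
  interpret F: vfunctor V A B F by fact
  interpret G: vfunctor V A B G by fact
  have b [simp]: "X \<in> Obj V" "\<And>c. c \<in> VOb A \<Longrightarrow> \<beta> c \<in> Arr V" "\<And>c. c \<in> VOb A \<Longrightarrow> Dom V (\<beta> c) = X"
    "\<And>c. c \<in> VOb A \<Longrightarrow> Cod V (\<beta> c) = VHom B (FOb F c) (FOb G c)"
    using assms(1) by (simp_all add: vnat_family_def)
  have "VCmp B (FOb F a) (FOb G a) (FOb G b) \<cdot> ((FHom G a b \<cdot> g) \<otimes> (\<beta> a \<cdot> f))
    = (VCmp B (FOb F a) (FOb G a) (FOb G b) \<cdot> (FHom G a b \<otimes> \<beta> a)) \<cdot> (g \<otimes> f)" by simp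
  also have "\<dots> = (VCmp B (FOb F a) (FOb F b) (FOb G b) \<cdot> ((\<beta> b \<otimes> FHom F a b) \<cdot> sym V (VHom A a b) X)) \<cdot> (g \<otimes> f)"
    using assms(1) by (simp add: vnat_family_def)
  also have "\<dots> = VCmp B (FOb F a) (FOb F b) (FOb G b) \<cdot>
     (((\<beta> b \<cdot> f) \<otimes> (FHom F a b \<cdot> g)) \<cdot> sym V (Dom V g) (Dom V f))"
    by (simp add: sym_nat)
  finally show ?thesis .
qed

lemma vnat_family_types:
  assumes "vnat_family V A B F G X \<beta>"
  shows "X \<in> Obj V" "\<And>c. c \<in> VOb A \<Longrightarrow> \<beta> c \<in> Arr V" "\<And>c. c \<in> VOb A \<Longrightarrow> Dom V (\<beta> c) = X"
    "\<And>c. c \<in> VOb A \<Longrightarrow> Cod V (\<beta> c) = VHom B (FOb F c) (FOb G c)"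
  using assms by (simp_all add: vnat_family_def)

lemma vnat_family_comp:
  assumes \<beta>: "vnat_family V A B F G X \<beta>" and F: "vfunctor V A B F" and G: "vfunctor V A B G"
    and [simp]: "f \<in> Arr V" "Cod V f = X"
  shows "vnat_family V A B F G (Dom V f) (\<lambda>a. \<beta> a \<cdot> f)"
proof -
  interpret F: vfunctor V A B F by fact
  interpret G: vfunctor V A B G by fact
  note [simp] = vnat_family_types[OF \<beta>]
  show ?thesis
    using vnat_family_el[OF \<beta> F G _ _ _ _ assms(4,5), of a b "Idn V (VHom A a b)" for a b]
    unfolding vnat_family_def by simp
qed

text \<open>
  The two naturality conditions differ by composition with the isomorphism \<open>X \<cong> X \<odot> \<one>\<close>.  Hence the
  global elements of the hom object \<open>[A,B](F,G)\<close> are the V-natural transformations.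
\<close>

lemma vnat_iff_vnat_family:
  assumes F: "vfunctor V A B F" and G: "vfunctor V A B G"
  shows "vnat V A B F G \<alpha> \<longleftrightarrow> vnat_family V A B F G \<one> \<alpha>"
proof -
  interpret F: vfunctor V A B F by fact
  interpret G: vfunctor V A B G by fact
  have key: "(vpost V B (FOb F a) (FOb F b) (FOb G b) (\<alpha> b) \<cdot> FHom F a b
        = vpre V B (FOb F a) (FOb G a) (FOb G b) (\<alpha> a) \<cdot> FHom G a b) \<longleftrightarrow>
      (VCmp B (FOb F a) (FOb G a) (FOb G b) \<cdot> (FHom G a b \<otimes> \<alpha> a)
        = VCmp B (FOb F a) (FOb F b) (FOb G b) \<cdot> ((\<alpha> b \<otimes> FHom F a b) \<cdot> sym V (VHom A a b) \<one>))"
    (is "?l = ?r \<longleftrightarrow> ?f = ?g")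
    if t: "\<And>a. a \<in> VOb A \<Longrightarrow> \<alpha> a \<in> hom V \<one> (VHom B (FOb F a) (FOb G a))"
      and [simp]: "a \<in> VOb A" "b \<in> VOb A" for a b
  proof -
    have [simp]: "\<alpha> a \<in> Arr V" "Dom V (\<alpha> a) = \<one>" "Cod V (\<alpha> a) = VHom B (FOb F a) (FOb G a)"
        if "a \<in> VOb A" for a using t[OF that] by simp_all
    have "?r = ?f \<cdot> rinv (VHom A a b)" by (simp add: F.B.vpre_el)
    moreover have "?l = ?g \<cdot> rinv (VHom A a b)" by (simp add: F.B.vpost_el sym_rinv)
    moreover have "?f \<cdot> rinv (VHom A a b) = ?g \<cdot> rinv (VHom A a b) \<longleftrightarrow> ?f = ?g"
      by (rule iffI, erule iso_epi) simp_all
    ultimately show ?thesis by (simp only: eq_commute)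
  qed
  show ?thesis
  proof
    assume "vnat V A B F G \<alpha>"
    then interpret vnat V A B F G \<alpha> .
    show "vnat_family V A B F G \<one> \<alpha>" unfolding vnat_family_def
      using key[OF vnat_in] vnat_natural by simp
  next
    assume f: "vnat_family V A B F G \<one> \<alpha>"
    hence t: "\<And>a. a \<in> VOb A \<Longrightarrow> \<alpha> a \<in> hom V \<one> (VHom B (FOb F a) (FOb G a))"
      by (simp add: vnat_family_def)
    show "vnat V A B F G \<alpha>"
      by unfold_locales (use t key[OF t] f in \<open>simp_all add: vnat_family_def\<close>)
  qed
qed

end

text \<open>
  The functor V-category is defined by choosing ends, so its properties need their existence, which
  is assumed here and follows from completeness of \<open>V\<close> when \<open>A\<close> is small.
\<close>

locale functor_category_ends = A: vcategory V A + B: vcategory V B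
  for V :: "('o, 'm) smc" (structure)
    and A :: "('a, 'o, 'm) vcat" and B :: "('b, 'o, 'm) vcat" +
  assumes has_end: "\<lbrakk>vfunctor V A B F; vfunctor V A B G\<rbrakk> \<Longrightarrow> \<exists>E p. is_end V A B F G E p"
begin

abbreviation "proj \<equiv> fun_proj V A B"
abbreviation "FC \<equiv> functor_vcat V A B"

lemma VOb_FC [simp]: "F \<in> VOb FC \<longleftrightarrow> vfunctor V A B F"
  by (simp add: functor_vcat_def)

lemma is_end_proj:
  assumes "vfunctor V A B F" "vfunctor V A B G"
  shows "is_end V A B F G (VHom FC F G) (proj F G)"
  using someI_ex[of "\<lambda>x. case x of (E, p) \<Rightarrow> is_end V A B F G E p"] has_end[OF assms]
  by (auto simp: functor_vcat_def fun_end_def split: prod.splits)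

lemma proj_family:
  assumes "vfunctor V A B F" "vfunctor V A B G"
  shows "vnat_family V A B F G (VHom FC F G) (proj F G)"
  using is_end_proj[OF assms] by (simp add: is_end_def)

lemma hom_obj [simp]: "\<lbrakk>vfunctor V A B F; vfunctor V A B G\<rbrakk> \<Longrightarrow> VHom FC F G \<in> Obj V"
  using proj_family by (simp add: vnat_family_def)

lemma proj_types [simp]:
  assumes "vfunctor V A B F" "vfunctor V A B G" "a \<in> VOb A"
  shows "proj F G a \<in> Arr V" "Dom V (proj F G a) = VHom FC F G"
    "Cod V (proj F G a) = VHom B (FOb F a) (FOb G a)"
  using proj_family[OF assms(1,2)] assms(3) by (simp_all add: vnat_family_def)

lemma proj_natural:
  assumes "vfunctor V A B F" "vfunctor V A B G"
    "a \<in> VOb A" "b \<in> VOb A" "g \<in> Arr V" "Cod V g = VHom A a b" "f \<in> Arr V" "Cod V f = VHom FC F G"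
  shows "VCmp B (FOb F a) (FOb G a) (FOb G b) \<cdot> ((FHom G a b \<cdot> g) \<otimes> (proj F G a \<cdot> f))
    = VCmp B (FOb F a) (FOb F b) (FOb G b) \<cdot> (((proj F G b \<cdot> f) \<otimes> (FHom F a b \<cdot> g)) \<cdot> sym V (Dom V g) (Dom V f))"
  by (rule A.vnat_family_el[OF proj_family]) (use assms in simp_all)

lemma proj_lift:
  assumes "vfunctor V A B F" "vfunctor V A B G" "vnat_family V A B F G X \<beta>"
  obtains f where "f \<in> Arr V" "Dom V f = X" "Cod V f = VHom FC F G"
    "\<And>a. a \<in> VOb A \<Longrightarrow> proj F G a \<cdot> f = \<beta> a"
  using is_end_proj[OF assms(1,2)] assms(3) unfolding is_end_def by (metis A.in_hom_iff)

lemma proj_eqI: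
  assumes "vfunctor V A B F" "vfunctor V A B G" "f \<in> Arr V" "g \<in> Arr V" "Dom V f = Dom V g"
    "Cod V f = VHom FC F G" "Cod V g = VHom FC F G"
    "\<And>a. a \<in> VOb A \<Longrightarrow> proj F G a \<cdot> f = proj F G a \<cdot> g"
  shows "f = g"
proof -
  have "vnat_family V A B F G (Dom V f) (\<lambda>a. proj F G a \<cdot> f)"
    by (rule A.vnat_family_comp[OF proj_family]) (use assms in simp_all)
  hence "\<exists>!h. h \<in> hom V (Dom V f) (VHom FC F G) \<and> (\<forall>a\<in>VOb A. proj F G a \<cdot> h = proj F G a \<cdot> f)"
    using is_end_proj[OF assms(1,2)] unfolding is_end_def by blast
  moreover have "f \<in> hom V (Dom V f) (VHom FC F G)" "g \<in> hom V (Dom V f) (VHom FC F G)"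
    using assms(3-7) by simp_all
  moreover have "\<forall>a\<in>VOb A. proj F G a \<cdot> g = proj F G a \<cdot> f" using assms(8) by auto
  ultimately show ?thesis by blast
qed

lemma identity_family:
  assumes "vfunctor V A B F"
  shows "vnat_family V A B F F \<one> (\<lambda>a. VId B (FOb F a))"
proof -
  interpret F: vfunctor V A B F by fact
  show ?thesis by (simp add: vnat_family_def A.lunit_sym)
qed

lemma VId_FC:
  assumes F: "vfunctor V A B F"
  shows "VId FC F \<in> hom V \<one> (VHom FC F F)" "\<And>a. a \<in> VOb A \<Longrightarrow> proj F F a \<cdot> VId FC F = VId B (FOb F a)"
proof -
  obtain i where i: "i \<in> Arr V" "Dom V i = \<one>" "Cod V i = VHom FC F F"
    "\<And>a. a \<in> VOb A \<Longrightarrow> proj F F a \<cdot> i = VId B (FOb F a)"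
    using proj_lift[OF F F identity_family[OF F]] by blast
  have "VId FC F = (THE i. i \<in> hom V \<one> (VHom FC F F) \<and> (\<forall>a \<in> VOb A. proj F F a \<cdot> i = VId B (FOb F a)))"
    by (simp add: functor_vcat_def)
  also have "\<dots> = i"
    by (rule the_equality) (use i in \<open>auto intro: proj_eqI[OF F F]\<close>)
  finally show "VId FC F \<in> hom V \<one> (VHom FC F F)"
    "\<And>a. a \<in> VOb A \<Longrightarrow> proj F F a \<cdot> VId FC F = VId B (FOb F a)" using i by simp_all
qed

text \<open>
  Moving the hom object of \<open>A\<close> past \<open>X\<close> by naturality of \<open>\<beta>\<close> and then past \<open>Y\<close> by naturality of
  \<open>\<alpha>\<close> moves it past \<open>X \<odot> Y\<close>, by the hexagon.
\<close>

lemma composite_family: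
  assumes F: "vfunctor V A B F" and G: "vfunctor V A B G" and K: "vfunctor V A B K"
    and \<alpha>: "vnat_family V A B F G Y \<alpha>" and \<beta>: "vnat_family V A B G K X \<beta>"
  shows "vnat_family V A B F K (X \<odot> Y) (\<lambda>a. VCmp B (FOb F a) (FOb G a) (FOb K a) \<cdot> (\<beta> a \<otimes> \<alpha> a))"
  unfolding vnat_family_def
proof (intro conjI ballI)
  interpret F: vfunctor V A B F by fact
  interpret G: vfunctor V A B G by fact
  interpret K: vfunctor V A B K by fact
  note [simp] = A.vnat_family_types[OF \<alpha>] A.vnat_family_types[OF \<beta>]
  show "X \<odot> Y \<in> Obj V" by simp
  fix a assume [simp]: "a \<in> VOb A"
  show "VCmp B (FOb F a) (FOb G a) (FOb K a) \<cdot> (\<beta> a \<otimes> \<alpha> a) \<in> hom V (X \<odot> Y) (VHom B (FOb F a) (FOb K a))"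
    by simp
  fix b assume [simp]: "b \<in> VOb A"
  let ?P = "VHom A a b"
  let ?m = "\<lambda>p q r. VCmp B p q r"
  have "(?m (FOb F a) (FOb K a) (FOb K b) \<cdot> (FHom K a b \<otimes> (?m (FOb F a) (FOb G a) (FOb K a) \<cdot> (\<beta> a \<otimes> \<alpha> a))))
      \<cdot> assoc V ?P X Y
    = ?m (FOb F a) (FOb G a) (FOb K b) \<cdot> ((?m (FOb G a) (FOb K a) (FOb K b) \<cdot> (FHom K a b \<otimes> \<beta> a)) \<otimes> \<alpha> a)"
    by (simp add: B.VCmp_assoc_el)
  also have "\<dots> = (?m (FOb F a) (FOb G a) (FOb K b) \<cdot>
      ((?m (FOb G a) (FOb G b) (FOb K b) \<cdot> (\<beta> b \<otimes> FHom G a b)) \<otimes> \<alpha> a)) \<cdot> (sym V ?P X \<otimes> Idn V Y)"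
    using A.vnat_family_el[OF \<beta> G K, of a b "Idn V ?P" "Idn V X"] by simp
  also have "\<dots> = ?m (FOb F a) (FOb G b) (FOb K b) \<cdot> ((\<beta> b \<otimes> (?m (FOb F a) (FOb G a) (FOb G b) \<cdot> (FHom G a b \<otimes> \<alpha> a)))
      \<cdot> (assoc V X ?P Y \<cdot> (sym V ?P X \<otimes> Idn V Y)))"
    by (subst B.VCmp_assoc_el) simp_all
  also have "\<dots> = ?m (FOb F a) (FOb G b) (FOb K b) \<cdot> ((\<beta> b \<otimes> (?m (FOb F a) (FOb F b) (FOb G b) \<cdot> (\<alpha> b \<otimes> FHom F a b)))
      \<cdot> ((Idn V X \<otimes> sym V ?P Y) \<cdot> (assoc V X ?P Y \<cdot> (sym V ?P X \<otimes> Idn V Y))))"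
    using A.vnat_family_el[OF \<alpha> F G, of a b "Idn V ?P" "Idn V Y"] by simp
  \<comment> \<open>the two transpositions combine to one past \<open>X \<odot> Y\<close>\<close>
  also have "(Idn V X \<otimes> sym V ?P Y) \<cdot> (assoc V X ?P Y \<cdot> (sym V ?P X \<otimes> Idn V Y))
      = assoc V X Y ?P \<cdot> (sym V ?P (X \<odot> Y) \<cdot> assoc V ?P X Y)"
    using A.hexagon[of ?P X Y] by simp
  also have "?m (FOb F a) (FOb G b) (FOb K b) \<cdot> ((\<beta> b \<otimes> (?m (FOb F a) (FOb F b) (FOb G b) \<cdot> (\<alpha> b \<otimes> FHom F a b)))
      \<cdot> (assoc V X Y ?P \<cdot> (sym V ?P (X \<odot> Y) \<cdot> assoc V ?P X Y)))
    = (?m (FOb F a) (FOb F b) (FOb K b) \<cdot> ((?m (FOb F b) (FOb G b) (FOb K b) \<cdot> (\<beta> b \<otimes> \<alpha> b)) \<otimes> FHom F a b))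
      \<cdot> (sym V ?P (X \<odot> Y) \<cdot> assoc V ?P X Y)"
    by (subst B.VCmp_assoc_el) simp_all
  also have "\<dots> = (?m (FOb F a) (FOb F b) (FOb K b) \<cdot> (((?m (FOb F b) (FOb G b) (FOb K b) \<cdot> (\<beta> b \<otimes> \<alpha> b)) \<otimes> FHom F a b)
      \<cdot> sym V ?P (X \<odot> Y))) \<cdot> assoc V ?P X Y" by simp
  finally show "?m (FOb F a) (FOb K a) (FOb K b) \<cdot> (FHom K a b \<otimes> (?m (FOb F a) (FOb G a) (FOb K a) \<cdot> (\<beta> a \<otimes> \<alpha> a)))
    = ?m (FOb F a) (FOb F b) (FOb K b) \<cdot> (((?m (FOb F b) (FOb G b) (FOb K b) \<cdot> (\<beta> b \<otimes> \<alpha> b)) \<otimes> FHom F a b)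
      \<cdot> sym V ?P (X \<odot> Y))"
    by (rule A.iso_epi) simp_all
qed

lemma VCmp_FC:
  assumes F: "vfunctor V A B F" and G: "vfunctor V A B G" and K: "vfunctor V A B K"
  shows "VCmp FC F G K \<in> hom V (VHom FC G K \<odot> VHom FC F G) (VHom FC F K)"
    "\<And>a. a \<in> VOb A \<Longrightarrow> proj F K a \<cdot> VCmp FC F G K
      = VCmp B (FOb F a) (FOb G a) (FOb K a) \<cdot> (proj G K a \<otimes> proj F G a)"
proof -
  let ?\<gamma> = "\<lambda>a. VCmp B (FOb F a) (FOb G a) (FOb K a) \<cdot> (proj G K a \<otimes> proj F G a)"
  let ?X = "VHom FC G K \<odot> VHom FC F G"
  obtain c where c: "c \<in> Arr V" "Dom V c = ?X" "Cod V c = VHom FC F K"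
    "\<And>a. a \<in> VOb A \<Longrightarrow> proj F K a \<cdot> c = ?\<gamma> a"
    using proj_lift[OF F K composite_family[OF F G K proj_family[OF F G] proj_family[OF G K]]] by blast
  have "VCmp FC F G K = (THE c. c \<in> hom V ?X (VHom FC F K) \<and> (\<forall>a \<in> VOb A. proj F K a \<cdot> c = ?\<gamma> a))"
    by (simp add: functor_vcat_def)
  also have "\<dots> = c"
    by (rule the_equality) (use c in \<open>auto intro: proj_eqI[OF F K]\<close>)
  finally show "VCmp FC F G K \<in> hom V ?X (VHom FC F K)"
    "\<And>a. a \<in> VOb A \<Longrightarrow> proj F K a \<cdot> VCmp FC F G K = ?\<gamma> a" using c by simp_all
qed

text \<open>
  Evaluation at \<open>a\<close>: being a V-functor, it carries \<open>vpost\<close> and \<open>vpre\<close> of the functor V-category to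
  those of \<open>B\<close>, so equations in the functor V-category are checked componentwise.
\<close>

abbreviation "evaluation a \<equiv> mk_vfun FC (\<lambda>F. FOb F a) (\<lambda>F G. proj F G a)"

lemma vcategory_FC: "vcategory V FC"
  and vfunctor_evaluation: "a \<in> VOb A \<Longrightarrow> vfunctor V FC B (evaluation a)"
proof -
  note * = A.vcategory_of_projections[OF B.vcategory_axioms, of "VOb A" FC "\<lambda>a F. FOb F a" "\<lambda>a F G. proj F G a"]
  have "FOb F a \<in> VOb B" if "a \<in> VOb A" "vfunctor V A B F" for F a
    using that(1) vfunctor.FOb_in[OF that(2)] by simp
  thus "vcategory V FC" "a \<in> VOb A \<Longrightarrow> vfunctor V FC B (evaluation a)"
    using * VId_FC VCmp_FC proj_eqI by (simp_all del: A.in_hom_iff add: A.in_hom_iff[of "proj _ _ _"])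
qed

lemma proj_vpost:
  assumes "vfunctor V A B F" "vfunctor V A B G" "vfunctor V A B K" "a \<in> VOb A"
    "e \<in> Arr V" "Dom V e = \<one>" "Cod V e = VHom FC G K" "f \<in> Arr V" "Cod V f = VHom FC F G"
  shows "proj F K a \<cdot> (vpost V FC F G K e \<cdot> f)
    = vpost V B (FOb F a) (FOb G a) (FOb K a) (proj G K a \<cdot> e) \<cdot> (proj F G a \<cdot> f)"
  using vfunctor.FHom_vpost[OF vfunctor_evaluation[OF assms(4)], of F G K e f] assms by simp

lemma proj_vpre:
  assumes "vfunctor V A B F" "vfunctor V A B G" "vfunctor V A B K" "a \<in> VOb A"
    "e \<in> Arr V" "Dom V e = \<one>" "Cod V e = VHom FC F G" "f \<in> Arr V" "Cod V f = VHom FC G K"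
  shows "proj F K a \<cdot> (vpre V FC F G K e \<cdot> f)
    = vpre V B (FOb F a) (FOb G a) (FOb K a) (proj F G a \<cdot> e) \<cdot> (proj G K a \<cdot> f)"
  using vfunctor.FHom_vpre[OF vfunctor_evaluation[OF assms(4)], of F G K e f] assms by simp

lemma vnat_of_element:
  assumes "vfunctor V A B F" "vfunctor V A B G" "e \<in> Arr V" "Dom V e = \<one>" "Cod V e = VHom FC F G"
  shows "vnat V A B F G (\<lambda>a. proj F G a \<cdot> e)"
  using A.vnat_family_comp[OF proj_family[OF assms(1,2)] assms(1,2), of e] assms
    A.vnat_iff_vnat_family[OF assms(1,2)] by simp

end

locale restriction = AB: functor_category_ends V A B + CB: functor_category_ends V C B + J: vfunctor V A C J
  for V :: "('o, 'm) smc" (structure)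
    and A :: "('a, 'o, 'm) vcat" and C :: "('c, 'o, 'm) vcat" and B :: "('b, 'o, 'm) vcat"
    and J :: "('a, 'c, 'm) vfun"
begin

abbreviation "R \<equiv> precomp V A C B J"

lemma R_ob [simp]: "vfunctor V C B F \<Longrightarrow> FOb R F = vfun_comp V A F J"
  by (simp add: precomp_def)

lemma comp_J [simp]: "vfunctor V C B F \<Longrightarrow> vfunctor V A B (vfun_comp V A F J)"
  by (rule vfunctor_vfun_comp[OF J.vfunctor_axioms])

text \<open>
  Naturality along \<open>J\<close> is an instance of naturality, at the generalized element \<open>J\<^sub>a\<^sub>b\<close> of the hom
  object of \<open>C\<close>.
\<close>

lemma restricted_family:
  assumes F: "vfunctor V C B F" and G: "vfunctor V C B G" and \<beta>: "vnat_family V C B F G X \<beta>"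
  shows "vnat_family V A B (vfun_comp V A F J) (vfun_comp V A G J) X (\<lambda>a. \<beta> (FOb J a))"
  using AB.A.vnat_family_el[OF \<beta> F G, of "FOb J a" "FOb J b" "FHom J a b" "Idn V X" for a b]
    AB.A.vnat_family_types[OF \<beta>]
  unfolding vnat_family_def by simp

lemma R_hom:
  assumes F: "vfunctor V C B F" and G: "vfunctor V C B G"
  shows "FHom R F G \<in> hom V (VHom CB.FC F G) (VHom AB.FC (FOb R F) (FOb R G))"
    "\<And>a. a \<in> VOb A \<Longrightarrow> AB.proj (vfun_comp V A F J) (vfun_comp V A G J) a \<cdot> FHom R F G = CB.proj F G (FOb J a)"
proof -
  note fam = restricted_family[OF F G CB.proj_family[OF F G]]
  obtain f where f: "f \<in> Arr V" "Dom V f = VHom CB.FC F G"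
    "Cod V f = VHom AB.FC (vfun_comp V A F J) (vfun_comp V A G J)"
    "\<And>a. a \<in> VOb A \<Longrightarrow> AB.proj (vfun_comp V A F J) (vfun_comp V A G J) a \<cdot> f = CB.proj F G (FOb J a)"
    using AB.proj_lift[OF comp_J[OF F] comp_J[OF G] fam] by blast
  have "FHom R F G = (THE f. f \<in> hom V (VHom CB.FC F G) (VHom AB.FC (vfun_comp V A F J) (vfun_comp V A G J)) \<and>
        (\<forall>a \<in> VOb A. AB.proj (vfun_comp V A F J) (vfun_comp V A G J) a \<cdot> f = CB.proj F G (FOb J a)))"
    using F G by (simp add: precomp_def functor_vcat_def)
  also have "\<dots> = f"
    by (rule the_equality) (use f in \<open>auto intro: AB.proj_eqI[OF comp_J[OF F] comp_J[OF G]]\<close>)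
  finally show "FHom R F G \<in> hom V (VHom CB.FC F G) (VHom AB.FC (FOb R F) (FOb R G))"
    "\<And>a. a \<in> VOb A \<Longrightarrow> AB.proj (vfun_comp V A F J) (vfun_comp V A G J) a \<cdot> FHom R F G = CB.proj F G (FOb J a)"
    using f F G by simp_all
qed

lemma R_hom_types [simp]:
  assumes "vfunctor V C B F" "vfunctor V C B G"
  shows "FHom R F G \<in> Arr V" "Dom V (FHom R F G) = VHom CB.FC F G"
    "Cod V (FHom R F G) = VHom AB.FC (vfun_comp V A F J) (vfun_comp V A G J)"
  using R_hom(1)[OF assms] assms by simp_all

lemma proj_R:
  assumes "vfunctor V C B F" "vfunctor V C B G" "a \<in> VOb A" "x \<in> Arr V" "Cod V x = VHom CB.FC F G"
  shows "AB.proj (vfun_comp V A F J) (vfun_comp V A G J) a \<cdot> (FHom R F G \<cdot> x) = CB.proj F G (FOb J a) \<cdot> x"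
  by (rule AB.A.comp_tail[OF R_hom(2)]) (use assms in simp_all)

lemma vfunctor_R: "vfunctor V CB.FC AB.FC R"
proof -
  interpret CBF: vcategory V CB.FC by (rule CB.vcategory_FC)
  interpret ABF: vcategory V AB.FC by (rule AB.vcategory_FC)
  let ?c = "\<lambda>F. vfun_comp V A F J"
  show ?thesis
  proof
    fix F G K assume FGK: "F \<in> VOb CB.FC" "G \<in> VOb CB.FC" "K \<in> VOb CB.FC"
    hence [simp]: "vfunctor V C B F" "vfunctor V C B G" "vfunctor V C B K" by simp_all
    show "FHom R F K \<cdot> VCmp CB.FC F G K
        = VCmp AB.FC (FOb R F) (FOb R G) (FOb R K) \<cdot> (FHom R G K \<otimes> FHom R F G)"
    proof (rule AB.proj_eqI[of "?c F" "?c K"])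
      fix a assume [simp]: "a \<in> VOb A"
      interpret E: vfunctor V AB.FC B "AB.evaluation a" by (rule AB.vfunctor_evaluation) simp
      show "AB.proj (?c F) (?c K) a \<cdot> (FHom R F K \<cdot> VCmp CB.FC F G K) =
         AB.proj (?c F) (?c K) a \<cdot> (VCmp AB.FC (FOb R F) (FOb R G) (FOb R K) \<cdot> (FHom R G K \<otimes> FHom R F G))"
        using E.FHom_VCmp_el[of "?c F" "?c G" "?c K" "FHom R G K" "FHom R F G"]
          CB.VCmp_FC(2)[of F G K "FOb J a"]
        by (simp add: proj_R R_hom)
    qed simp_all
  next
    fix F assume "F \<in> VOb CB.FC"
    hence [simp]: "vfunctor V C B F" by simp
    show "FHom R F F \<cdot> VId CB.FC F = VId AB.FC (FOb R F)"
      by (rule AB.proj_eqI[of "?c F" "?c F"]) (simp_all add: proj_R AB.VId_FC CB.VId_FC)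
  qed (simp_all, auto simp: precomp_def)
qed

end

section \<open>Small limits and ends\<close>

context includes cardinal_syntax begin

lemma small_finite:
  assumes "size_universe U" "finite A"
  shows "small U A"
  unfolding small_def
  by (rule finite_ordLess_infinite)
     (use assms in \<open>simp_all add: size_universe_def card_of_well_order_on Field_card_of\<close>)

lemma small_square:
  assumes U: "size_universe U" and A: "small U A"
  shows "small U (A \<times> A)"
proof (cases "finite A")
  case True
  thus ?thesis by (simp add: small_finite[OF U])
next
  case False
  hence "|A \<times> A| =o |A|" by (rule card_of_Times_same_infinite)
  thus ?thesis using A ordIso_ordLess_trans unfolding small_def by blast
qed

lemma small_Plus:
  assumes "size_universe U" "small U A" "small U B"
  shows "small U (A <+> B)"
  using assms card_of_Plus_ordLess_infinite unfolding small_def size_universe_def by blast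

lemma small_image: "small U A \<Longrightarrow> small U (f ` A)"
  unfolding small_def using card_of_image ordLeq_ordLess_trans by blast

lemma small_embeds:
  fixes U :: "'u set"
  assumes "small U A"
  obtains f :: "'x \<Rightarrow> 'u" where "inj_on f A"
  using assms unfolding small_def
  by (metis card_of_ordLeq ordLess_imp_ordLeq)

end

text \<open>
  The shape of a small diagram may be a category of any type: it is carried to the type of \<open>U\<close> along
  injections of its sets of objects and arrows.
\<close>

lemma small_limit_exists:
  assumes C: "complete_cat (U :: 'u set) C" and J: "category J"
    and small: "small U (Obj J)" "small U (Arr J)" and D: "is_functor J C Do Da"
  shows "\<exists>X p. is_limit J C Do Da X p"
proof -
  interpret J: category J by fact
  obtain i :: "_ \<Rightarrow> 'u" where i: "inj_on i (Obj J)" using small_embeds[OF small(1)] by blast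
  obtain k :: "_ \<Rightarrow> 'u" where k: "inj_on k (Arr J)" using small_embeds[OF small(2)] by blast
  define i' where "i' = inv_into (Obj J) i"
  define k' where "k' = inv_into (Arr J) k"
  have i' [simp]: "x \<in> Obj J \<Longrightarrow> i' (i x) = x" for x using i by (simp add: i'_def)
  have k' [simp]: "x \<in> Arr J \<Longrightarrow> k' (k x) = x" for x using k by (simp add: k'_def)
  \<comment> \<open>the copy of the shape in the type of \<open>U\<close>\<close>
  define J' :: "('u, 'u) cat" where "J' = \<lparr>Obj = i ` Obj J, Arr = k ` Arr J, Dom = (\<lambda>f. i (Dom J (k' f))),
    Cod = (\<lambda>f. i (Cod J (k' f))), Idn = (\<lambda>x. k (Idn J (i' x))), Cmp = (\<lambda>g f. k (Cmp J (k' g) (k' f)))\<rparr>"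
  have eqi [simp]: "i x = i y \<longleftrightarrow> x = y" if "x \<in> Obj J" "y \<in> Obj J" for x y
    using i that by (auto simp: inj_on_def)
  have J': "category J'"
  proof
    fix f g h A B D E
    assume "f \<in> hom J' A B" "g \<in> hom J' B D" "h \<in> hom J' D E"
    thus "Cmp J' (Cmp J' h g) f = Cmp J' h (Cmp J' g f)" by (auto simp: J'_def hom_def)
  qed (auto simp: J'_def hom_def)
  have D': "is_functor J' C (Do \<circ> i') (Da \<circ> k')"
    using D unfolding is_functor_def J'_def by auto
  have "\<exists>X p. is_limit J' C (Do \<circ> i') (Da \<circ> k') X p"
    using C J' D' small_image[OF small(1), of i] small_image[OF small(2), of k]
    unfolding complete_cat_def by (auto simp: J'_def)
  then obtain X p where lim: "is_limit J' C (Do \<circ> i') (Da \<circ> k') X p" by blast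
  have cone: "is_cone J' C (Do \<circ> i') (Da \<circ> k') Y q \<longleftrightarrow> is_cone J C Do Da Y (\<lambda>x. q (i x))" for Y q
    by (simp add: is_cone_def J'_def)
  have "is_limit J C Do Da X (\<lambda>x. p (i x))" unfolding is_limit_def
  proof (intro conjI allI impI)
    show "is_cone J C Do Da X (\<lambda>x. p (i x))" using lim cone by (simp add: is_limit_def)
    fix Y q assume "is_cone J C Do Da Y q"
    hence "is_cone J' C (Do \<circ> i') (Da \<circ> k') Y (q \<circ> i')" unfolding cone by (simp add: is_cone_def)
    hence "\<exists>!f. f \<in> hom C Y X \<and> (\<forall>x \<in> Obj J'. Cmp C (p x) f = (q \<circ> i') x)"
      using lim unfolding is_limit_def by blast
    thus "\<exists>!f. f \<in> hom C Y X \<and> (\<forall>x\<in>Obj J. Cmp C (p (i x)) f = q x)"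
      by (simp add: J'_def)
  qed
  thus ?thesis by blast
qed

context sym_monoidal_closed begin

lemma curry:
  assumes "A \<in> Obj V" "B \<in> Obj V" "f \<in> Arr V" "Dom V f = A \<odot> B" "Cod V f = D"
  shows "curry V A B D f \<in> Arr V" "Dom V (curry V A B D f) = A" "Cod V (curry V A B D f) = ihom V B D"
    "ev V B D \<cdot> (curry V A B D f \<otimes> Idn V B) = f"
proof -
  have "D \<in> Obj V" using Dom_Cod_in(2)[OF assms(3)] assms(5) by simp
  hence "\<exists>!g. g \<in> hom V A (ihom V B D) \<and> ev V B D \<cdot> (g \<otimes> Idn V B) = f"
    using closed[of A B D f] assms by simp
  from theI'[OF this] show "curry V A B D f \<in> Arr V" "Dom V (curry V A B D f) = A"
    "Cod V (curry V A B D f) = ihom V B D" "ev V B D \<cdot> (curry V A B D f \<otimes> Idn V B) = f"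
    unfolding curry_def by simp_all
qed

lemma ev_curry:
  assumes [simp]: "A \<in> Obj V" "B \<in> Obj V" "f \<in> Arr V" "Dom V f = A \<odot> B" "Cod V f = D"
    "h \<in> Arr V" "Cod V h = B"
  shows "ev V B D \<cdot> (curry V A B D f \<otimes> h) = f \<cdot> (Idn V A \<otimes> h)"
    "\<lbrakk>g \<in> Arr V; Cod V g = A\<rbrakk> \<Longrightarrow> ev V B D \<cdot> ((curry V A B D f \<cdot> g) \<otimes> h) = f \<cdot> (g \<otimes> h)"
proof -
  note c [simp] = curry[OF assms(1-5)]
  have [simp]: "D \<in> Obj V" using Dom_Cod_in(2)[OF assms(3)] assms(5) by simp
  show "ev V B D \<cdot> (curry V A B D f \<otimes> h) = f \<cdot> (Idn V A \<otimes> h)"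
    using comp_tail[OF c(4), of "Idn V A \<otimes> h"] by simp
  show "ev V B D \<cdot> ((curry V A B D f \<cdot> g) \<otimes> h) = f \<cdot> (g \<otimes> h)" if "g \<in> Arr V" "Cod V g = A"
    using comp_tail[OF c(4), of "g \<otimes> h"] that by simp
qed

lemma ev_eqI:
  assumes "ev V B D \<cdot> (f \<otimes> Idn V B) = ev V B D \<cdot> (g \<otimes> Idn V B)"
    "f \<in> Arr V" "g \<in> Arr V" "Dom V f = Dom V g" "Cod V f = ihom V B D" "Cod V g = ihom V B D"
    "B \<in> Obj V" "D \<in> Obj V"
  shows "f = g"
proof -
  have "\<exists>!h. h \<in> hom V (Dom V f) (ihom V B D) \<and> ev V B D \<cdot> (h \<otimes> Idn V B) = ev V B D \<cdot> (f \<otimes> Idn V B)"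
    by (rule closed) (use assms in simp_all)
  moreover have "f \<in> hom V (Dom V f) (ihom V B D)" "g \<in> hom V (Dom V f) (ihom V B D)"
    using assms by simp_all
  ultimately show ?thesis using assms(1) by metis
qed

end

text \<open>
  The end of \<open>B(F-,G-)\<close> is the limit of the diagram with an object \<open>B(Fa,Ga)\<close> for each \<open>a\<close>, an
  object \<open>ihom (A(a,b)) (B(Fa,Gb))\<close> for each pair \<open>(a,b)\<close>, and the two arrows from \<open>B(Fa,Ga)\<close>
  and \<open>B(Fb,Gb)\<close> to the latter whose equality is V-naturality.
\<close>

definition end_shape :: "'a set \<Rightarrow> ('a + 'a \<times> 'a, ('a + 'a \<times> 'a) + ('a \<times> 'a + 'a \<times> 'a)) cat" where
  "end_shape S = \<lparr>Obj = S <+> S \<times> S, Arr = (S <+> S \<times> S) <+> (S \<times> S <+> S \<times> S),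
     Dom = (\<lambda>f. case f of Inl x \<Rightarrow> x | Inr (Inl (a, b)) \<Rightarrow> Inl a | Inr (Inr (a, b)) \<Rightarrow> Inl b),
     Cod = (\<lambda>f. case f of Inl x \<Rightarrow> x | Inr (Inl s) \<Rightarrow> Inr s | Inr (Inr s) \<Rightarrow> Inr s),
     Idn = Inl,
     Cmp = (\<lambda>g f. case g of Inl x \<Rightarrow> f | Inr y \<Rightarrow> g)\<rparr>"

lemma category_end_shape: "category (end_shape S)"
  by unfold_locales (auto simp: end_shape_def hom_def split: sum.splits if_splits)

text \<open>
  Transposed to arrows into the internal homs, the equations of a cone over the diagram on
  \<open>end_shape\<close> are the V-naturality conditions, so cones and V-natural families coincide.
\<close>

lemma (in sym_monoidal_closed) end_exists:
  assumes U: "size_universe U" and V: "complete_cat U V" and S: "small U (VOb A)"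
    and F: "vfunctor V A B F" and G: "vfunctor V A B G"
  shows "\<exists>E p. is_end V A B F G E p"
proof -
  interpret F: vfunctor V A B F by fact
  interpret G: vfunctor V A B G by fact
  let ?J = "end_shape (VOb A)"
  define B1 where "B1 a = VHom B (FOb F a) (FOb G a)" for a
  define B2 where "B2 a b = VHom B (FOb F a) (FOb G b)" for a b
  \<comment> \<open>the two ways from a component to \<open>B(Fa,Gb)\<close>, as arrows out of a tensor product and transposed\<close>
  define l where "l a b = VCmp B (FOb F a) (FOb G a) (FOb G b) \<cdot>
    ((FHom G a b \<otimes> Idn V (B1 a)) \<cdot> sym V (B1 a) (VHom A a b))" for a b
  define r where "r a b = VCmp B (FOb F a) (FOb F b) (FOb G b) \<cdot> (Idn V (B1 b) \<otimes> FHom F a b)" for a b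
  define L where "L a b = curry V (B1 a) (VHom A a b) (B2 a b) (l a b)" for a b
  define R where "R a b = curry V (B1 b) (VHom A a b) (B2 a b) (r a b)" for a b
  define Do where "Do x = (case x of Inl a \<Rightarrow> B1 a | Inr (a, b) \<Rightarrow> ihom V (VHom A a b) (B2 a b))" for x
  define Da where "Da f = (case f of Inl x \<Rightarrow> Idn V (Do x) | Inr (Inl (a, b)) \<Rightarrow> L a b | Inr (Inr (a, b)) \<Rightarrow> R a b)" for f
  have [simp]: "a \<in> VOb A \<Longrightarrow> B1 a \<in> Obj V" "a \<in> VOb A \<Longrightarrow> b \<in> VOb A \<Longrightarrow> B2 a b \<in> Obj V" for a b
    by (simp_all add: B1_def B2_def)
  have lr [simp]: "l a b \<in> Arr V" "Dom V (l a b) = B1 a \<odot> VHom A a b" "Cod V (l a b) = B2 a b"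
    "r a b \<in> Arr V" "Dom V (r a b) = B1 b \<odot> VHom A a b" "Cod V (r a b) = B2 a b"
    if "a \<in> VOb A" "b \<in> VOb A" for a b using that by (simp_all add: l_def r_def B1_def B2_def)
  have LR [simp]: "L a b \<in> Arr V" "Dom V (L a b) = B1 a" "Cod V (L a b) = ihom V (VHom A a b) (B2 a b)"
    "R a b \<in> Arr V" "Dom V (R a b) = B1 b" "Cod V (R a b) = ihom V (VHom A a b) (B2 a b)"
    if "a \<in> VOb A" "b \<in> VOb A" for a b
    using that by (simp_all add: L_def R_def curry)
  have DoO: "x \<in> Obj ?J \<Longrightarrow> Do x \<in> Obj V" for x by (auto simp: Do_def end_shape_def)
  have diagram: "is_functor ?J V Do Da"
    unfolding is_functor_def
  proof (intro conjI ballI impI)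
    fix x assume "x \<in> Obj ?J"
    thus "Do x \<in> Obj V" "Da (Idn ?J x) = Idn V (Do x)" using DoO by (simp_all add: Da_def end_shape_def)
  next
    fix u assume "u \<in> Arr ?J"
    thus u: "Da u \<in> hom V (Do (Dom ?J u)) (Do (Cod ?J u))"
      using DoO by (auto simp: Da_def Do_def end_shape_def)
    fix v assume "v \<in> Arr ?J" "Dom ?J v = Cod ?J u"
    thus "Da (Cmp ?J v u) = Da v \<cdot> Da u"
      using \<open>u \<in> Arr ?J\<close> DoO
      by (auto simp: Da_def Do_def end_shape_def split: if_splits)
  qed
  have small: "small U (Obj ?J)" "small U (Arr ?J)"
    using U S by (simp_all add: end_shape_def small_Plus small_square)
  obtain E p where lim: "is_limit ?J V Do Da E p"
    using small_limit_exists[OF V category_end_shape small diagram] by blast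
  have natural_iff: "L a b \<cdot> \<beta> a = R a b \<cdot> \<beta> b \<longleftrightarrow>
      VCmp B (FOb F a) (FOb G a) (FOb G b) \<cdot> (FHom G a b \<otimes> \<beta> a)
        = VCmp B (FOb F a) (FOb F b) (FOb G b) \<cdot> ((\<beta> b \<otimes> FHom F a b) \<cdot> sym V (VHom A a b) X)"
      (is "_ \<longleftrightarrow> ?f = ?g")
    if [simp]: "a \<in> VOb A" "b \<in> VOb A" "X \<in> Obj V"
      and t: "\<And>a. a \<in> VOb A \<Longrightarrow> \<beta> a \<in> hom V X (B1 a)" for a b X \<beta>
  proof -
    have [simp]: "\<beta> a \<in> Arr V" "Dom V (\<beta> a) = X" "Cod V (\<beta> a) = B1 a" if "a \<in> VOb A" for a
      using t[OF that] by simp_all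
    have b1 [simp]: "VHom B (FOb F a) (FOb G a) = B1 a" for a by (simp add: B1_def)
    have [simp]: "VHom B (FOb F a) (FOb G b) = B2 a b" for a b by (simp add: B2_def)
    have "L a b \<cdot> \<beta> a = R a b \<cdot> \<beta> b \<longleftrightarrow>
       ev V (VHom A a b) (B2 a b) \<cdot> ((L a b \<cdot> \<beta> a) \<otimes> Idn V (VHom A a b))
       = ev V (VHom A a b) (B2 a b) \<cdot> ((R a b \<cdot> \<beta> b) \<otimes> Idn V (VHom A a b))"
      by (rule iffI, simp, rule ev_eqI[of "VHom A a b" "B2 a b"]) simp_all
    also have "ev V (VHom A a b) (B2 a b) \<cdot> ((L a b \<cdot> \<beta> a) \<otimes> Idn V (VHom A a b)) = ?f \<cdot> sym V X (VHom A a b)"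
      by (simp add: L_def ev_curry l_def sym_nat)
    also have "ev V (VHom A a b) (B2 a b) \<cdot> ((R a b \<cdot> \<beta> b) \<otimes> Idn V (VHom A a b)) = ?g \<cdot> sym V X (VHom A a b)"
      by (simp add: R_def ev_curry r_def)
    also have "?f \<cdot> sym V X (VHom A a b) = ?g \<cdot> sym V X (VHom A a b) \<longleftrightarrow> ?f = ?g"
      by (rule iffI, erule iso_epi) simp_all
    finally show ?thesis .
  qed
  have cone_family: "vnat_family V A B F G X (\<lambda>a. q (Inl a))" if c: "is_cone ?J V Do Da X q" for X q
  proof -
    have t: "\<And>a. a \<in> VOb A \<Longrightarrow> q (Inl a) \<in> hom V X (B1 a)" and [simp]: "X \<in> Obj V"
      using c unfolding is_cone_def end_shape_def Do_def by (auto simp del: in_hom_iff dest!: bspec[of _ _ "Inl _"])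
    have "L a b \<cdot> q (Inl a) = R a b \<cdot> q (Inl b)" if "a \<in> VOb A" "b \<in> VOb A" for a b
    proof -
      have "Inr (Inl (a, b)) \<in> Arr ?J" "Inr (Inr (a, b)) \<in> Arr ?J" using that by (auto simp: end_shape_def)
      moreover have "Da u \<cdot> q (Dom ?J u) = q (Cod ?J u)" if "u \<in> Arr ?J" for u
        using c that by (simp add: is_cone_def)
      ultimately have "Da (Inr (Inl (a, b))) \<cdot> q (Dom ?J (Inr (Inl (a, b)))) = q (Cod ?J (Inr (Inl (a, b))))"
        "Da (Inr (Inr (a, b))) \<cdot> q (Dom ?J (Inr (Inr (a, b)))) = q (Cod ?J (Inr (Inr (a, b))))"
        by blast+
      thus ?thesis by (simp add: end_shape_def Da_def)
    qed
    thus ?thesis using natural_iff[OF _ _ _ t] t unfolding vnat_family_def by (simp add: B1_def)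
  qed
  have family_cone: "is_cone ?J V Do Da X (\<lambda>x. case x of Inl a \<Rightarrow> \<beta> a | Inr (a, b) \<Rightarrow> L a b \<cdot> \<beta> a)"
    if f: "vnat_family V A B F G X \<beta>" for X \<beta>
  proof -
    have t: "\<And>a. a \<in> VOb A \<Longrightarrow> \<beta> a \<in> hom V X (B1 a)" and [simp]: "X \<in> Obj V"
      using f unfolding vnat_family_def by (simp_all add: B1_def)
    have [simp]: "\<beta> a \<in> Arr V" "Dom V (\<beta> a) = X" "Cod V (\<beta> a) = B1 a" if "a \<in> VOb A" for a
      using t[OF that] by simp_all
    have "L a b \<cdot> \<beta> a = R a b \<cdot> \<beta> b" if "a \<in> VOb A" "b \<in> VOb A" for a b
      using natural_iff[OF that _ t] f that unfolding vnat_family_def by simp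
    thus ?thesis unfolding is_cone_def by (auto simp: end_shape_def Do_def Da_def)
  qed
  have "is_end V A B F G E (\<lambda>a. p (Inl a))" unfolding is_end_def
  proof (intro conjI allI impI)
    have cone: "is_cone ?J V Do Da E p" using lim by (simp add: is_limit_def)
    thus "vnat_family V A B F G E (\<lambda>a. p (Inl a))" by (rule cone_family)
    fix X \<beta> assume f: "vnat_family V A B F G X \<beta>"
    note ex = lim[unfolded is_limit_def, THEN conjunct2, rule_format, OF family_cone[OF f]]
    have p: "p (Inl a) \<in> hom V E (B1 a)" "p (Inr (a, b)) = L a b \<cdot> p (Inl a)"
      if ab: "a \<in> VOb A" "b \<in> VOb A" for a b
    proof -
      have "Inl a \<in> Obj ?J" "Inr (Inl (a, b)) \<in> Arr ?J" using ab by (auto simp: end_shape_def)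
      thus "p (Inl a) \<in> hom V E (B1 a)" "p (Inr (a, b)) = L a b \<cdot> p (Inl a)"
        using cone unfolding is_cone_def by (force simp: end_shape_def Do_def Da_def)+
    qed
    have "(\<forall>x \<in> Obj ?J. p x \<cdot> f = (case x of Inl a \<Rightarrow> \<beta> a | Inr (a, b) \<Rightarrow> L a b \<cdot> \<beta> a))
        \<longleftrightarrow> (\<forall>a\<in>VOb A. p (Inl a) \<cdot> f = \<beta> a)" if "f \<in> hom V X E" for f
      using that p by (auto simp: end_shape_def Plus_def)
    thus "\<exists>!f. f \<in> hom V X E \<and> (\<forall>a\<in>VOb A. p (Inl a) \<cdot> f = \<beta> a)"
      using ex by (simp only: cong: conj_cong)
  qed
  thus ?thesis by blast
qed

section \<open>Initial objects and discrete V-categories\<close>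

context sym_monoidal_closed begin

definition is_initial :: "'o \<Rightarrow> bool" where
  "is_initial Z \<longleftrightarrow> Z \<in> Obj V \<and> (\<forall>A \<in> Obj V. \<exists>!f. f \<in> hom V Z A)"

lemma initial_eq:
  assumes "is_initial Z" "f \<in> Arr V" "g \<in> Arr V" "Dom V f = Z" "Dom V g = Z" "Cod V f = Cod V g"
  shows "f = g"
proof -
  have "Cod V f \<in> Obj V" "f \<in> hom V Z (Cod V f)" "g \<in> hom V Z (Cod V f)" using assms by auto
  thus ?thesis using assms(1) unfolding is_initial_def by blast
qed

text \<open>
  By closedness an arrow \<open>Z \<odot> X \<rightarrow> D\<close> is an arrow \<open>Z \<rightarrow> ihom X D\<close>.
\<close>

lemma initial_tensor_right:
  assumes Z: "is_initial Z" and [simp]: "X \<in> Obj V"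
  shows "is_initial (Z \<odot> X)"
  unfolding is_initial_def
proof (intro conjI ballI)
  have [simp]: "Z \<in> Obj V" using Z by (simp add: is_initial_def)
  show "Z \<odot> X \<in> Obj V" by simp
  fix D assume [simp]: "D \<in> Obj V"
  obtain g where g: "g \<in> Arr V" "Dom V g = Z" "Cod V g = ihom V X D"
    using Z unfolding is_initial_def by (metis in_hom_iff obj_types(3) \<open>X \<in> Obj V\<close> \<open>D \<in> Obj V\<close>)
  show "\<exists>!f. f \<in> hom V (Z \<odot> X) D"
  proof (rule ex1I[of _ "ev V X D \<cdot> (g \<otimes> Idn V X)"])
    show "ev V X D \<cdot> (g \<otimes> Idn V X) \<in> hom V (Z \<odot> X) D" using g by simp
    fix f assume "f \<in> hom V (Z \<odot> X) D"
    hence f: "f \<in> Arr V" "Dom V f = Z \<odot> X" "Cod V f = D" by simp_all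
    have "curry V Z X D f = g" by (rule initial_eq[OF Z]) (use f g in \<open>simp_all add: curry\<close>)
    thus "f = ev V X D \<cdot> (g \<otimes> Idn V X)" using curry(4)[of Z X f D] f by simp
  qed
qed

lemma initial_tensor_left:
  assumes Z: "is_initial Z" and [simp]: "X \<in> Obj V"
  shows "is_initial (X \<odot> Z)"
  unfolding is_initial_def
proof (intro conjI ballI)
  have [simp]: "Z \<in> Obj V" using Z by (simp add: is_initial_def)
  note Z' = initial_tensor_right[OF Z, of X]
  show "X \<odot> Z \<in> Obj V" by simp
  fix D assume [simp]: "D \<in> Obj V"
  obtain g where g: "g \<in> Arr V" "Dom V g = Z \<odot> X" "Cod V g = D"
    using Z' unfolding is_initial_def by (metis in_hom_iff \<open>X \<in> Obj V\<close> \<open>D \<in> Obj V\<close>)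
  show "\<exists>!f. f \<in> hom V (X \<odot> Z) D"
  proof (rule ex1I[of _ "g \<cdot> sym V X Z"])
    show "g \<cdot> sym V X Z \<in> hom V (X \<odot> Z) D" using g by simp
    fix f assume "f \<in> hom V (X \<odot> Z) D"
    hence f: "f \<in> Arr V" "Dom V f = X \<odot> Z" "Cod V f = D" by simp_all
    have "f \<cdot> sym V Z X = g" by (rule initial_eq[OF Z']) (use f g in simp_all)
    thus "f = g \<cdot> sym V X Z" using f by auto
  qed
qed

end

text \<open>
  The hom objects of a discrete V-category use \<open>initial_obj\<close>, which is an initial object only if
  there is one.
\<close>

locale smc_initial = sym_monoidal_closed V for V :: "('o, 'm) smc" (structure) +
  assumes initial: "is_initial (initial_obj V)"
begin

abbreviation dhom :: "'a \<Rightarrow> 'a \<Rightarrow> 'o" where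
  "dhom a b \<equiv> (if a = b then \<one> else initial_obj V)"

lemma initial_obj_type [simp]: "initial_obj V \<in> Obj V"
  using initial by (simp add: is_initial_def)

lemma dhom_initial [simp]:
  "a \<noteq> b \<Longrightarrow> X \<in> Obj V \<Longrightarrow> is_initial (dhom a b \<odot> X)" "a \<noteq> b \<Longrightarrow> X \<in> Obj V \<Longrightarrow> is_initial (X \<odot> dhom a b)"
  using initial initial_tensor_left initial_tensor_right by simp_all

lemma dhom_type [simp]: "dhom a b \<in> Obj V" by simp

lemma discrete_domain_initial:
  assumes "\<not> (a = b \<and> b = c)"
  shows "is_initial (dhom b c \<odot> dhom a b)"
  using assms initial dhom_type[of b c] dhom_type[of a b]
    initial_tensor_left[of "dhom a b" "dhom b c"] initial_tensor_right[of "dhom b c" "dhom a b"]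
  by (cases "a = b") simp_all

lemma discrete_simps [simp]:
  "VOb (discrete_vcat V S) = S" "VHom (discrete_vcat V S) a b = dhom a b"
  "VId (discrete_vcat V S) a = Idn V \<one>" "VCmp (discrete_vcat V S) a a a = lunit V \<one>"
  by (simp_all add: discrete_vcat_def)

lemma initial_ex:
  assumes "is_initial Z" "A \<in> Obj V"
  shows "(THE f. f \<in> hom V Z A) \<in> hom V Z A"
  using assms theI'[of "\<lambda>f. f \<in> hom V Z A"] unfolding is_initial_def by blast

lemma discrete_VCmp_types:
  "VCmp (discrete_vcat V S) a b c \<in> hom V (dhom b c \<odot> dhom a b) (dhom a c)"
proof (cases "a = b \<and> b = c")
  case False
  thus ?thesis using discrete_domain_initial[OF False] initial_ex[of "dhom b c \<odot> dhom a b" "dhom a c"]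
    unfolding discrete_vcat_def Let_def by simp
qed simp

lemma vcategory_discrete: "vcategory V (discrete_vcat V S)"
proof -
  let ?D = "discrete_vcat V S"
  have t [simp]: "VCmp ?D a b c \<in> Arr V" "Dom V (VCmp ?D a b c) = dhom b c \<odot> dhom a b"
    "Cod V (VCmp ?D a b c) = dhom a c" for a b c
    using discrete_VCmp_types[of S a b c] by (simp_all del: if_split)
  show ?thesis
  proof
    fix a b c d :: 'a
    have *: "is_initial ((dhom c d \<odot> dhom b c) \<odot> dhom a b)" if "\<not> (a = b \<and> b = c \<and> c = d)"
    proof (cases "b = c \<and> c = d")
      case True
      thus ?thesis using that initial by (auto intro!: initial_tensor_left)
    next
      case False
      show ?thesis by (rule initial_tensor_right[OF discrete_domain_initial[OF False]]) (rule dhom_type)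
    qed
    show "VCmp ?D a b d \<cdot> (VCmp ?D b c d \<otimes> Idn V (VHom ?D a b)) =
       VCmp ?D a c d \<cdot> (Idn V (VHom ?D c d) \<otimes> VCmp ?D a b c) \<cdot> assoc V (VHom ?D c d) (VHom ?D b c) (VHom ?D a b)"
    proof (cases "a = b \<and> b = c \<and> c = d")
      case True
      thus ?thesis using triangle[of \<one> \<one>] by (simp add: lunit_munit)
    next
      case False
      show ?thesis by (rule initial_eq[OF *[OF False]]) (simp_all del: if_split)
    qed
  next
    fix a b
    show "VCmp ?D a b b \<cdot> (VId ?D b \<otimes> Idn V (VHom ?D a b)) = lunit V (VHom ?D a b)"
      by (cases "a = b", simp, rule initial_eq[OF dhom_initial(2)[of a b \<one>]]) (simp_all del: if_split)
    show "VCmp ?D a a b \<cdot> (Idn V (VHom ?D a b) \<otimes> VId ?D a) = runit V (VHom ?D a b)"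
      by (cases "a = b", simp add: lunit_munit, rule initial_eq[OF dhom_initial(1)[of a b \<one>]]) (simp_all del: if_split)
  qed (simp_all del: if_split)
qed

text \<open>
  By this equation a weight on a discrete V-category is a V-functor on that V-category itself.
\<close>

lemma op_discrete: "op_vcat V (discrete_vcat V S) = discrete_vcat V S"
proof -
  let ?D = "discrete_vcat V S"
  have t [simp]: "VCmp ?D a b c \<in> Arr V" "Dom V (VCmp ?D a b c) = dhom b c \<odot> dhom a b"
    "Cod V (VCmp ?D a b c) = dhom a c" for a b c
    using discrete_VCmp_types[of S a b c] by (simp_all del: if_split)
  have sym_dhom: "dhom b a = dhom a b" for a b :: 'c by simp
  have "VCmp ?D c b a \<cdot> sym V (VHom ?D c b) (VHom ?D b a) = VCmp ?D a b c" for a b c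
  proof (cases "a = b \<and> b = c")
    case True
    thus ?thesis by (simp add: lunit_sym lunit_munit[symmetric])
  next
    case False
    note i = discrete_domain_initial[OF False]
    show ?thesis
      by (rule initial_eq[OF i]) (simp_all del: if_split add: sym_dhom[of c b] sym_dhom[of b a] sym_dhom[of c a])
  qed
  thus ?thesis by (intro vcat.equality) (auto simp: op_vcat_def intro!: ext)
qed

text \<open>
  Over a discrete V-category the composition law has content only for three equal objects, since
  otherwise both sides are arrows out of an initial object.
\<close>

lemma vfunctor_discreteI:
  assumes B: "vcategory V B"
    and "\<And>a. a \<in> S \<Longrightarrow> FOb F a \<in> VOb B"
    and "\<And>a b. \<lbrakk>a \<in> S; b \<in> S\<rbrakk> \<Longrightarrow> FHom F a b \<in> hom V (dhom a b) (VHom B (FOb F a) (FOb F b))"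
    and "\<And>a. a \<in> S \<Longrightarrow> FHom F a a = VId B (FOb F a)"
    and "\<And>a. a \<notin> S \<Longrightarrow> FOb F a = undefined"
    and "\<And>a b. a \<notin> S \<or> b \<notin> S \<Longrightarrow> FHom F a b = undefined"
  shows "vfunctor V (discrete_vcat V S) B F"
proof -
  interpret B: vcategory V B by fact
  interpret D: vcategory V "discrete_vcat V S" by (rule vcategory_discrete)
  have t: "FHom F a b \<in> Arr V" "Dom V (FHom F a b) = dhom a b" "Cod V (FHom F a b) = VHom B (FOb F a) (FOb F b)"
    if "a \<in> S" "b \<in> S" for a b using assms(3)[OF that] by (simp_all del: if_split)
  have c: "VCmp (discrete_vcat V S) a b c \<in> Arr V" "Dom V (VCmp (discrete_vcat V S) a b c) = dhom b c \<odot> dhom a b"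
    "Cod V (VCmp (discrete_vcat V S) a b c) = dhom a c" for a b c
    using discrete_VCmp_types[of S a b c] by (simp_all del: if_split)
  show ?thesis
  proof
    fix a b c assume "a \<in> VOb (discrete_vcat V S)" "b \<in> VOb (discrete_vcat V S)" "c \<in> VOb (discrete_vcat V S)"
    hence s [simp]: "a \<in> S" "b \<in> S" "c \<in> S" by simp_all
    show "FHom F a c \<cdot> VCmp (discrete_vcat V S) a b c
        = VCmp B (FOb F a) (FOb F b) (FOb F c) \<cdot> (FHom F b c \<otimes> FHom F a b)"
    proof (cases "a = b \<and> b = c")
      case True
      thus ?thesis by (simp add: assms(2,4) lunit_munit)
    next
      case False
      note i = discrete_domain_initial[OF False]
      show ?thesis by (rule initial_eq[OF i]) (simp_all add: t c assms(2) del: if_split)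
    qed
  qed (use assms in \<open>simp_all del: if_split\<close>)
qed

definition discrete_vfun :: "'a set \<Rightarrow> ('b, 'o, 'm) vcat \<Rightarrow> ('a \<Rightarrow> 'b) \<Rightarrow> ('a, 'b, 'm) vfun" where
  "discrete_vfun S B fo = mk_vfun (discrete_vcat V S) fo
     (\<lambda>a b. if a = b then VId B (fo a) else (THE f. f \<in> hom V (initial_obj V) (VHom B (fo a) (fo b))))"

lemma discrete_vfun_ob [simp]: "a \<in> S \<Longrightarrow> FOb (discrete_vfun S B fo) a = fo a"
  by (simp add: discrete_vfun_def)

lemma vfunctor_discrete_vfun:
  assumes B: "vcategory V B" and "\<And>a. a \<in> S \<Longrightarrow> fo a \<in> VOb B"
  shows "vfunctor V (discrete_vcat V S) B (discrete_vfun S B fo)"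
proof -
  interpret B: vcategory V B by fact
  have *: "a \<in> S \<Longrightarrow> b \<in> S \<Longrightarrow> (THE f. f \<in> hom V (initial_obj V) (VHom B (fo a) (fo b)))
     \<in> hom V (initial_obj V) (VHom B (fo a) (fo b))" for a b
    by (rule initial_ex[OF initial]) (simp add: assms(2))
  show ?thesis
    by (rule vfunctor_discreteI[OF B]) (use assms * in \<open>auto simp: discrete_vfun_def simp del: in_hom_iff intro: B.VId_in\<close>)
qed

lemma discrete_FHom:
  assumes "vfunctor V (discrete_vcat V S) B F" "a \<in> S"
  shows "FHom F a a = VId B (FOb F a)"
proof -
  interpret F: vfunctor V "discrete_vcat V S" B F by fact
  show ?thesis using F.FHom_VId[of a] F.FHom_types[of a a] assms(2) by simp
qed

lemma discrete_vfun_eqI: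
  assumes F: "vfunctor V (discrete_vcat V S) B F" and G: "vfunctor V (discrete_vcat V S) B G"
    and e: "\<And>a. a \<in> S \<Longrightarrow> FOb F a = FOb G a"
  shows "F = G"
proof (rule vfun_eqI[OF F G])
  interpret F: vfunctor V "discrete_vcat V S" B F by fact
  interpret G: vfunctor V "discrete_vcat V S" B G by fact
  fix a b assume "a \<in> VOb (discrete_vcat V S)" "b \<in> VOb (discrete_vcat V S)"
  thus "FHom F a b = FHom G a b"
    using discrete_FHom[OF F] discrete_FHom[OF G] e initial_eq[OF initial, of "FHom F a b" "FHom G a b"]
    by (cases "a = b") simp_all
qed (use e in simp)

text \<open>
  For distinct objects both sides of the naturality condition are arrows out of an initial object;
  for equal objects the condition compares composites with identities.
\<close>

lemma discrete_family:
  assumes F: "vfunctor V (discrete_vcat V S) B F" and G: "vfunctor V (discrete_vcat V S) B G"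
  shows "vnat_family V (discrete_vcat V S) B F G X \<beta> \<longleftrightarrow>
    X \<in> Obj V \<and> (\<forall>a \<in> S. \<beta> a \<in> hom V X (VHom B (FOb F a) (FOb G a)))"
proof -
  interpret F: vfunctor V "discrete_vcat V S" B F by fact
  interpret G: vfunctor V "discrete_vcat V S" B G by fact
  have "VCmp B (FOb F a) (FOb G a) (FOb G b) \<cdot> (FHom G a b \<otimes> \<beta> a)
        = VCmp B (FOb F a) (FOb F b) (FOb G b) \<cdot> ((\<beta> b \<otimes> FHom F a b) \<cdot> sym V (dhom a b) X)"
    if [simp]: "X \<in> Obj V" and t: "\<And>a. a \<in> S \<Longrightarrow> \<beta> a \<in> hom V X (VHom B (FOb F a) (FOb G a))"
      and s [simp]: "a \<in> S" "b \<in> S" for a b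
  proof -
    have [simp]: "FOb F a \<in> VOb B" "FOb G a \<in> VOb B" if "a \<in> S" for a
      using F.FOb_type[of a] G.FOb_type[of a] that by simp_all
    have [simp]: "\<beta> a \<in> Arr V" "Dom V (\<beta> a) = X" "Cod V (\<beta> a) = VHom B (FOb F a) (FOb G a)" if "a \<in> S" for a
      using t[OF that] by simp_all
    have FG: "FHom F a b \<in> Arr V" "Dom V (FHom F a b) = dhom a b" "Cod V (FHom F a b) = VHom B (FOb F a) (FOb F b)"
      "FHom G a b \<in> Arr V" "Dom V (FHom G a b) = dhom a b" "Cod V (FHom G a b) = VHom B (FOb G a) (FOb G b)"
      using F.FHom_types[of a b] G.FHom_types[of a b] by (simp_all del: if_split)
    show ?thesis
    proof (cases "a = b")
      case True
      thus ?thesis using discrete_FHom[OF F, of b] discrete_FHom[OF G, of b] by (simp add: runit_sym)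
    next
      case False
      show ?thesis
        by (rule initial_eq[OF dhom_initial(1)[OF False, of X]]) (simp_all add: FG del: if_split)
    qed
  qed
  thus ?thesis unfolding vnat_family_def discrete_simps by (auto simp del: in_hom_iff)
qed

end

text \<open>
  An initial object is a limit of the empty diagram in the opposite category.
\<close>

lemma (in sym_monoidal_closed) smc_initialI:
  assumes U: "size_universe (U :: 'u set)" and c: "cocomplete_cat U V"
  shows "smc_initial V"
proof -
  let ?J = "\<lparr>Obj = {}, Arr = {}, Dom = \<lambda>_. undefined, Cod = \<lambda>_. undefined, Idn = \<lambda>_. undefined,
    Cmp = \<lambda>_ _. undefined\<rparr> :: ('u, 'u) cat"
  have "category ?J" by unfold_locales (auto simp: hom_def)
  moreover have "is_functor ?J (op_cat V) (\<lambda>_. undefined) (\<lambda>_. undefined)"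
    by (simp add: is_functor_def)
  ultimately obtain X p where lim: "is_limit ?J (op_cat V) (\<lambda>_. undefined) (\<lambda>_. undefined) X p"
    using c small_finite[OF U] unfolding cocomplete_cat_def complete_cat_def by fastforce
  have "is_initial X"
    using lim unfolding is_limit_def is_cone_def is_initial_def by (simp add: op_cat_def hom_def conj_commute)
  hence "is_initial (initial_obj V)"
    using someI[of is_initial X] unfolding initial_obj_def is_initial_def by simp
  thus ?thesis by unfold_locales
qed

section \<open>The V-category V\<close>

context sym_monoidal_closed begin

lemma self_simps [simp]: "VOb (self_vcat V) = Obj V" "VHom (self_vcat V) X Y = ihom V X Y"
  by (simp_all add: self_vcat_def)

lemma self_VId [simp]:
  assumes [simp]: "X \<in> Obj V"
  shows "VId (self_vcat V) X \<in> Arr V" "Dom V (VId (self_vcat V) X) = \<one>"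
    "Cod V (VId (self_vcat V) X) = ihom V X X"
    "\<lbrakk>x \<in> Arr V; Cod V x = X\<rbrakk> \<Longrightarrow> ev V X X \<cdot> (VId (self_vcat V) X \<otimes> x) = x \<cdot> lunit V (Dom V x)"
  by (simp_all add: self_vcat_def curry ev_curry lunit_nat)

lemma self_VCmp [simp]:
  assumes [simp]: "X \<in> Obj V" "Y \<in> Obj V" "Z \<in> Obj V"
  shows "VCmp (self_vcat V) X Y Z \<in> Arr V"
    "Dom V (VCmp (self_vcat V) X Y Z) = ihom V Y Z \<odot> ihom V X Y"
    "Cod V (VCmp (self_vcat V) X Y Z) = ihom V X Z"
  by (simp_all add: self_vcat_def curry)

text \<open>
  Evaluating a composite is evaluating twice.  Together with \<open>ev_eqI\<close> this turns the axioms for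
  \<open>self_vcat\<close> into coherence statements.
\<close>

lemma ev_self_VCmp:
  assumes [simp]: "X \<in> Obj V" "Y \<in> Obj V" "Z \<in> Obj V" "g \<in> Arr V" "Cod V g = ihom V Y Z"
    "f \<in> Arr V" "Cod V f = ihom V X Y" "x \<in> Arr V" "Cod V x = X"
  shows "ev V X Z \<cdot> ((VCmp (self_vcat V) X Y Z \<cdot> (g \<otimes> f)) \<otimes> x)
    = ev V Y Z \<cdot> ((g \<otimes> (ev V X Y \<cdot> (f \<otimes> x))) \<cdot> assoc V (Dom V g) (Dom V f) (Dom V x))"
  by (simp add: self_vcat_def curry ev_curry assoc_nat)

lemma ev_self_VCmp_tail:
  assumes [simp]: "X \<in> Obj V" "Y \<in> Obj V" "Z \<in> Obj V" "g \<in> Arr V" "Cod V g = ihom V Y Z"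
    "f \<in> Arr V" "Cod V f = ihom V X Y" "x \<in> Arr V" "Cod V x = X"
    "y \<in> Arr V" "Cod V y = (Dom V g \<odot> Dom V f) \<odot> Dom V x"
  shows "ev V X Z \<cdot> (((VCmp (self_vcat V) X Y Z \<cdot> (g \<otimes> f)) \<otimes> x) \<cdot> y)
    = ev V Y Z \<cdot> ((g \<otimes> (ev V X Y \<cdot> (f \<otimes> x))) \<cdot> (assoc V (Dom V g) (Dom V f) (Dom V x) \<cdot> y))"
  using comp_tail[OF ev_self_VCmp[OF assms(1-9)], of y] by simp

text \<open>
  After evaluation the unit laws become \<open>lunit_tensor\<close> and the triangle, and associativity becomes
  the pentagon.
\<close>

lemma vcategory_self: "vcategory V (self_vcat V)"
proof
  let ?S = "self_vcat V"
  fix X Y assume "X \<in> VOb ?S" "Y \<in> VOb ?S"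
  hence [simp]: "X \<in> Obj V" "Y \<in> Obj V" by simp_all
  show "VCmp ?S X Y Y \<cdot> (VId ?S Y \<otimes> Idn V (VHom ?S X Y)) = lunit V (VHom ?S X Y)"
  proof (rule ev_eqI[of X Y])
    show "ev V X Y \<cdot> ((VCmp ?S X Y Y \<cdot> (VId ?S Y \<otimes> Idn V (VHom ?S X Y))) \<otimes> Idn V X)
      = ev V X Y \<cdot> (lunit V (VHom ?S X Y) \<otimes> Idn V X)"
      using comp_tail[OF self_VId(4)[of Y "ev V X Y"], of "assoc V \<one> (ihom V X Y) X"]
      by (simp add: ev_self_VCmp lunit_tensor)
  qed simp_all
  show "VCmp ?S X X Y \<cdot> (Idn V (VHom ?S X Y) \<otimes> VId ?S X) = runit V (VHom ?S X Y)"
  proof (rule ev_eqI[of X Y])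
    show "ev V X Y \<cdot> ((VCmp ?S X X Y \<cdot> (Idn V (VHom ?S X Y) \<otimes> VId ?S X)) \<otimes> Idn V X)
      = ev V X Y \<cdot> (runit V (VHom ?S X Y) \<otimes> Idn V X)"
      by (simp add: ev_self_VCmp triangle)
  qed simp_all
next
  let ?S = "self_vcat V"
  fix W X Y Z assume "W \<in> VOb ?S" "X \<in> VOb ?S" "Y \<in> VOb ?S" "Z \<in> VOb ?S"
  hence [simp]: "W \<in> Obj V" "X \<in> Obj V" "Y \<in> Obj V" "Z \<in> Obj V" by simp_all
  let ?F = "ihom V W X" let ?G = "ihom V X Y" let ?H = "ihom V Y Z"
  let ?e = "ev V Y Z \<cdot> (Idn V ?H \<otimes> (ev V X Y \<cdot> (Idn V ?G \<otimes> ev V W X)))"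
  have "VCmp ?S W X Z \<cdot> (VCmp ?S X Y Z \<otimes> Idn V ?F) =
     VCmp ?S W Y Z \<cdot> ((Idn V ?H \<otimes> VCmp ?S W X Y) \<cdot> assoc V ?H ?G ?F)" (is "?l = ?r")
  proof (rule ev_eqI[of W Z])
    have "ev V W Z \<cdot> (?l \<otimes> Idn V W)
      = ev V X Z \<cdot> ((VCmp ?S X Y Z \<otimes> ev V W X) \<cdot> assoc V (?H \<odot> ?G) ?F W)"
      by (simp add: ev_self_VCmp)
    also have "\<dots> = ?e \<cdot> (assoc V ?H ?G (?F \<odot> W) \<cdot> assoc V (?H \<odot> ?G) ?F W)"
      using ev_self_VCmp_tail[of X Y Z "Idn V ?H" "Idn V ?G" "ev V W X" "assoc V (?H \<odot> ?G) ?F W"] by simp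
    also have "\<dots> = ?e \<cdot> ((Idn V ?H \<otimes> assoc V ?G ?F W) \<cdot> (assoc V ?H (?G \<odot> ?F) W \<cdot> (assoc V ?H ?G ?F \<otimes> Idn V W)))"
      by (simp add: pentagon)
    also have "\<dots> = ev V Y Z \<cdot> ((Idn V ?H \<otimes> (ev V W Y \<cdot> (VCmp ?S W X Y \<otimes> Idn V W)))
        \<cdot> (assoc V ?H (?G \<odot> ?F) W \<cdot> (assoc V ?H ?G ?F \<otimes> Idn V W)))"
      using ev_self_VCmp[of W X Y "Idn V ?G" "Idn V ?F" "Idn V W"] by simp
    also have "\<dots> = ev V W Z \<cdot> (((VCmp ?S W Y Z \<cdot> (Idn V ?H \<otimes> VCmp ?S W X Y)) \<otimes> Idn V W) \<cdot> (assoc V ?H ?G ?F \<otimes> Idn V W))"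
      by (subst ev_self_VCmp_tail) simp_all
    also have "\<dots> = ev V W Z \<cdot> (?r \<otimes> Idn V W)" by simp
    finally show "ev V W Z \<cdot> (?l \<otimes> Idn V W) = ev V W Z \<cdot> (?r \<otimes> Idn V W)" .
  qed simp_all
  thus "VCmp ?S W X Z \<cdot> (VCmp ?S X Y Z \<otimes> Idn V (VHom ?S W X)) =
     VCmp ?S W Y Z \<cdot> (Idn V (VHom ?S Y Z) \<otimes> VCmp ?S W X Y) \<cdot> assoc V (VHom ?S Y Z) (VHom ?S X Y) (VHom ?S W X)"
    by simp
qed simp_all

definition named_arr :: "'o \<Rightarrow> 'o \<Rightarrow> 'm \<Rightarrow> 'm" where
  "named_arr A B e = ev V A B \<cdot> ((e \<otimes> Idn V A) \<cdot> linv A)"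

lemma named_arr_types [simp]:
  assumes "A \<in> Obj V" "B \<in> Obj V" "e \<in> Arr V" "Dom V e = \<one>" "Cod V e = ihom V A B"
  shows "named_arr A B e \<in> Arr V" "Dom V (named_arr A B e) = A" "Cod V (named_arr A B e) = B"
  using assms by (simp_all add: named_arr_def)

lemma ev_named:
  assumes [simp]: "A \<in> Obj V" "B \<in> Obj V" "e \<in> Arr V" "Dom V e = \<one>" "Cod V e = ihom V A B"
  shows "ev V A B \<cdot> (e \<otimes> Idn V A) = named_arr A B e \<cdot> lunit V A"
  by (simp add: named_arr_def)

lemma arr_name:
  assumes [simp]: "f \<in> Arr V" "Dom V f = A" "Cod V f = B"
  shows "arr_name V A B f \<in> Arr V" "Dom V (arr_name V A B f) = \<one>" "Cod V (arr_name V A B f) = ihom V A B"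
    "named_arr A B (arr_name V A B f) = f"
proof -
  have [simp]: "A \<in> Obj V" "B \<in> Obj V" using Dom_Cod_in[OF assms(1)] by simp_all
  show "arr_name V A B f \<in> Arr V" "Dom V (arr_name V A B f) = \<one>" "Cod V (arr_name V A B f) = ihom V A B"
    by (simp_all add: arr_name_def curry)
  show "named_arr A B (arr_name V A B f) = f"
    unfolding named_arr_def arr_name_def
    using comp_tail[OF curry(4)[of \<one> A "f \<cdot> lunit V A" B], of "linv A"] by (simp add: curry)
qed

end

section \<open>Colimits weighted over a discrete V-category\<close>

context smc_initial begin

lemma hom_into_along_discrete:
  assumes D: "vfunctor V (discrete_vcat V S) L D" and x: "x \<in> VOb L"
  shows "vfunctor V (discrete_vcat V S) (self_vcat V) (hom_into_along V (discrete_vcat V S) L D x)"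
    and "k \<in> S \<Longrightarrow> FOb (hom_into_along V (discrete_vcat V S) L D x) k = VHom L (FOb D k) x"
proof -
  interpret D: vfunctor V "discrete_vcat V S" L D by fact
  note [simp] = x D.FOb_type[simplified] D.FHom_types[simplified]
  let ?K = "discrete_vcat V S"
  let ?h = "hom_into_along V ?K L D x"
  have h: "?h = vfun_comp V ?K (hom_into V L x) (op_vfun D)"
    by (simp add: hom_into_along_def op_discrete)
  have hi: "FOb (hom_into V L x) y = VHom L y x" if "y \<in> VOb L" for y
    using that by (simp add: hom_into_def)
  have hi': "FHom (hom_into V L x) y z = curry V (VHom L z y) (VHom L y x) (VHom L z x)
        (VCmp L z y x \<cdot> sym V (VHom L z y) (VHom L y x))" if "y \<in> VOb L" "z \<in> VOb L" for y z
    using that by (simp_all add: hom_into_def)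
  have ob: "FOb ?h k = VHom L (FOb D k) x" if "k \<in> S" for k
    using that by (simp add: h op_vfun_def hi)
  thus "k \<in> S \<Longrightarrow> FOb ?h k = VHom L (FOb D k) x" .
  have FD: "FHom D b a \<in> Arr V" "Dom V (FHom D b a) = dhom a b" "Cod V (FHom D b a) = VHom L (FOb D b) (FOb D a)"
    if "a \<in> S" "b \<in> S" for a b using D.FHom_types[of b a] that by (auto simp del: D.FHom_types)
  have hh: "FHom ?h a b = curry V (VHom L (FOb D b) (FOb D a)) (VHom L (FOb D a) x) (VHom L (FOb D b) x)
        (VCmp L (FOb D b) (FOb D a) x \<cdot> sym V (VHom L (FOb D b) (FOb D a)) (VHom L (FOb D a) x)) \<cdot> FHom D b a"
    if "a \<in> S" "b \<in> S" for a b
    using that by (simp add: h op_vfun_def hi')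
  show "vfunctor V ?K (self_vcat V) ?h"
  proof (rule vfunctor_discreteI[OF vcategory_self])
    fix a assume [simp]: "a \<in> S"
    let ?X = "VHom L (FOb D a) x"
    have hx: "VHom L (FOb D a) x \<in> Obj V" by simp
    have Da: "FHom D a a = VId L (FOb D a)" by (rule discrete_FHom[OF D]) simp
    show "FHom ?h a a = VId (self_vcat V) (FOb ?h a)"
    proof (rule ev_eqI[of ?X ?X])
      have "ev V ?X ?X \<cdot> (FHom ?h a a \<otimes> Idn V ?X) = lunit V ?X"
        by (simp add: hh Da ev_curry sym_nat runit_sym)
      also have "\<dots> = ev V ?X ?X \<cdot> (VId (self_vcat V) (FOb ?h a) \<otimes> Idn V ?X)"
        by (simp add: ob)
      finally show "ev V ?X ?X \<cdot> (FHom ?h a a \<otimes> Idn V ?X)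
        = ev V ?X ?X \<cdot> (VId (self_vcat V) (FOb ?h a) \<otimes> Idn V ?X)" .
    qed (simp_all add: hh Da curry ob)
  next
    fix a b assume [simp]: "a \<in> S" "b \<in> S"
    show "FHom ?h a b \<in> hom V (dhom a b) (VHom (self_vcat V) (FOb ?h a) (FOb ?h b))"
      using FD[of a b] by (simp add: hh curry ob del: if_split)
  qed (simp_all add: ob, auto simp: h vfun_comp_def)
qed

text \<open>
  The universal property of the coproduct \<open>c\<close> of the copowers \<open>W k \<odot> D k\<close>, with \<open>n\<close> the family of
  coprojections.  It is stated with a parameter object \<open>Z\<close> and so determines the hom objects of \<open>L\<close> out
  of \<open>c\<close>, not only their global elements.
\<close>

definition copower_colimit :: "('l, 'o, 'm) vcat \<Rightarrow> 'k set \<Rightarrow> ('k \<Rightarrow> 'o) \<Rightarrow> ('k \<Rightarrow> 'l) \<Rightarrow> 'l \<Rightarrow> ('k \<Rightarrow> 'm) \<Rightarrow> bool" where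
  "copower_colimit L S W D c n \<longleftrightarrow> c \<in> VOb L \<and> (\<forall>k\<in>S. n k \<in> hom V (W k) (VHom L (D k) c)) \<and>
     (\<forall>x \<in> VOb L. \<forall>Z \<in> Obj V. \<forall>g. (\<forall>k\<in>S. g k \<in> hom V (Z \<odot> W k) (VHom L (D k) x)) \<longrightarrow>
        (\<exists>!f. f \<in> hom V Z (VHom L c x) \<and> (\<forall>k\<in>S. VCmp L (D k) c x \<cdot> (f \<otimes> n k) = g k)))"

lemma copower_colimit_cong:
  assumes "copower_colimit L S W D c n" "\<And>k. k \<in> S \<Longrightarrow> W k = W' k" "\<And>k. k \<in> S \<Longrightarrow> n k = n' k"
  shows "copower_colimit L S W' D c n'"
  using assms unfolding copower_colimit_def by simp

lemma copower_colimit_univ: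
  assumes "copower_colimit L S W D c n" "x \<in> VOb L" "Z \<in> Obj V"
    "\<And>k. k \<in> S \<Longrightarrow> g k \<in> hom V (Z \<odot> W k) (VHom L (D k) x)"
  shows "\<exists>!f. f \<in> hom V Z (VHom L c x) \<and> (\<forall>k\<in>S. VCmp L (D k) c x \<cdot> (f \<otimes> n k) = g k)"
  using assms(1)[unfolded copower_colimit_def, THEN conjunct2, THEN conjunct2, rule_format, OF assms(2,3), of g]
    assms(4) by blast

lemma copower_colimit_eqI:
  assumes c: "copower_colimit L S W D c n" and L: "vcategory V L" and x: "x \<in> VOb L"
    and D: "\<And>k. k \<in> S \<Longrightarrow> D k \<in> VOb L"
    and fg: "f \<in> Arr V" "g \<in> Arr V" "Dom V f = Dom V g" "Cod V f = VHom L c x" "Cod V g = VHom L c x"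
    and e: "\<And>k. k \<in> S \<Longrightarrow> VCmp L (D k) c x \<cdot> (f \<otimes> n k) = VCmp L (D k) c x \<cdot> (g \<otimes> n k)"
  shows "f = g"
proof -
  interpret L: vcategory V L by fact
  have n: "c \<in> VOb L" "\<And>k. k \<in> S \<Longrightarrow> n k \<in> hom V (W k) (VHom L (D k) c)"
    using c by (simp_all add: copower_colimit_def)
  have "\<exists>!h. h \<in> hom V (Dom V f) (VHom L c x) \<and>
     (\<forall>k\<in>S. VCmp L (D k) c x \<cdot> (h \<otimes> n k) = VCmp L (D k) c x \<cdot> (f \<otimes> n k))"
    by (rule copower_colimit_univ[OF c x]) (use n fg D x in simp_all)
  moreover have "f \<in> hom V (Dom V f) (VHom L c x)" "g \<in> hom V (Dom V f) (VHom L c x)"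
    using fg by simp_all
  ultimately show ?thesis using e by metis
qed

text \<open>
  A family over a discrete V-category is V-natural as soon as it is well typed, so the end in
  \<open>is_wcolim\<close> is a product; its projections, evaluated, are composition with the arrows named by
  \<open>\<nu>\<close> (the fact \<open>ev_p\<close> below).
\<close>

lemma is_wcolim_discrete_iff:
  assumes W: "vfunctor V (discrete_vcat V S) (self_vcat V) W" and D: "vfunctor V (discrete_vcat V S) L D"
  shows "is_wcolim V (discrete_vcat V S) L W D c \<nu> \<longleftrightarrow>
    (c \<in> VOb L \<longrightarrow> (\<forall>k\<in>S. \<nu> k \<in> hom V \<one> (ihom V (FOb W k) (VHom L (FOb D k) c)))) \<and>
    copower_colimit L S (FOb W) (FOb D) c (\<lambda>k. named_arr (FOb W k) (VHom L (FOb D k) c) (\<nu> k))"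
    (is "_ \<longleftrightarrow> (_ \<longrightarrow> ?T) \<and> _")
proof (cases "c \<in> VOb L \<and> ?T")
  let ?K = "discrete_vcat V S"
  let ?S = "self_vcat V"
  interpret W: vfunctor V ?K ?S W by fact
  interpret D: vfunctor V ?K L D by fact
  have [simp]: "k \<in> S \<Longrightarrow> FOb W k \<in> Obj V" "k \<in> S \<Longrightarrow> FOb D k \<in> VOb L" for k
    using W.FOb_type[of k] D.FOb_type[of k] by simp_all
  note hi = hom_into_along_discrete[OF D]
  case True
  hence [simp]: "c \<in> VOb L" and \<nu> [simp]: "\<And>k. k \<in> S \<Longrightarrow> \<nu> k \<in> Arr V" "\<And>k. k \<in> S \<Longrightarrow> Dom V (\<nu> k) = \<one>"
    "\<And>k. k \<in> S \<Longrightarrow> Cod V (\<nu> k) = ihom V (FOb W k) (VHom L (FOb D k) c)" by simp_all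
  let ?n = "\<lambda>k. named_arr (FOb W k) (VHom L (FOb D k) c) (\<nu> k)"
  have nat: "vnat V ?K ?S W (hom_into_along V ?K L D c) \<nu>"
    unfolding vnat_iff_vnat_family[OF W hi(1)[OF \<open>c \<in> VOb L\<close>]] discrete_family[OF W hi(1)[OF \<open>c \<in> VOb L\<close>]]
    by (simp add: hi)
  define p where "p x k = vpre V ?S (FOb W k) (VHom L (FOb D k) c) (VHom L (FOb D k) x) (\<nu> k)
           \<cdot> FHom (hom_from V L (FOb D k)) c x" for x k
  have hf: "FHom (hom_from V L (FOb D k)) c x
      = curry V (VHom L c x) (VHom L (FOb D k) c) (VHom L (FOb D k) x) (VCmp L (FOb D k) c x)"
    if "x \<in> VOb L" for x k using that by (simp add: hom_from_def)
  have p [simp]: "p x k \<in> Arr V" "Dom V (p x k) = VHom L c x"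
      "Cod V (p x k) = ihom V (FOb W k) (VHom L (FOb D k) x)" if "x \<in> VOb L" "k \<in> S" for x k
    using that by (simp_all add: p_def hf curry W.B.vpre_types)
  have ev_p: "ev V (FOb W k) (VHom L (FOb D k) x) \<cdot> ((p x k \<cdot> f) \<otimes> Idn V (FOb W k))
      = VCmp L (FOb D k) c x \<cdot> (f \<otimes> ?n k)"
    if [simp]: "x \<in> VOb L" "k \<in> S" "f \<in> Arr V" "Cod V f = VHom L c x" for x k f
  proof -
    let ?W = "FOb W k" let ?c = "VHom L (FOb D k) c" let ?x = "VHom L (FOb D k) x"
    let ?h = "curry V (VHom L c x) ?c ?x (VCmp L (FOb D k) c x) \<cdot> f"
    have h: "?h \<in> Arr V" "Dom V ?h = Dom V f" "Cod V ?h = ihom V ?c ?x" by (simp_all add: curry)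
    have "p x k \<cdot> f = VCmp ?S ?W ?c ?x \<cdot> ((?h \<otimes> \<nu> k) \<cdot> rinv (Dom V f))"
      using W.B.vpre_el[of ?W ?c ?x "\<nu> k" ?h] by (simp add: p_def hf h curry)
    hence "ev V ?W ?x \<cdot> ((p x k \<cdot> f) \<otimes> Idn V ?W)
      = ev V ?W ?x \<cdot> (((VCmp ?S ?W ?c ?x \<cdot> (?h \<otimes> \<nu> k)) \<otimes> Idn V ?W) \<cdot> (rinv (Dom V f) \<otimes> Idn V ?W))"
      using h by simp
    also have "\<dots> = ev V ?c ?x \<cdot> ((?h \<otimes> (ev V ?W ?c \<cdot> (\<nu> k \<otimes> Idn V ?W)))
        \<cdot> (assoc V (Dom V f) \<one> ?W \<cdot> (rinv (Dom V f) \<otimes> Idn V ?W)))"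
      using h by (subst ev_self_VCmp_tail) simp_all
    also have "\<dots> = ev V ?c ?x \<cdot> (?h \<otimes> ?n k)"
      using h by (simp add: triangle_inv ev_named)
    also have "\<dots> = VCmp L (FOb D k) c x \<cdot> (f \<otimes> ?n k)" by (simp add: ev_curry)
    finally show ?thesis .
  qed
  have bij: "p x k \<cdot> f = \<beta> \<longleftrightarrow> VCmp L (FOb D k) c x \<cdot> (f \<otimes> ?n k)
       = ev V (FOb W k) (VHom L (FOb D k) x) \<cdot> (\<beta> \<otimes> Idn V (FOb W k))"
    if "x \<in> VOb L" "k \<in> S" "f \<in> hom V Z (VHom L c x)" "\<beta> \<in> hom V Z (ihom V (FOb W k) (VHom L (FOb D k) x))"
    for x k f \<beta> Z
  proof
    show "p x k \<cdot> f = \<beta>" if "VCmp L (FOb D k) c x \<cdot> (f \<otimes> ?n k)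
       = ev V (FOb W k) (VHom L (FOb D k) x) \<cdot> (\<beta> \<otimes> Idn V (FOb W k))"
      by (rule ev_eqI[of "FOb W k" "VHom L (FOb D k) x"])
         (use that \<open>x \<in> VOb L\<close> \<open>k \<in> S\<close> \<open>f \<in> _\<close> \<open>\<beta> \<in> _\<close> in \<open>simp_all add: ev_p\<close>)
  qed (use ev_p[of x k f] that in auto)
  have "is_end V ?K ?S W (hom_into_along V ?K L D x) (VHom L c x) (p x) \<longleftrightarrow>
     (\<forall>Z \<in> Obj V. \<forall>g. (\<forall>k\<in>S. g k \<in> hom V (Z \<odot> FOb W k) (VHom L (FOb D k) x)) \<longrightarrow>
        (\<exists>!f. f \<in> hom V Z (VHom L c x) \<and> (\<forall>k\<in>S. VCmp L (FOb D k) c x \<cdot> (f \<otimes> ?n k) = g k)))"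
    (is "?E \<longleftrightarrow> ?U") if x [simp]: "x \<in> VOb L" for x
  proof -
    have fam: "vnat_family V ?K ?S W (hom_into_along V ?K L D x) Z \<beta> \<longleftrightarrow>
      Z \<in> Obj V \<and> (\<forall>k\<in>S. \<beta> k \<in> hom V Z (ihom V (FOb W k) (VHom L (FOb D k) x)))" for Z \<beta>
      unfolding discrete_family[OF W hi(1)[OF x]] by (simp add: hi)
    have pf: "vnat_family V ?K ?S W (hom_into_along V ?K L D x) (VHom L c x) (p x)"
      unfolding fam by simp
    show ?thesis
    proof
      assume ?E
      show ?U
      proof (intro ballI allI impI)
        fix Z g assume [simp]: "Z \<in> Obj V" and g: "\<forall>k\<in>S. g k \<in> hom V (Z \<odot> FOb W k) (VHom L (FOb D k) x)"
        define \<beta> where "\<beta> k = curry V Z (FOb W k) (VHom L (FOb D k) x) (g k)" for k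
        have \<beta>: "\<beta> k \<in> hom V Z (ihom V (FOb W k) (VHom L (FOb D k) x))"
          "ev V (FOb W k) (VHom L (FOb D k) x) \<cdot> (\<beta> k \<otimes> Idn V (FOb W k)) = g k" if "k \<in> S" for k
          using that g by (simp_all add: \<beta>_def curry)
        have "\<exists>!f. f \<in> hom V Z (VHom L c x) \<and> (\<forall>k\<in>S. p x k \<cdot> f = \<beta> k)"
          using \<open>?E\<close> \<beta> fam[of Z \<beta>] unfolding is_end_def by (simp del: in_hom_iff)
        moreover have "(\<forall>k\<in>S. p x k \<cdot> f = \<beta> k) \<longleftrightarrow> (\<forall>k\<in>S. VCmp L (FOb D k) c x \<cdot> (f \<otimes> ?n k) = g k)"
          if "f \<in> hom V Z (VHom L c x)" for f
          using bij[OF x _ that \<beta>(1)] \<beta>(2) by simp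
        ultimately show "\<exists>!f. f \<in> hom V Z (VHom L c x) \<and> (\<forall>k\<in>S. VCmp L (FOb D k) c x \<cdot> (f \<otimes> ?n k) = g k)"
          by (simp only: cong: conj_cong)
      qed
    next
      assume ?U
      show ?E unfolding is_end_def
      proof (intro conjI allI impI pf)
        fix Z \<beta> assume "vnat_family V ?K ?S W (hom_into_along V ?K L D x) Z \<beta>"
        hence Z [simp]: "Z \<in> Obj V" and \<beta>: "\<And>k. k \<in> S \<Longrightarrow> \<beta> k \<in> hom V Z (ihom V (FOb W k) (VHom L (FOb D k) x))"
          unfolding fam by (simp_all del: in_hom_iff)
        define g where "g k = ev V (FOb W k) (VHom L (FOb D k) x) \<cdot> (\<beta> k \<otimes> Idn V (FOb W k))" for k
        have g: "\<forall>k\<in>S. g k \<in> hom V (Z \<odot> FOb W k) (VHom L (FOb D k) x)"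
          using \<beta> by (simp add: g_def)
        have "(\<forall>k\<in>S. p x k \<cdot> f = \<beta> k) \<longleftrightarrow> (\<forall>k\<in>S. VCmp L (FOb D k) c x \<cdot> (f \<otimes> ?n k) = g k)"
          if "f \<in> hom V Z (VHom L c x)" for f
          using bij[OF x _ that \<beta>] by (simp add: g_def)
        thus "\<exists>!f. f \<in> hom V Z (VHom L c x) \<and> (\<forall>k\<in>VOb ?K. p x k \<cdot> f = \<beta> k)"
          using \<open>?U\<close>[rule_format, OF Z, of g] g by (simp only: discrete_simps cong: conj_cong)
      qed
    qed
  qed
  thus ?thesis
    using True W D nat
    unfolding is_wcolim_def op_discrete copower_colimit_def p_def[symmetric]
    by (simp del: in_hom_iff add: in_hom_iff[of "named_arr _ _ _"])
next
  let ?K = "discrete_vcat V S"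
  case False
  have "c \<in> VOb L \<and> ?T" if w: "is_wcolim V ?K L W D c \<nu>"
  proof
    show c: "c \<in> VOb L" using w by (simp add: is_wcolim_def)
    note hi = hom_into_along_discrete[OF D c]
    have "vnat V ?K (self_vcat V) W (hom_into_along V ?K L D c) \<nu>"
      using w by (simp add: is_wcolim_def op_discrete)
    thus ?T using hi unfolding vnat_iff_vnat_family[OF W hi(1)] discrete_family[OF W hi(1)] by simp
  qed
  moreover have "c \<in> VOb L" if "copower_colimit L S (FOb W) (FOb D) c n" for n
    using that by (simp add: copower_colimit_def)
  ultimately show ?thesis using False by blast
qed

text \<open>
  Cocompleteness speaks of index sets in the type of \<open>U\<close>, so the index set is first moved there.
\<close>

lemma copower_colimit_exists:
  assumes co: "cocomplete_vcat (U :: 'u set) V L" and L: "vcategory V L" and I: "small U I"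
    and W: "\<And>i. i \<in> I \<Longrightarrow> W i \<in> Obj V" and D: "\<And>i. i \<in> I \<Longrightarrow> D i \<in> VOb L"
  shows "\<exists>c n. copower_colimit L I W D c n"
proof -
  interpret L: vcategory V L by fact
  obtain f :: "_ \<Rightarrow> 'u" where f: "inj_on f I" using small_embeds[OF I] by blast
  define f' where "f' = inv_into I f"
  have f' [simp]: "i \<in> I \<Longrightarrow> f' (f i) = i" for i using f by (simp add: f'_def)
  let ?S = "f ` I"
  let ?K = "discrete_vcat V ?S"
  define W' where "W' = discrete_vfun ?S (self_vcat V) (W \<circ> f')"
  define D' where "D' = discrete_vfun ?S L (D \<circ> f')"
  have W': "vfunctor V ?K (self_vcat V) W'"
    unfolding W'_def by (rule vfunctor_discrete_vfun[OF vcategory_self]) (auto simp: W)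
  have D': "vfunctor V ?K L D'"
    unfolding D'_def by (rule vfunctor_discrete_vfun[OF L]) (auto simp: D)
  have "vcategory V ?K \<and> small U (VOb ?K) \<and> vfunctor V (op_vcat V ?K) (self_vcat V) W' \<and> vfunctor V ?K L D'"
    unfolding op_discrete discrete_simps
    by (intro conjI vcategory_discrete small_image[OF I] W' D')
  with co have "\<exists>c \<nu>. is_wcolim V ?K L W' D' c \<nu>"
    unfolding cocomplete_vcat_def by (elim allE impE)
  then obtain c n where c: "copower_colimit L ?S (FOb W') (FOb D') c n"
    unfolding is_wcolim_discrete_iff[OF W' D'] by blast
  have WD [simp]: "i \<in> I \<Longrightarrow> FOb W' (f i) = W i" "i \<in> I \<Longrightarrow> FOb D' (f i) = D i" for i
    by (simp_all add: W'_def D'_def)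
  have "copower_colimit L I W D c (n \<circ> f)" unfolding copower_colimit_def
  proof (intro conjI ballI allI impI)
    show "c \<in> VOb L" using c by (simp add: copower_colimit_def)
    show "(n \<circ> f) k \<in> hom V (W k) (VHom L (D k) c)" if "k \<in> I" for k
      using c that by (simp add: copower_colimit_def)
    fix x Z g assume x: "x \<in> VOb L" "Z \<in> Obj V" and g: "\<forall>k\<in>I. g k \<in> hom V (Z \<odot> W k) (VHom L (D k) x)"
    have "\<forall>k\<in>?S. (g \<circ> f') k \<in> hom V (Z \<odot> FOb W' k) (VHom L (FOb D' k) x)" using g by simp
    hence "\<exists>!h. h \<in> hom V Z (VHom L c x) \<and> (\<forall>k\<in>?S. VCmp L (FOb D' k) c x \<cdot> (h \<otimes> n k) = (g \<circ> f') k)"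
      by (intro copower_colimit_univ[OF c x]) blast
    thus "\<exists>!h. h \<in> hom V Z (VHom L c x) \<and> (\<forall>k\<in>I. VCmp L (D k) c x \<cdot> (h \<otimes> (n \<circ> f) k) = g k)"
      by simp
  qed
  thus ?thesis by blast
qed

end

section \<open>V-adjunctions from universal arrows\<close>

locale universal_arrows = G: vfunctor V B M G
  for V :: "('o, 'm) smc" (structure)
    and M :: "('x, 'o, 'm) vcat" and B :: "('b, 'o, 'm) vcat" and G :: "('b, 'x, 'm) vfun" +
  fixes fo :: "'x \<Rightarrow> 'b" and \<eta> :: "'x \<Rightarrow> 'm"
  assumes fo [simp]: "x \<in> VOb M \<Longrightarrow> fo x \<in> VOb B"
    and \<eta>: "x \<in> VOb M \<Longrightarrow> \<eta> x \<in> hom V \<one> (VHom M x (FOb G (fo x)))"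
    and transpose_iso: "\<lbrakk>x \<in> VOb M; b \<in> VOb B\<rbrakk>
      \<Longrightarrow> is_iso V (vpre V M x (FOb G (fo x)) (FOb G b) (\<eta> x) \<cdot> FHom G (fo x) b)"
begin

lemma \<eta>_types [simp]:
  assumes "x \<in> VOb M"
  shows "\<eta> x \<in> Arr V" "Dom V (\<eta> x) = \<one>" "Cod V (\<eta> x) = VHom M x (FOb G (fo x))"
  using \<eta>[OF assms] by simp_all

definition untranspose :: "'x \<Rightarrow> 'b \<Rightarrow> 'm" where
  "untranspose x b = inverse_arr V (vpre V M x (FOb G (fo x)) (FOb G b) (\<eta> x) \<cdot> FHom G (fo x) b)"

lemma untranspose_types [simp]:
  assumes [simp]: "x \<in> VOb M" "b \<in> VOb B"
  shows "untranspose x b \<in> Arr V" "Dom V (untranspose x b) = VHom M x (FOb G b)"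
    "Cod V (untranspose x b) = VHom B (fo x) b"
  using G.inverse_types[OF transpose_iso[OF assms]] by (simp_all add: untranspose_def)

lemma transpose_untranspose [simp]:
  assumes [simp]: "x \<in> VOb M" "b \<in> VOb B" "f \<in> Arr V" "Cod V f = VHom M x (FOb G b)"
  shows "vpre V M x (FOb G (fo x)) (FOb G b) (\<eta> x) \<cdot> (FHom G (fo x) b \<cdot> (untranspose x b \<cdot> f)) = f"
  using G.inverse_cancel_tail(2)[OF transpose_iso[OF assms(1,2)], of f]
  by (simp add: untranspose_def[symmetric])

text \<open>
  Every equation below between arrows into \<open>B(fo x, b)\<close> is checked on transposes.
\<close>

lemma transpose_eqI:
  assumes "vpre V M x (FOb G (fo x)) (FOb G b) (\<eta> x) \<cdot> (FHom G (fo x) b \<cdot> f)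
      = vpre V M x (FOb G (fo x)) (FOb G b) (\<eta> x) \<cdot> (FHom G (fo x) b \<cdot> g)"
    and [simp]: "x \<in> VOb M" "b \<in> VOb B" "f \<in> Arr V" "Cod V f = VHom B (fo x) b" "g \<in> Arr V" "Cod V g = VHom B (fo x) b"
  shows "f = g"
  by (rule G.iso_mono[OF _ transpose_iso[OF assms(2,3)]]) (use assms(1) in simp_all)

definition left_adjoint :: "('x, 'b, 'm) vfun" where
  "left_adjoint = mk_vfun M fo (\<lambda>x y. untranspose x (fo y) \<cdot> vpost V M x y (FOb G (fo y)) (\<eta> y))"

definition counit :: "'b \<Rightarrow> 'm" where
  "counit b = untranspose (FOb G b) b \<cdot> VId M (FOb G b)"

lemma left_adjoint_simps [simp]:
  "x \<in> VOb M \<Longrightarrow> FOb left_adjoint x = fo x"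
  "\<lbrakk>x \<in> VOb M; y \<in> VOb M\<rbrakk> \<Longrightarrow> FHom left_adjoint x y
    = untranspose x (fo y) \<cdot> vpost V M x y (FOb G (fo y)) (\<eta> y)"
  by (simp_all add: left_adjoint_def)

lemma counit_types [simp]:
  assumes "b \<in> VOb B"
  shows "counit b \<in> Arr V" "Dom V (counit b) = \<one>" "Cod V (counit b) = VHom B (fo (FOb G b)) b"
  using assms by (simp_all add: counit_def)

lemma G_counit:
  assumes [simp]: "b \<in> VOb B"
  shows "vpre V M (FOb G b) (FOb G (fo (FOb G b))) (FOb G b) (\<eta> (FOb G b)) \<cdot> (FHom G (fo (FOb G b)) b \<cdot> counit b)
    = VId M (FOb G b)"
  by (simp add: counit_def)

text \<open>
  The transpose of \<open>F\<^sub>x\<^sub>y\<close> is postcomposition with \<open>\<eta>\<^sub>y\<close>, which is compatible with composition.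
\<close>

lemma vfunctor_left_adjoint: "vfunctor V M B left_adjoint"
  unfolding left_adjoint_def
proof (rule G.vfunctor_mk_vfun)
  fix x y z assume [simp]: "x \<in> VOb M" "y \<in> VOb M" "z \<in> VOb M"
  let ?F = "\<lambda>x y. untranspose x (fo y) \<cdot> vpost V M x y (FOb G (fo y)) (\<eta> y)"
  show "?F x z \<cdot> VCmp M x y z = VCmp B (fo x) (fo y) (fo z) \<cdot> (?F y z \<otimes> ?F x y)"
  proof (rule transpose_eqI[of x "fo z"])
    have "vpre V M x (FOb G (fo x)) (FOb G (fo z)) (\<eta> x) \<cdot>
        (FHom G (fo x) (fo z) \<cdot> (VCmp B (fo x) (fo y) (fo z) \<cdot> (?F y z \<otimes> ?F x y)))
      = VCmp M x (FOb G (fo y)) (FOb G (fo z)) \<cdot> ((FHom G (fo y) (fo z) \<cdot> ?F y z) \<otimes>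
         (vpost V M x y (FOb G (fo y)) (\<eta> y) \<cdot> Idn V (VHom M x y)))"
      by (simp add: G.FHom_VCmp_el G.B.VCmp_vpre[symmetric])
    also have "\<dots> = VCmp M x y (FOb G (fo z)) \<cdot>
        ((vpre V M y (FOb G (fo y)) (FOb G (fo z)) (\<eta> y) \<cdot> (FHom G (fo y) (fo z) \<cdot> ?F y z)) \<otimes> Idn V (VHom M x y))"
      by (subst G.B.VCmp_middle[symmetric]) simp_all
    also have "\<dots> = vpre V M x (FOb G (fo x)) (FOb G (fo z)) (\<eta> x) \<cdot>
        (FHom G (fo x) (fo z) \<cdot> (?F x z \<cdot> VCmp M x y z))"
      using G.B.VCmp_vpost[of x y z "FOb G (fo z)" "\<eta> z" "Idn V (VHom M y z)" "Idn V (VHom M x y)"] by simp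
    finally show "vpre V M x (FOb G (fo x)) (FOb G (fo z)) (\<eta> x) \<cdot> (FHom G (fo x) (fo z) \<cdot> (?F x z \<cdot> VCmp M x y z))
      = vpre V M x (FOb G (fo x)) (FOb G (fo z)) (\<eta> x) \<cdot>
        (FHom G (fo x) (fo z) \<cdot> (VCmp B (fo x) (fo y) (fo z) \<cdot> (?F y z \<otimes> ?F x y)))" by simp
  qed simp_all
next
  fix x assume [simp]: "x \<in> VOb M"
  show "(untranspose x (fo x) \<cdot> vpost V M x x (FOb G (fo x)) (\<eta> x)) \<cdot> VId M x = VId B (fo x)"
    by (rule transpose_eqI[of x "fo x"]) simp_all
qed (simp_all add: G.vcategory_axioms G.B.vcategory_axioms)

lemma vadjunction_left_adjoint: "vadjunction V M B left_adjoint G \<eta> counit"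
proof -
  interpret F: vfunctor V M B left_adjoint by (rule vfunctor_left_adjoint)
  interpret GF: vfunctor V M M "vfun_comp V M G left_adjoint"
    by (rule vfunctor_vfun_comp[OF vfunctor_left_adjoint G.vfunctor_axioms])
  interpret FG: vfunctor V B B "vfun_comp V B left_adjoint G"
    by (rule vfunctor_vfun_comp[OF G.vfunctor_axioms vfunctor_left_adjoint])
  interpret iM: vfunctor V M M "vfun_id V M" by (rule G.B.vfunctor_vfun_id)
  interpret iB: vfunctor V B B "vfun_id V B" by (rule G.vfunctor_vfun_id)
  interpret unit: vnat V M M "vfun_id V M" "vfun_comp V M G left_adjoint" \<eta>
    by unfold_locales simp_all
  have counit_post: "vpost V M (FOb G b) (FOb G (fo (FOb G b))) (FOb G b) (FHom G (fo (FOb G b)) b \<cdot> counit b)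
      \<cdot> \<eta> (FOb G b) = VId M (FOb G b)" if "b \<in> VOb B" for b
    using that G_counit[OF that] by (simp add: G.B.vpost_eq_vpre)
  interpret counit: vnat V B B "vfun_comp V B left_adjoint G" "vfun_id V B" counit
  proof
    fix b d assume [simp]: "b \<in> VOb B" "d \<in> VOb B"
    let ?b = "FOb G b" and ?d = "FOb G d"
    have "vpost V B (fo ?b) (fo ?d) d (counit d) \<cdot> (FHom left_adjoint ?b ?d \<cdot> FHom G b d)
        = vpre V B (fo ?b) b d (counit b)"
    proof (rule transpose_eqI[of ?b d])
      have "vpre V M ?b (FOb G (fo ?b)) ?d (\<eta> ?b) \<cdot> (FHom G (fo ?b) d \<cdot>
          (vpost V B (fo ?b) (fo ?d) d (counit d) \<cdot> (FHom left_adjoint ?b ?d \<cdot> FHom G b d)))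
        = vpost V M ?b (FOb G (fo ?d)) ?d (FHom G (fo ?d) d \<cdot> counit d) \<cdot>
          (vpost V M ?b ?d (FOb G (fo ?d)) (\<eta> ?d) \<cdot> FHom G b d)"
        by (simp add: G.FHom_vpost G.B.vpost_vpre[symmetric])
      also have "\<dots> = FHom G b d"
        by (subst G.B.vpost_vpost) (simp_all add: counit_post)
      also have "\<dots> = vpre V M ?b (FOb G (fo ?b)) ?d (\<eta> ?b) \<cdot>
          (FHom G (fo ?b) d \<cdot> (vpre V B (fo ?b) b d (counit b) \<cdot> Idn V (VHom B b d)))"
        by (subst G.FHom_vpre, simp_all) (subst G.B.vpre_vpre, simp_all add: G_counit)
      finally show "vpre V M ?b (FOb G (fo ?b)) ?d (\<eta> ?b) \<cdot> (FHom G (fo ?b) d \<cdot>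
          (vpost V B (fo ?b) (fo ?d) d (counit d) \<cdot> (FHom left_adjoint ?b ?d \<cdot> FHom G b d)))
        = vpre V M ?b (FOb G (fo ?b)) ?d (\<eta> ?b) \<cdot> (FHom G (fo ?b) d \<cdot> vpre V B (fo ?b) b d (counit b))"
        by simp
    qed simp_all
    thus "vpost V B (FOb (vfun_comp V B left_adjoint G) b) (FOb (vfun_comp V B left_adjoint G) d) (FOb (vfun_id V B) d)
        (counit d) \<cdot> FHom (vfun_comp V B left_adjoint G) b d =
       vpre V B (FOb (vfun_comp V B left_adjoint G) b) (FOb (vfun_id V B) b) (FOb (vfun_id V B) d) (counit b) \<cdot>
       FHom (vfun_id V B) b d" by simp
  qed simp_all
  show ?thesis
  proof
    fix x assume [simp]: "x \<in> VOb M"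
    have "vpost V B (fo x) (fo (FOb G (fo x))) (fo x) (counit (fo x)) \<cdot>
        (FHom left_adjoint x (FOb G (fo x)) \<cdot> \<eta> x) = VId B (fo x)"
    proof (rule transpose_eqI[of x "fo x"])
      let ?y = "FOb G (fo x)"
      have "vpre V M x ?y ?y (\<eta> x) \<cdot> (FHom G (fo x) (fo x) \<cdot> (vpost V B (fo x) (fo ?y) (fo x) (counit (fo x)) \<cdot>
            (FHom left_adjoint x ?y \<cdot> \<eta> x)))
          = vpost V M x (FOb G (fo ?y)) ?y (FHom G (fo ?y) (fo x) \<cdot> counit (fo x)) \<cdot>
            (vpost V M x ?y (FOb G (fo ?y)) (\<eta> ?y) \<cdot> \<eta> x)"
        by (simp add: G.FHom_vpost G.B.vpost_vpre[symmetric])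
      also have "\<dots> = \<eta> x"
        by (subst G.B.vpost_vpost) (simp_all add: counit_post)
      also have "\<dots> = vpre V M x ?y ?y (\<eta> x) \<cdot> (FHom G (fo x) (fo x) \<cdot> VId B (fo x))"
        by simp
      finally show "vpre V M x ?y ?y (\<eta> x) \<cdot> (FHom G (fo x) (fo x) \<cdot> (vpost V B (fo x) (fo ?y) (fo x) (counit (fo x)) \<cdot>
            (FHom left_adjoint x ?y \<cdot> \<eta> x)))
        = vpre V M x ?y ?y (\<eta> x) \<cdot> (FHom G (fo x) (fo x) \<cdot> VId B (fo x))" .
    qed simp_all
    thus "vcomp V B (FOb left_adjoint x) (FOb left_adjoint (FOb G (FOb left_adjoint x))) (FOb left_adjoint x)
        (counit (FOb left_adjoint x)) (FHom left_adjoint x (FOb G (FOb left_adjoint x)) \<cdot> \<eta> x) = VId B (FOb left_adjoint x)"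
      by (simp add: G.vcomp_eq_vpost)
  next
    fix b assume [simp]: "b \<in> VOb B"
    show "vcomp V M (FOb G b) (FOb G (FOb left_adjoint (FOb G b))) (FOb G b)
        (FHom G (FOb left_adjoint (FOb G b)) b \<cdot> counit b) (\<eta> (FOb G b)) = VId M (FOb G b)"
      by (simp add: G.B.vcomp_eq_vpost counit_post)
  qed
qed

end

section \<open>Left Kan extension along the inclusion of objects\<close>

locale ob_restriction = smc_initial V + P: vcategory V P + L: vcategory V L
  for V :: "('o, 'm) smc" (structure)
    and P :: "('p, 'o, 'm) vcat" and L :: "('l, 'o, 'm) vcat" +
  assumes ob_ends: "\<lbrakk>vfunctor V (ob_vcat V P) L F; vfunctor V (ob_vcat V P) L G\<rbrakk>
      \<Longrightarrow> \<exists>E p. is_end V (ob_vcat V P) L F G E p"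
    and P_ends: "\<lbrakk>vfunctor V P L F; vfunctor V P L G\<rbrakk> \<Longrightarrow> \<exists>E p. is_end V P L F G E p"
begin

abbreviation "K \<equiv> ob_vcat V P"
abbreviation "H \<equiv> ob_incl V P"

lemma ob_simps [simp]: "VOb K = VOb P" "VHom K a b = dhom a b" "VId K a = Idn V \<one>"
  by (simp_all add: ob_vcat_def)

lemma H_simps [simp]:
  "a \<in> VOb P \<Longrightarrow> FOb H a = a" "a \<in> VOb P \<Longrightarrow> FHom H a a = VId P a"
  by (simp_all add: ob_incl_def)

lemma vfunctor_H: "vfunctor V K P H"
proof -
  have "(THE f. f \<in> hom V (initial_obj V) (VHom P a b)) \<in> hom V (initial_obj V) (VHom P a b)"
    if "a \<in> VOb P" "b \<in> VOb P" for a b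
    by (rule initial_ex[OF initial]) (use that in simp)
  thus ?thesis unfolding ob_vcat_def
    by (intro vfunctor_discreteI[OF P.vcategory_axioms])
       (auto simp: ob_incl_def ob_vcat_def simp del: in_hom_iff intro: P.VId_in)
qed

sublocale R: restriction V K P L H
proof -
  interpret K: vcategory V K unfolding ob_vcat_def by (rule vcategory_discrete)
  interpret H: vfunctor V K P H by (rule vfunctor_H)
  show "restriction V K P L H" by unfold_locales (use ob_ends P_ends in simp_all)
qed

abbreviation "M \<equiv> functor_vcat V K L"
abbreviation "B \<equiv> functor_vcat V P L"
abbreviation "G \<equiv> ob_restrict V P L"

lemma G_eq: "G = precomp V K P L H" by (simp add: ob_restrict_def)

lemma G_ob: "vfunctor V P L b \<Longrightarrow> FOb G b = vfun_comp V K b H" by (simp add: G_eq)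

lemma G_ob_types [simp]:
  assumes "vfunctor V P L b"
  shows "vfunctor V K L (FOb G b)" "a \<in> VOb P \<Longrightarrow> FOb (FOb G b) a = FOb b a"
  using R.comp_J[OF assms] assms by (simp_all add: G_ob)

lemma G_hom_types [simp]:
  assumes "vfunctor V P L b" "vfunctor V P L d"
  shows "FHom G b d \<in> Arr V" "Dom V (FHom G b d) = VHom B b d" "Cod V (FHom G b d) = VHom M (FOb G b) (FOb G d)"
  using R.R_hom_types[OF assms] assms by (simp_all add: G_eq)

lemma proj_G:
  assumes "vfunctor V P L b" "vfunctor V P L d" "a \<in> VOb P" "x \<in> Arr V" "Cod V x = VHom B b d"
  shows "fun_proj V K L (FOb G b) (FOb G d) a \<cdot> (FHom G b d \<cdot> x) = fun_proj V P L b d a \<cdot> x"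
  using R.proj_R[of b d a x] assms by (simp add: G_eq)

lemma vfunctor_G: "vfunctor V B M G"
  unfolding G_eq by (rule R.vfunctor_R)

lemma K_functor_FOb: "vfunctor V K L F \<Longrightarrow> a \<in> VOb P \<Longrightarrow> FOb F a \<in> VOb L"
  using vfunctor.FOb_in[of V K L F a] by simp

text \<open>
  The coprojection of the summand \<open>P(a,c) \<odot> F a\<close> of \<open>N c\<close> is required to come from the unit, as in
  \<open>is_left_kan\<close>.
\<close>

definition is_lan :: "('p, 'l, 'm) vfun \<Rightarrow> ('p, 'l, 'm) vfun \<Rightarrow> ('p \<Rightarrow> 'm) \<Rightarrow> bool" where
  "is_lan F N \<eta> \<longleftrightarrow> vfunctor V P L N \<and>
     (\<forall>a \<in> VOb P. \<eta> a \<in> hom V \<one> (VHom L (FOb F a) (FOb N a))) \<and>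
     (\<forall>c \<in> VOb P. copower_colimit L (VOb P) (\<lambda>a. VHom P a c) (FOb F) (FOb N c)
        (\<lambda>a. vpre V L (FOb F a) (FOb N a) (FOb N c) (\<eta> a) \<cdot> FHom N a c))"

text \<open>
  The action of \<open>P(c,d)\<close> on \<open>N\<close> is induced, through the universal property of \<open>N c\<close>, by composition
  \<open>P(c,d) \<odot> P(a,c) \<rightarrow> P(a,d)\<close> followed by the coprojection; associativity and unit laws of \<open>P\<close> then make
  \<open>N\<close> a V-functor.  The unit picks the summand of the identity, and acting on it recovers all
  coprojections.
\<close>

lemma lan_exists:
  assumes F: "vfunctor V K L F"
    and "\<And>c. c \<in> VOb P \<Longrightarrow> \<exists>t n. copower_colimit L (VOb P) (\<lambda>a. VHom P a c) (FOb F) t n"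
  shows "\<exists>N \<eta>. is_lan F N \<eta>"
proof -
  note [simp] = K_functor_FOb[OF F]
  have "\<forall>c\<in>VOb P. \<exists>q. copower_colimit L (VOb P) (\<lambda>a. VHom P a c) (FOb F) (fst q) (snd q)"
    using assms(2) by simp
  from bchoice[OF this] obtain q
    where q: "\<And>c. c \<in> VOb P \<Longrightarrow> copower_colimit L (VOb P) (\<lambda>a. VHom P a c) (FOb F) (fst (q c)) (snd (q c))"
    by blast
  define t where "t c = fst (q c)" for c
  define n where "n a c = snd (q c) a" for a c
  have colim: "copower_colimit L (VOb P) (\<lambda>a. VHom P a c) (FOb F) (t c) (\<lambda>a. n a c)" if "c \<in> VOb P" for c
    using q[OF that] by (simp add: t_def n_def)
  have [simp]: "c \<in> VOb P \<Longrightarrow> t c \<in> VOb L" for c using colim by (simp add: copower_colimit_def)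
  have n [simp]: "n a c \<in> Arr V" "Dom V (n a c) = VHom P a c" "Cod V (n a c) = VHom L (FOb F a) (t c)"
    if "a \<in> VOb P" "c \<in> VOb P" for a c
    using colim[OF that(2)] that(1) by (simp_all add: copower_colimit_def)
  have test: "f = g" if "c \<in> VOb P" "x \<in> VOb L" "f \<in> Arr V" "g \<in> Arr V" "Dom V f = Dom V g"
      "Cod V f = VHom L (t c) x" "Cod V g = VHom L (t c) x"
      "\<And>a. a \<in> VOb P \<Longrightarrow> VCmp L (FOb F a) (t c) x \<cdot> (f \<otimes> n a c) = VCmp L (FOb F a) (t c) x \<cdot> (g \<otimes> n a c)"
    for c x f g
    by (rule copower_colimit_eqI[OF colim[OF that(1)] L.vcategory_axioms that(2) _ that(3-7)])
       (use that(8) in simp_all)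
  \<comment> \<open>the action of \<open>P\<close> on \<open>N\<close>, through the universal property\<close>
  define Nh where "Nh c d = (SOME f. f \<in> hom V (VHom P c d) (VHom L (t c) (t d)) \<and>
      (\<forall>a\<in>VOb P. VCmp L (FOb F a) (t c) (t d) \<cdot> (f \<otimes> n a c) = n a d \<cdot> VCmp P a c d))" for c d
  have Nh: "Nh c d \<in> hom V (VHom P c d) (VHom L (t c) (t d)) \<and>
      (\<forall>a\<in>VOb P. VCmp L (FOb F a) (t c) (t d) \<cdot> (Nh c d \<otimes> n a c) = n a d \<cdot> VCmp P a c d)"
    if "c \<in> VOb P" "d \<in> VOb P" for c d
    unfolding Nh_def by (rule someI_ex, rule ex1_implies_ex, rule copower_colimit_univ[OF colim[OF that(1)]])
      (use that in simp_all)
  have Nh2: "VCmp L (FOb F a) (t c) (t d) \<cdot> (Nh c d \<otimes> n a c) = n a d \<cdot> VCmp P a c d"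
    if "a \<in> VOb P" "c \<in> VOb P" "d \<in> VOb P" for a c d
    using Nh[OF that(2,3)] that(1) by blast
  have [simp]: "Nh c d \<in> Arr V" "Dom V (Nh c d) = VHom P c d" "Cod V (Nh c d) = VHom L (t c) (t d)"
    if "c \<in> VOb P" "d \<in> VOb P" for c d using Nh[OF that] by simp_all
  have Nn: "VCmp L (FOb F a) (t c) (t d) \<cdot> ((Nh c d \<cdot> f) \<otimes> (n a c \<cdot> g)) = n a d \<cdot> (VCmp P a c d \<cdot> (f \<otimes> g))"
    if "a \<in> VOb P" "c \<in> VOb P" "d \<in> VOb P" "f \<in> Arr V" "Cod V f = VHom P c d" "g \<in> Arr V" "Cod V g = VHom P a c"
    for a c d f g
    using comp_cong_tail[OF Nh2[of a c d], of "f \<otimes> g"] that by simp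
  define N where "N = mk_vfun P t Nh"
  have N: "vfunctor V P L N" unfolding N_def
  proof (rule vfunctor_mk_vfun)
    fix c d e assume [simp]: "c \<in> VOb P" "d \<in> VOb P" "e \<in> VOb P"
    show "Nh c e \<cdot> VCmp P c d e = VCmp L (t c) (t d) (t e) \<cdot> (Nh d e \<otimes> Nh c d)"
    proof (rule test[of c "t e"])
      fix a assume [simp]: "a \<in> VOb P"
      have "VCmp L (FOb F a) (t c) (t e) \<cdot> ((VCmp L (t c) (t d) (t e) \<cdot> (Nh d e \<otimes> Nh c d)) \<otimes> n a c)
        = VCmp L (FOb F a) (t d) (t e) \<cdot> ((Nh d e \<otimes> (VCmp L (FOb F a) (t c) (t d) \<cdot> (Nh c d \<otimes> n a c)))
           \<cdot> assoc V (VHom P d e) (VHom P c d) (VHom P a c))"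
        by (simp add: L.VCmp_assoc_el)
      also have "\<dots> = (VCmp L (FOb F a) (t d) (t e) \<cdot> (Nh d e \<otimes> (n a d \<cdot> VCmp P a c d)))
           \<cdot> assoc V (VHom P d e) (VHom P c d) (VHom P a c)"
        by (simp add: Nh2)
      also have "\<dots> = n a e \<cdot> (VCmp P a d e \<cdot> ((Idn V (VHom P d e) \<otimes> VCmp P a c d)
           \<cdot> assoc V (VHom P d e) (VHom P c d) (VHom P a c)))"
        using Nn[of a d e "Idn V (VHom P d e)" "VCmp P a c d"] by simp
      also have "\<dots> = n a e \<cdot> (VCmp P a c e \<cdot> (VCmp P c d e \<otimes> Idn V (VHom P a c)))"
        by (simp add: P.VCmp_assoc)
      also have "\<dots> = VCmp L (FOb F a) (t c) (t e) \<cdot> ((Nh c e \<cdot> VCmp P c d e) \<otimes> n a c)"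
        using Nn[of a c e "VCmp P c d e" "Idn V (VHom P a c)"] by simp
      finally show "VCmp L (FOb F a) (t c) (t e) \<cdot> ((Nh c e \<cdot> VCmp P c d e) \<otimes> n a c)
         = VCmp L (FOb F a) (t c) (t e) \<cdot> ((VCmp L (t c) (t d) (t e) \<cdot> (Nh d e \<otimes> Nh c d)) \<otimes> n a c)" by simp
    qed simp_all
  next
    fix c assume [simp]: "c \<in> VOb P"
    show "Nh c c \<cdot> VId P c = VId L (t c)"
    proof (rule test[of c "t c"])
      fix a assume [simp]: "a \<in> VOb P"
      show "VCmp L (FOb F a) (t c) (t c) \<cdot> ((Nh c c \<cdot> VId P c) \<otimes> n a c)
        = VCmp L (FOb F a) (t c) (t c) \<cdot> (VId L (t c) \<otimes> n a c)"
        using Nn[of a c c "VId P c" "Idn V (VHom P a c)"] by simp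
    qed simp_all
  qed (simp_all add: P.vcategory_axioms L.vcategory_axioms)
  interpret N: vfunctor V P L N by fact
  \<comment> \<open>the summand of \<open>N a\<close> picked out by the identity of \<open>a\<close>\<close>
  define \<eta> where "\<eta> a = n a a \<cdot> VId P a" for a
  have \<eta> [simp]: "\<eta> a \<in> Arr V" "Dom V (\<eta> a) = \<one>" "Cod V (\<eta> a) = VHom L (FOb F a) (t a)"
    if "a \<in> VOb P" for a using that by (simp_all add: \<eta>_def)
  have n_eq: "n a c = vpre V L (FOb F a) (FOb N a) (FOb N c) (\<eta> a) \<cdot> FHom N a c"
    if [simp]: "a \<in> VOb P" "c \<in> VOb P" for a c
  proof -
    have "vpre V L (FOb F a) (t a) (t c) (\<eta> a) \<cdot> Nh a c
      = (VCmp L (FOb F a) (t a) (t c) \<cdot> (Nh a c \<otimes> (n a a \<cdot> VId P a))) \<cdot> rinv (VHom P a c)"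
      by (simp add: L.vpre_el \<eta>_def)
    also have "\<dots> = n a c"
      using Nn[of a a c "Idn V (VHom P a c)" "VId P a"] by simp
    finally show ?thesis by (simp add: N_def)
  qed
  have "copower_colimit L (VOb P) (\<lambda>a. VHom P a c) (FOb F) (FOb N c)
        (\<lambda>a. vpre V L (FOb F a) (FOb N a) (FOb N c) (\<eta> a) \<cdot> FHom N a c)" if "c \<in> VOb P" for c
  proof -
    have "FOb N c = t c" using that by (simp add: N_def)
    thus ?thesis using colim[OF that] n_eq[OF _ that] unfolding copower_colimit_def by simp
  qed
  hence "is_lan F N \<eta>" using N by (simp add: is_lan_def N_def)
  thus ?thesis by blast
qed

end

context ob_restriction begin

text \<open>
  The inverse sends an arrow \<open>z : F \<rightarrow> G b\<close> to the arrow that on the summand indexed by \<open>a\<close> applies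
  \<open>z\<^sub>a\<close> and then lets \<open>P(a,c)\<close> act on \<open>b\<close>.  It is defined on the whole hom object
  \<open>X = M(F, G b)\<close> at once, by its components \<open>w\<^sub>c\<close>.
\<close>

lemma lan_transpose_iso:
  assumes lan: "is_lan F N \<eta>" and F [simp]: "vfunctor V K L F"
    and e [simp]: "e \<in> Arr V" "Dom V e = \<one>" "Cod V e = VHom M F (FOb G N)"
      "\<And>a. a \<in> VOb P \<Longrightarrow> fun_proj V K L F (FOb G N) a \<cdot> e = \<eta> a"
    and b [simp]: "vfunctor V P L b"
  shows "is_iso V (vpre V M F (FOb G N) (FOb G b) e \<cdot> FHom G N b)"
proof -
  note [simp] = K_functor_FOb[OF F]
  have N [simp]: "vfunctor V P L N" using lan by (simp add: is_lan_def)
  interpret N: vfunctor V P L N by fact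
  interpret b: vfunctor V P L b by fact
  interpret M: vcategory V M by (rule R.AB.vcategory_FC)
  interpret B: vcategory V B by (rule R.CB.vcategory_FC)
  have \<eta> [simp]: "\<eta> a \<in> Arr V" "Dom V (\<eta> a) = \<one>" "Cod V (\<eta> a) = VHom L (FOb F a) (FOb N a)"
    if "a \<in> VOb P" for a using lan that by (simp_all add: is_lan_def)
  define n where "n a c = vpre V L (FOb F a) (FOb N a) (FOb N c) (\<eta> a) \<cdot> FHom N a c" for a c
  have n [simp]: "n a c \<in> Arr V" "Dom V (n a c) = VHom P a c" "Cod V (n a c) = VHom L (FOb F a) (FOb N c)"
    if "a \<in> VOb P" "c \<in> VOb P" for a c using that by (simp_all add: n_def)
  have colim: "copower_colimit L (VOb P) (\<lambda>a. VHom P a c) (FOb F) (FOb N c) (\<lambda>a. n a c)"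
    if "c \<in> VOb P" for c using lan that by (simp add: is_lan_def n_def)
  have test: "f = g" if "c \<in> VOb P" "x \<in> VOb L" "f \<in> Arr V" "g \<in> Arr V" "Dom V f = Dom V g"
      "Cod V f = VHom L (FOb N c) x" "Cod V g = VHom L (FOb N c) x"
      "\<And>a. a \<in> VOb P \<Longrightarrow> VCmp L (FOb F a) (FOb N c) x \<cdot> (f \<otimes> n a c) = VCmp L (FOb F a) (FOb N c) x \<cdot> (g \<otimes> n a c)"
    for c x f g
    by (rule copower_colimit_eqI[OF colim[OF that(1)] L.vcategory_axioms that(2) _ that(3-7)])
       (use that(8) in simp_all)
  have n_nat: "VCmp L (FOb F a) (FOb N c) (FOb N d) \<cdot> ((FHom N c d \<cdot> f) \<otimes> (n a c \<cdot> g)) = n a d \<cdot> (VCmp P a c d \<cdot> (f \<otimes> g))"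
    if "a \<in> VOb P" "c \<in> VOb P" "d \<in> VOb P" "f \<in> Arr V" "Cod V f = VHom P c d" "g \<in> Arr V" "Cod V g = VHom P a c"
    for a c d f g
    using that by (simp add: n_def L.VCmp_vpre N.FHom_VCmp_el)
  let ?X = "VHom M F (FOb G b)"
  \<comment> \<open>the components of the generic arrow \<open>F \<rightarrow> G b\<close>\<close>
  define z where "z a = fun_proj V K L F (FOb G b) a" for a
  have z [simp]: "z a \<in> Arr V" "Dom V (z a) = ?X" "Cod V (z a) = VHom L (FOb F a) (FOb b a)"
    if "a \<in> VOb P" for a using R.AB.proj_types[of F "FOb G b" a] that by (simp_all add: z_def)
  \<comment> \<open>apply \<open>z\<^sub>a\<close>, then let \<open>P(a,c)\<close> act on \<open>b\<close>; the symmetry puts \<open>X\<close> first, as the universal property asks\<close>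
  define g where "g a c = VCmp L (FOb F a) (FOb b a) (FOb b c) \<cdot> ((FHom b a c \<otimes> z a) \<cdot> sym V ?X (VHom P a c))" for a c
  define w where "w c = (SOME f. f \<in> hom V ?X (VHom L (FOb N c) (FOb b c)) \<and>
      (\<forall>a\<in>VOb P. VCmp L (FOb F a) (FOb N c) (FOb b c) \<cdot> (f \<otimes> n a c) = g a c))" for c
  have w: "w c \<in> hom V ?X (VHom L (FOb N c) (FOb b c)) \<and>
      (\<forall>a\<in>VOb P. VCmp L (FOb F a) (FOb N c) (FOb b c) \<cdot> (w c \<otimes> n a c) = g a c)" if "c \<in> VOb P" for c
    unfolding w_def by (rule someI_ex, rule ex1_implies_ex, rule copower_colimit_univ[OF colim[OF that]])
      (use that in \<open>simp_all add: g_def\<close>)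
  have [simp]: "w c \<in> Arr V" "Dom V (w c) = ?X" "Cod V (w c) = VHom L (FOb N c) (FOb b c)" if "c \<in> VOb P" for c
    using w[OF that] by simp_all
  have w_n: "VCmp L (FOb F a) (FOb N c) (FOb b c) \<cdot> ((w c \<cdot> f) \<otimes> (n a c \<cdot> p))
      = VCmp L (FOb F a) (FOb b a) (FOb b c) \<cdot> (((FHom b a c \<cdot> p) \<otimes> (z a \<cdot> f)) \<cdot> sym V (Dom V f) (Dom V p))"
    if [simp]: "a \<in> VOb P" "c \<in> VOb P" "f \<in> Arr V" "Cod V f = ?X" "p \<in> Arr V" "Cod V p = VHom P a c" for a c f p
  proof -
    have "VCmp L (FOb F a) (FOb N c) (FOb b c) \<cdot> (w c \<otimes> n a c)
      = VCmp L (FOb F a) (FOb b a) (FOb b c) \<cdot> ((FHom b a c \<otimes> z a) \<cdot> sym V ?X (VHom P a c))"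
      using w[OF that(2)] that(1) by (simp add: g_def)
    from comp_cong_tail[OF this, of "f \<otimes> p"] show ?thesis by (simp add: sym_nat)
  qed
  have fam: "vnat_family V P L N b ?X w" unfolding vnat_family_def
  proof (intro conjI ballI)
    fix c d assume [simp]: "c \<in> VOb P" "d \<in> VOb P"
    let ?Q = "VHom P c d"
    show "VCmp L (FOb N c) (FOb b c) (FOb b d) \<cdot> (FHom b c d \<otimes> w c)
      = VCmp L (FOb N c) (FOb N d) (FOb b d) \<cdot> ((w d \<otimes> FHom N c d) \<cdot> sym V ?Q ?X)"
    proof (rule test[of c "FOb b d"])
      fix a assume [simp]: "a \<in> VOb P"
      let ?A = "VHom P a c"
      have "VCmp L (FOb F a) (FOb N c) (FOb b d) \<cdot> ((VCmp L (FOb N c) (FOb b c) (FOb b d) \<cdot> (FHom b c d \<otimes> w c)) \<otimes> n a c)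
        = VCmp L (FOb F a) (FOb b c) (FOb b d) \<cdot>
          ((FHom b c d \<otimes> (VCmp L (FOb F a) (FOb N c) (FOb b c) \<cdot> (w c \<otimes> n a c))) \<cdot> assoc V ?Q ?X ?A)"
        by (simp add: L.VCmp_assoc_el)
      also have "\<dots> = VCmp L (FOb F a) (FOb b c) (FOb b d) \<cdot>
          ((FHom b c d \<otimes> (VCmp L (FOb F a) (FOb b a) (FOb b c) \<cdot> (FHom b a c \<otimes> z a))) \<cdot>
           ((Idn V ?Q \<otimes> sym V ?X ?A) \<cdot> assoc V ?Q ?X ?A))"
        using w_n[of a c "Idn V ?X" "Idn V ?A"] by simp
      also have "\<dots> = (VCmp L (FOb F a) (FOb b c) (FOb b d) \<cdot>
          ((FHom b c d \<otimes> (VCmp L (FOb F a) (FOb b a) (FOb b c) \<cdot> (FHom b a c \<otimes> z a))) \<cdot> assoc V ?Q ?A ?X))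
          \<cdot> (ainv ?Q ?A ?X \<cdot> ((Idn V ?Q \<otimes> sym V ?X ?A) \<cdot> assoc V ?Q ?X ?A))"
        by simp
      also have "\<dots> = (VCmp L (FOb F a) (FOb b a) (FOb b d) \<cdot>
          ((VCmp L (FOb b a) (FOb b c) (FOb b d) \<cdot> (FHom b c d \<otimes> FHom b a c)) \<otimes> z a))
          \<cdot> (sym V ?X (?Q \<odot> ?A) \<cdot> (assoc V ?X ?Q ?A \<cdot> (sym V ?Q ?X \<otimes> Idn V ?A)))"
        by (subst L.VCmp_assoc_el) (simp_all add: sym_hexagon)
      also have "\<dots> = VCmp L (FOb F a) (FOb b a) (FOb b d) \<cdot> (((FHom b a d \<cdot> VCmp P a c d) \<otimes> z a)
          \<cdot> (sym V ?X (?Q \<odot> ?A) \<cdot> (assoc V ?X ?Q ?A \<cdot> (sym V ?Q ?X \<otimes> Idn V ?A))))"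
        by (simp add: b.FHom_VCmp)
      also have "\<dots> = (VCmp L (FOb F a) (FOb b a) (FOb b d) \<cdot> (((FHom b a d \<cdot> VCmp P a c d) \<otimes> z a)
          \<cdot> sym V ?X (?Q \<odot> ?A))) \<cdot> (assoc V ?X ?Q ?A \<cdot> (sym V ?Q ?X \<otimes> Idn V ?A))"
        by simp
      also have "\<dots> = (VCmp L (FOb F a) (FOb N d) (FOb b d) \<cdot> (w d \<otimes> (n a d \<cdot> VCmp P a c d)))
          \<cdot> (assoc V ?X ?Q ?A \<cdot> (sym V ?Q ?X \<otimes> Idn V ?A))"
        using w_n[of a d "Idn V ?X" "VCmp P a c d"] by simp
      also have "\<dots> = VCmp L (FOb F a) (FOb N d) (FOb b d) \<cdot>
          ((w d \<otimes> (VCmp L (FOb F a) (FOb N c) (FOb N d) \<cdot> (FHom N c d \<otimes> n a c)))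
          \<cdot> (assoc V ?X ?Q ?A \<cdot> (sym V ?Q ?X \<otimes> Idn V ?A)))"
        using n_nat[of a c d "Idn V ?Q" "Idn V ?A"] by simp
      also have "\<dots> = (VCmp L (FOb F a) (FOb N c) (FOb b d) \<cdot>
          ((VCmp L (FOb N c) (FOb N d) (FOb b d) \<cdot> (w d \<otimes> FHom N c d)) \<otimes> n a c)) \<cdot> (sym V ?Q ?X \<otimes> Idn V ?A)"
        by (subst L.VCmp_assoc_el) simp_all
      also have "\<dots> = VCmp L (FOb F a) (FOb N c) (FOb b d) \<cdot>
          ((VCmp L (FOb N c) (FOb N d) (FOb b d) \<cdot> ((w d \<otimes> FHom N c d) \<cdot> sym V ?Q ?X)) \<otimes> n a c)"
        by simp
      finally show "VCmp L (FOb F a) (FOb N c) (FOb b d) \<cdot> ((VCmp L (FOb N c) (FOb b c) (FOb b d) \<cdot> (FHom b c d \<otimes> w c)) \<otimes> n a c)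
        = VCmp L (FOb F a) (FOb N c) (FOb b d) \<cdot>
          ((VCmp L (FOb N c) (FOb N d) (FOb b d) \<cdot> ((w d \<otimes> FHom N c d) \<cdot> sym V ?Q ?X)) \<otimes> n a c)" .
    qed simp_all
  qed simp_all
  obtain u where u [simp]: "u \<in> Arr V" "Dom V u = ?X" "Cod V u = VHom B N b"
    "\<And>c. c \<in> VOb P \<Longrightarrow> fun_proj V P L N b c \<cdot> u = w c"
    using R.CB.proj_lift[OF N b fam] by blast
  let ?t = "vpre V M F (FOb G N) (FOb G b) e \<cdot> FHom G N b"
  have t [simp]: "?t \<in> Arr V" "Dom V ?t = VHom B N b" "Cod V ?t = ?X" by simp_all
  have proj_t: "z a \<cdot> (?t \<cdot> f) = vpre V L (FOb F a) (FOb N a) (FOb b a) (\<eta> a) \<cdot> (fun_proj V P L N b a \<cdot> f)"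
    if "a \<in> VOb P" "f \<in> Arr V" "Cod V f = VHom B N b" for a f
    using that by (simp add: z_def R.AB.proj_vpre proj_G)
  have tu: "?t \<cdot> u = Idn V ?X"
  proof (rule R.AB.proj_eqI[of F "FOb G b"])
    fix a assume "a \<in> VOb K"
    hence [simp]: "a \<in> VOb P" by simp
    have n_VId: "n a a \<cdot> VId P a = \<eta> a" by (simp add: n_def)
    have "z a \<cdot> (?t \<cdot> u) = vpre V L (FOb F a) (FOb N a) (FOb b a) (\<eta> a) \<cdot> w a"
      using proj_t[of a u] by simp
    also have "\<dots> = (VCmp L (FOb F a) (FOb N a) (FOb b a) \<cdot> (w a \<otimes> (n a a \<cdot> VId P a))) \<cdot> rinv ?X"
      using n_VId by (simp add: L.vpre_el)
    also have "\<dots> = z a"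
      using w_n[of a a "Idn V ?X" "VId P a"] by (simp add: sym_rinv)
    finally show "fun_proj V K L F (FOb G b) a \<cdot> (?t \<cdot> u) = fun_proj V K L F (FOb G b) a \<cdot> Idn V ?X"
      by (simp add: z_def[symmetric])
  qed simp_all
  have ut: "u \<cdot> ?t = Idn V (VHom B N b)"
  proof (rule R.CB.proj_eqI[of N b])
    fix c assume [simp]: "c \<in> VOb P"
    have "w c \<cdot> ?t = fun_proj V P L N b c"
    proof (rule test[of c "FOb b c"])
      fix a assume [simp]: "a \<in> VOb P"
      let ?A = "VHom P a c" let ?Y = "VHom B N b"
      have zt: "z a \<cdot> ?t = vpre V L (FOb F a) (FOb N a) (FOb b a) (\<eta> a) \<cdot> fun_proj V P L N b a"
        using proj_t[of a "Idn V ?Y"] by simp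
      have "VCmp L (FOb F a) (FOb N c) (FOb b c) \<cdot> ((w c \<cdot> ?t) \<otimes> n a c)
        = VCmp L (FOb F a) (FOb b a) (FOb b c) \<cdot> ((FHom b a c \<otimes> (z a \<cdot> ?t)) \<cdot> sym V ?Y ?A)"
        using w_n[of a c ?t "Idn V ?A"] by simp
      also have "\<dots> = (VCmp L (FOb F a) (FOb b a) (FOb b c) \<cdot> (FHom b a c \<otimes>
          (vpre V L (FOb F a) (FOb N a) (FOb b a) (\<eta> a) \<cdot> fun_proj V P L N b a))) \<cdot> sym V ?Y ?A"
        unfolding zt by simp
      also have "\<dots> = vpre V L (FOb F a) (FOb N a) (FOb b c) (\<eta> a) \<cdot>
          ((VCmp L (FOb N a) (FOb b a) (FOb b c) \<cdot> (FHom b a c \<otimes> fun_proj V P L N b a)) \<cdot> sym V ?Y ?A)"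
        by (subst L.VCmp_vpre) simp_all
      also have "\<dots> = vpre V L (FOb F a) (FOb N a) (FOb b c) (\<eta> a) \<cdot>
          (VCmp L (FOb N a) (FOb N c) (FOb b c) \<cdot> (fun_proj V P L N b c \<otimes> FHom N a c))"
        using R.CB.proj_natural[of N b a c "Idn V ?A" "Idn V ?Y"] by simp
      also have "\<dots> = VCmp L (FOb F a) (FOb N c) (FOb b c) \<cdot> (fun_proj V P L N b c \<otimes> n a c)"
        by (simp add: n_def L.VCmp_vpre)
      finally show "VCmp L (FOb F a) (FOb N c) (FOb b c) \<cdot> ((w c \<cdot> ?t) \<otimes> n a c)
        = VCmp L (FOb F a) (FOb N c) (FOb b c) \<cdot> (fun_proj V P L N b c \<otimes> n a c)" .
    qed simp_all
    thus "fun_proj V P L N b c \<cdot> (u \<cdot> ?t) = fun_proj V P L N b c \<cdot> Idn V (VHom B N b)"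
      using comp_tail[OF u(4)[of c], of ?t] by (simp del: u(4))
  qed simp_all
  show ?thesis unfolding is_iso_def
    by (rule exI[of _ u], rule is_inverseI) (use tu ut in simp_all)
qed

lemma is_left_kan_lan:
  assumes lan: "is_lan F N \<eta>" and F: "vfunctor V K L F" and e: "vnat V K L F (vfun_comp V K N H) \<alpha>"
    and \<alpha>: "\<And>a. a \<in> VOb P \<Longrightarrow> \<alpha> a = \<eta> a"
  shows "is_left_kan V K P L H F N \<alpha>"
proof -
  note [simp] = K_functor_FOb[OF F]
  have N [simp]: "vfunctor V P L N" using lan by (simp add: is_lan_def)
  interpret N: vfunctor V P L N by fact
  have \<eta> [simp]: "\<eta> a \<in> Arr V" "Dom V (\<eta> a) = \<one>" "Cod V (\<eta> a) = VHom L (FOb F a) (FOb N a)"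
    if "a \<in> VOb P" for a using lan that by (simp_all add: is_lan_def)
  have "is_wcolim V K L (hom_into_along V K P H c) F (FOb N c)
        (\<lambda>a. arr_name V (VHom P (FOb H a) c) (VHom L (FOb F a) (FOb N c))
           (vpre V L (FOb F a) (FOb N (FOb H a)) (FOb N c) (\<alpha> a) \<cdot> FHom N (FOb H a) c))"
    if [simp]: "c \<in> VOb P" for c
  proof -
    have K: "K = discrete_vcat V (VOb P)" by (simp add: ob_vcat_def)
    note H' = vfunctor_H[unfolded K] and F' = F[unfolded K]
    have W: "vfunctor V K (self_vcat V) (hom_into_along V K P H c)"
      unfolding K by (rule hom_into_along_discrete(1)[OF H']) simp
    have Wob [simp]: "a \<in> VOb P \<Longrightarrow> FOb (hom_into_along V K P H c) a = VHom P a c" for a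
      unfolding K using hom_into_along_discrete(2)[OF H', of c a] by simp
    note iff = is_wcolim_discrete_iff[OF W[unfolded K] F', folded K]
    have colim: "copower_colimit L (VOb P) (\<lambda>a. VHom P a c) (FOb F) (FOb N c)
        (\<lambda>a. vpre V L (FOb F a) (FOb N a) (FOb N c) (\<eta> a) \<cdot> FHom N a c)"
      using lan by (simp add: is_lan_def)
    show ?thesis unfolding iff
    proof (intro conjI impI ballI)
      fix k assume [simp]: "k \<in> VOb P"
      show "arr_name V (VHom P (FOb H k) c) (VHom L (FOb F k) (FOb N c))
           (vpre V L (FOb F k) (FOb N (FOb H k)) (FOb N c) (\<alpha> k) \<cdot> FHom N (FOb H k) c)
        \<in> hom V \<one> (ihom V (FOb (hom_into_along V K P H c) k) (VHom L (FOb F k) (FOb N c)))"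
        by (simp add: arr_name \<alpha>)
    next
      show "copower_colimit L (VOb P) (FOb (hom_into_along V K P H c)) (FOb F) (FOb N c)
        (\<lambda>k. named_arr (FOb (hom_into_along V K P H c) k) (VHom L (FOb F k) (FOb N c))
          (arr_name V (VHom P (FOb H k) c) (VHom L (FOb F k) (FOb N c))
           (vpre V L (FOb F k) (FOb N (FOb H k)) (FOb N c) (\<alpha> k) \<cdot> FHom N (FOb H k) c)))"
        by (rule copower_colimit_cong[OF colim]) (simp_all add: arr_name \<alpha>)
    qed
  qed
  thus ?thesis using vfunctor_H N e by (simp add: is_left_kan_def)
qed

theorem kan_adjunction_exists:
  assumes "\<And>F c. \<lbrakk>vfunctor V K L F; c \<in> VOb P\<rbrakk>
    \<Longrightarrow> \<exists>t n. copower_colimit L (VOb P) (\<lambda>a. VHom P a c) (FOb F) t n"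
  shows "\<exists>Lan \<eta> \<epsilon>. kan_adjunction V P L Lan \<eta> \<epsilon>"
proof -
  define N where "N F = (SOME N. \<exists>\<eta>. is_lan F N \<eta>)" for F
  define h where "h F = (SOME \<eta>. is_lan F (N F) \<eta>)" for F
  have lan: "is_lan F (N F) (h F)" if "vfunctor V K L F" for F
  proof -
    have "\<exists>N \<eta>. is_lan F N \<eta>" by (rule lan_exists[OF that assms[OF that]])
    hence "\<exists>\<eta>. is_lan F (N F) \<eta>" unfolding N_def by (rule someI_ex)
    thus ?thesis unfolding h_def by (rule someI_ex)
  qed
  have N [simp]: "vfunctor V P L (N F)" if "vfunctor V K L F" for F
    using lan[OF that] by (simp add: is_lan_def)
  have "\<exists>e. e \<in> hom V \<one> (VHom M F (FOb G (N F))) \<and> (\<forall>a\<in>VOb P. fun_proj V K L F (FOb G (N F)) a \<cdot> e = h F a)"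
    if F: "vfunctor V K L F" for F
  proof -
    note GN = G_ob_types(1)[OF N[OF F]]
    have "vnat_family V K L F (FOb G (N F)) \<one> (h F)"
      using discrete_family[OF F[unfolded ob_vcat_def] GN[unfolded ob_vcat_def]] lan[OF F] N[OF F]
      unfolding ob_vcat_def by (simp add: is_lan_def)
    from R.AB.proj_lift[OF F GN this] show ?thesis by (metis in_hom_iff ob_simps(1))
  qed
  then obtain e where e: "\<And>F. vfunctor V K L F \<Longrightarrow> e F \<in> hom V \<one> (VHom M F (FOb G (N F)))"
    "\<And>F a. \<lbrakk>vfunctor V K L F; a \<in> VOb P\<rbrakk> \<Longrightarrow> fun_proj V K L F (FOb G (N F)) a \<cdot> e F = h F a"
    by metis
  interpret G: vfunctor V B M G by (rule vfunctor_G)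
  interpret universal_arrows V M B G N e
  proof
    fix F assume "F \<in> VOb M"
    hence F: "vfunctor V K L F" by simp
    thus "N F \<in> VOb B" by simp
    show "e F \<in> hom V \<one> (VHom M F (FOb G (N F)))" by (rule e(1)[OF F])
    fix b assume "b \<in> VOb B"
    hence b: "vfunctor V P L b" by simp
    show "is_iso V (vpre V M F (FOb G (N F)) (FOb G b) (e F) \<cdot> FHom G (N F) b)"
      by (rule lan_transpose_iso[OF lan[OF F] F _ _ _ e(2)[OF F] b]) (use e(1)[OF F] in simp_all)
  qed
  have "kan_adjunction V P L left_adjoint e counit" unfolding kan_adjunction_def
  proof (intro conjI allI impI vadjunction_left_adjoint)
    fix F assume F: "vfunctor V K L F"
    have [simp]: "FOb left_adjoint F = N F" using F by simp
    have GN: "FOb G (N F) = vfun_comp V K (N F) H" using F by (simp add: G_ob)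
    have "vnat V K L F (FOb G (N F)) (\<lambda>a. fun_proj V K L F (FOb G (N F)) a \<cdot> e F)"
      by (rule R.AB.vnat_of_element) (use F e(1)[OF F] in simp_all)
    thus "is_left_kan V K P L H F (FOb left_adjoint F)
        (\<lambda>a. fun_proj V K L F (vfun_comp V K (FOb left_adjoint F) H) a \<cdot> e F)"
      using is_left_kan_lan[OF lan[OF F] F] e(2)[OF F] by (simp add: GN)
  qed
  thus ?thesis by blast
qed

end

section \<open>The Eilenberg-Moore object of a V-adjunction\<close>

context category begin

lemma equalizer_mono:
  assumes "is_equalizer C f g E e" "h \<in> Arr C" "k \<in> Arr C" "Dom C h = Dom C k"
    "Cod C h = E" "Cod C k = E" "e \<cdot> h = e \<cdot> k" "f \<in> Arr C" "g \<in> Arr C" "Dom C g = Dom C f"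
  shows "h = k"
proof -
  have e: "e \<in> Arr C" "Dom C e = E" "Cod C e = Dom C f" "f \<cdot> e = g \<cdot> e"
    using assms(1) by (simp_all add: is_equalizer_def)
  have "f \<cdot> (e \<cdot> h) = g \<cdot> (e \<cdot> h)"
    using comp_cong_tail[OF e(4), of h] e assms by simp
  moreover have "e \<cdot> h \<in> hom C (Dom C h) (Dom C f)" using e assms by simp
  ultimately have "\<exists>!m. m \<in> hom C (Dom C h) E \<and> e \<cdot> m = e \<cdot> h"
    using assms(1) unfolding is_equalizer_def by blast
  moreover have "h \<in> hom C (Dom C h) E" "k \<in> hom C (Dom C h) E" using assms by simp_all
  ultimately show ?thesis using assms(7) by metis
qed

lemma equalizer_iso:
  assumes E: "is_equalizer C f g E e" and E': "is_equalizer C f g E' e'"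
    and fg: "f \<in> Arr C" "g \<in> Arr C" "Dom C g = Dom C f"
    and k: "k \<in> hom C E' E" "e \<cdot> k = e'"
  shows "is_iso C k"
proof -
  have e: "e \<in> Arr C" "Dom C e = E" "Cod C e = Dom C f" "f \<cdot> e = g \<cdot> e" "e \<in> hom C E (Dom C f)"
    using E by (simp_all add: is_equalizer_def)
  have e': "e' \<in> Arr C" "Dom C e' = E'" "Cod C e' = Dom C f"
    using E' by (simp_all add: is_equalizer_def)
  have O: "E \<in> Obj C" "E' \<in> Obj C" using Dom_Cod_in(1)[OF e(1)] Dom_Cod_in(1)[OF e'(1)] e e' by simp_all
  obtain j where j: "j \<in> hom C E E'" "e' \<cdot> j = e"
    using E' e(4,5) unfolding is_equalizer_def by blast
  have "k \<cdot> j = Idn C E"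
    by (rule equalizer_mono[OF E]) (use e e' j k fg O comp_tail[OF k(2), of j] in simp_all)
  moreover have "j \<cdot> k = Idn C E'"
    by (rule equalizer_mono[OF E']) (use e e' j k fg O comp_tail[OF j(2), of k] in simp_all)
  ultimately show ?thesis unfolding is_iso_def
    by (intro exI[of _ j] is_inverseI) (use j k in simp_all)
qed

end

text \<open>
  The locale \<open>vadjunction\<close> with \<open>V\<close> as the implicit structure of the notation.
\<close>

locale V_adjunction = vadjunction V M B F G \<eta> \<epsilon>
  for V :: "('o, 'm) smc" (structure)
    and M :: "('x, 'o, 'm) vcat" and B :: "('b, 'o, 'm) vcat" and F G \<eta> \<epsilon>
begin

abbreviation "T \<equiv> vfun_comp V M G F"
abbreviation "\<mu> \<equiv> adj_mult V F G \<epsilon>"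

lemma \<eta>_types [simp]:
  assumes "x \<in> VOb M"
  shows "\<eta> x \<in> Arr V" "Dom V (\<eta> x) = \<one>" "Cod V (\<eta> x) = VHom M x (FOb G (FOb F x))"
  using unit.vnat_types[of x] assms by simp_all

lemma \<epsilon>_types [simp]:
  assumes "b \<in> VOb B"
  shows "\<epsilon> b \<in> Arr V" "Dom V (\<epsilon> b) = \<one>" "Cod V (\<epsilon> b) = VHom B (FOb F (FOb G b)) b"
  using counit.vnat_types[of b] assms by simp_all

lemma \<eta>_natural:
  assumes "x \<in> VOb M" "y \<in> VOb M" "f \<in> Arr V" "Cod V f = VHom M x y"
  shows "vpost V M x y (FOb G (FOb F y)) (\<eta> y) \<cdot> f
    = vpre V M x (FOb G (FOb F x)) (FOb G (FOb F y)) (\<eta> x) \<cdot> (FHom G (FOb F x) (FOb F y) \<cdot> (FHom F x y \<cdot> f))"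
  using unit.vnat_natural_el[of x y f] assms by simp

lemma \<epsilon>_natural:
  assumes "b \<in> VOb B" "d \<in> VOb B" "f \<in> Arr V" "Cod V f = VHom B b d"
  shows "vpost V B (FOb F (FOb G b)) (FOb F (FOb G d)) d (\<epsilon> d) \<cdot> (FHom F (FOb G b) (FOb G d) \<cdot> (FHom G b d \<cdot> f))
    = vpre V B (FOb F (FOb G b)) b d (\<epsilon> b) \<cdot> f"
  using counit.vnat_natural_el[of b d f] assms by simp

lemma triangle_F_el:
  assumes "x \<in> VOb M"
  shows "vpost V B (FOb F x) (FOb F (FOb G (FOb F x))) (FOb F x) (\<epsilon> (FOb F x)) \<cdot>
    (FHom F x (FOb G (FOb F x)) \<cdot> \<eta> x) = VId B (FOb F x)"
  using triangle_F[OF assms] assms by (simp add: F.B.vcomp_eq_vpost)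

lemma triangle_G_el:
  assumes "b \<in> VOb B"
  shows "vpost V M (FOb G b) (FOb G (FOb F (FOb G b))) (FOb G b) (FHom G (FOb F (FOb G b)) b \<cdot> \<epsilon> b)
    \<cdot> \<eta> (FOb G b) = VId M (FOb G b)"
  using triangle_G[OF assms] assms by (simp add: F.vcomp_eq_vpost)

text \<open>
  Each arrow \<open>h\<close> out of \<open>F x\<close> is recovered from its transpose \<open>G h \<circ> \<eta>\<^sub>x\<close> as
  \<open>\<epsilon>\<^sub>b \<circ> F (G h \<circ> \<eta>\<^sub>x)\<close>.
\<close>

lemma transpose_inject:
  assumes e: "vpre V M x (FOb G (FOb F x)) (FOb G b) (\<eta> x) \<cdot> (FHom G (FOb F x) b \<cdot> h)
      = vpre V M x (FOb G (FOb F x)) (FOb G b) (\<eta> x) \<cdot> (FHom G (FOb F x) b \<cdot> k)"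
    and [simp]: "x \<in> VOb M" "b \<in> VOb B"
    and hk: "h \<in> Arr V" "Cod V h = VHom B (FOb F x) b" "k \<in> Arr V" "Cod V k = VHom B (FOb F x) b"
  shows "h = k"
proof -
  have recover: "vpost V B (FOb F x) (FOb F (FOb G b)) b (\<epsilon> b) \<cdot> (FHom F x (FOb G b) \<cdot>
      (vpre V M x (FOb G (FOb F x)) (FOb G b) (\<eta> x) \<cdot> (FHom G (FOb F x) b \<cdot> h))) = h"
    if [simp]: "h \<in> Arr V" "Cod V h = VHom B (FOb F x) b" for h
  proof -
    let ?y = "FOb G (FOb F x)"
    have "vpost V B (FOb F x) (FOb F (FOb G b)) b (\<epsilon> b) \<cdot> (FHom F x (FOb G b) \<cdot>
      (vpre V M x ?y (FOb G b) (\<eta> x) \<cdot> (FHom G (FOb F x) b \<cdot> h)))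
      = vpre V B (FOb F x) (FOb F ?y) b (FHom F x ?y \<cdot> \<eta> x) \<cdot> (vpre V B (FOb F ?y) (FOb F x) b (\<epsilon> (FOb F x)) \<cdot> h)"
      by (simp add: F.FHom_vpre F.B.vpost_vpre \<epsilon>_natural)
    also have "\<dots> = vpre V B (FOb F x) (FOb F x) b (VId B (FOb F x)) \<cdot> h"
      by (subst F.B.vpre_vpre) (simp_all add: F.B.vpost_eq_vpre[symmetric] triangle_F_el)
    finally show ?thesis by simp
  qed
  show ?thesis using recover[OF hk(1,2)] recover[OF hk(3,4)] unfolding e by (rule trans[OF sym])
qed

text \<open>
  Associativity of \<open>G \<epsilon> F\<close> is naturality of \<open>\<epsilon>\<close> at the global element \<open>\<epsilon>\<^sub>F\<^sub>x\<close>; the unit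
  laws are the triangle identities.
\<close>

lemma vmonad_adjunction: "vmonad V M T \<eta> \<mu>"
proof -
  interpret TT: vfunctor V M M "vfun_comp V M T T"
    by (rule vfunctor_vfun_comp[OF unit.G.vfunctor_axioms unit.G.vfunctor_axioms])
  have \<mu> [simp]: "\<mu> x \<in> Arr V" "Dom V (\<mu> x) = \<one>"
    "Cod V (\<mu> x) = VHom M (FOb G (FOb F (FOb G (FOb F x)))) (FOb G (FOb F x))" if "x \<in> VOb M" for x
    using that by (simp_all add: adj_mult_def)
  interpret mult: vnat V M M "vfun_comp V M T T" T \<mu>
  proof
    fix x y assume [simp]: "x \<in> VOb M" "y \<in> VOb M"
    let ?S = "\<lambda>x. FOb F x" and ?R = "\<lambda>x. FOb F (FOb G (FOb F x))"
    have "vpost V M (FOb G (?R x)) (FOb G (?R y)) (FOb G (?S y)) (FHom G (?R y) (?S y) \<cdot> \<epsilon> (?S y)) \<cdot>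
        (FHom G (?R x) (?R y) \<cdot> (FHom F (FOb G (?S x)) (FOb G (?S y)) \<cdot> (FHom G (?S x) (?S y) \<cdot> FHom F x y)))
      = FHom G (?R x) (?S y) \<cdot> (vpost V B (?R x) (?R y) (?S y) (\<epsilon> (?S y)) \<cdot>
        (FHom F (FOb G (?S x)) (FOb G (?S y)) \<cdot> (FHom G (?S x) (?S y) \<cdot> FHom F x y)))"
      by (simp add: G.FHom_vpost)
    also have "\<dots> = vpre V M (FOb G (?R x)) (FOb G (?S x)) (FOb G (?S y)) (FHom G (?R x) (?S x) \<cdot> \<epsilon> (?S x)) \<cdot>
        (FHom G (?S x) (?S y) \<cdot> FHom F x y)"
      by (simp add: \<epsilon>_natural G.FHom_vpre)
    finally show "vpost V M (FOb (vfun_comp V M T T) x) (FOb (vfun_comp V M T T) y) (FOb T y) (\<mu> y) \<cdot>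
        FHom (vfun_comp V M T T) x y
      = vpre V M (FOb (vfun_comp V M T T) x) (FOb T x) (FOb T y) (\<mu> x) \<cdot> FHom T x y"
      by (simp add: adj_mult_def)
  qed simp_all
  show ?thesis
  proof
    fix x assume [simp]: "x \<in> VOb M"
    let ?S = "FOb F x" let ?R = "FOb F (FOb G ?S)"
    have "vpost V M (FOb G (FOb F (FOb G ?R))) (FOb G ?R) (FOb G ?S) (\<mu> x) \<cdot>
        (FHom G (FOb F (FOb G ?R)) ?R \<cdot> (FHom F (FOb G ?R) (FOb G ?S) \<cdot> (FHom G ?R ?S \<cdot> \<epsilon> ?S)))
      = FHom G (FOb F (FOb G ?R)) ?S \<cdot> (vpre V B (FOb F (FOb G ?R)) ?R ?S (\<epsilon> ?R) \<cdot> \<epsilon> ?S)"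
      by (simp add: adj_mult_def G.FHom_vpost[symmetric] \<epsilon>_natural)
    also have "\<dots> = FHom G (FOb F (FOb G ?R)) ?S \<cdot> (vpost V B (FOb F (FOb G ?R)) ?R ?S (\<epsilon> ?S) \<cdot> \<epsilon> ?R)"
      by (subst F.B.vpost_eq_vpre) simp_all
    also have "\<dots> = vpost V M (FOb G (FOb F (FOb G ?R))) (FOb G ?R) (FOb G ?S) (\<mu> x) \<cdot> \<mu> (FOb G ?S)"
      by (simp add: adj_mult_def G.FHom_vpost)
    finally show "vcomp V M (FOb T (FOb T (FOb T x))) (FOb T (FOb T x)) (FOb T x)
        (\<mu> x) (FHom T (FOb T (FOb T x)) (FOb T x) \<cdot> \<mu> x)
      = vcomp V M (FOb T (FOb T (FOb T x))) (FOb T (FOb T x)) (FOb T x) (\<mu> x) (\<mu> (FOb T x))"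
      by (simp add: F.vcomp_eq_vpost) (simp add: adj_mult_def)
    show "vcomp V M (FOb T x) (FOb T (FOb T x)) (FOb T x) (\<mu> x) (\<eta> (FOb T x)) = VId M (FOb T x)"
      using triangle_G_el[of ?S] by (simp add: F.vcomp_eq_vpost) (simp add: adj_mult_def)
    have "vpost V M (FOb G ?S) (FOb G ?R) (FOb G ?S) (\<mu> x) \<cdot> (FHom G ?S ?R \<cdot> (FHom F x (FOb G ?S) \<cdot> \<eta> x))
      = FHom G ?S ?S \<cdot> (vpost V B ?S ?R ?S (\<epsilon> ?S) \<cdot> (FHom F x (FOb G ?S) \<cdot> \<eta> x))"
      by (simp add: adj_mult_def G.FHom_vpost)
    thus "vcomp V M (FOb T x) (FOb T (FOb T x)) (FOb T x) (\<mu> x) (FHom T x (FOb T x) \<cdot> \<eta> x) = VId M (FOb T x)"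
      by (simp add: F.vcomp_eq_vpost triangle_F_el)
  qed
qed

abbreviation "algebras \<equiv> {(x, h). is_algebra V M T \<eta> \<mu> x h}"
abbreviation "C \<equiv> comparison_ob V F G \<epsilon>"

lemma comparison_ob_algebra:
  assumes [simp]: "b \<in> VOb B"
  shows "C b \<in> algebras"
proof -
  let ?S = "FOb F (FOb G b)" let ?R = "FOb F (FOb G ?S)"
  have "vpost V M (FOb G ?R) (FOb G ?S) (FOb G b) (FHom G ?S b \<cdot> \<epsilon> b) \<cdot> (FHom G ?R ?S \<cdot> \<epsilon> ?S)
    = FHom G ?R b \<cdot> (vpost V B ?R ?S b (\<epsilon> b) \<cdot> \<epsilon> ?S)"
    by (simp add: G.FHom_vpost)
  also have "\<dots> = FHom G ?R b \<cdot> (vpre V B ?R ?S b (\<epsilon> ?S) \<cdot> \<epsilon> b)"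
    by (subst F.B.vpost_eq_vpre) simp_all
  also have "\<dots> = FHom G ?R b \<cdot> (vpost V B ?R ?S b (\<epsilon> b) \<cdot> (FHom F (FOb G ?S) (FOb G b) \<cdot> (FHom G ?S b \<cdot> \<epsilon> b)))"
    by (simp add: \<epsilon>_natural)
  also have "\<dots> = vpost V M (FOb G ?R) (FOb G ?S) (FOb G b) (FHom G ?S b \<cdot> \<epsilon> b) \<cdot>
      (FHom G ?R ?S \<cdot> (FHom F (FOb G ?S) (FOb G b) \<cdot> (FHom G ?S b \<cdot> \<epsilon> b)))"
    by (simp add: G.FHom_vpost)
  finally show ?thesis
    using triangle_G_el[of b]
    by (simp add: comparison_ob_def is_algebra_def adj_mult_def F.vcomp_eq_vpost)
qed

definition em_left :: "'b \<Rightarrow> 'b \<Rightarrow> 'm" where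
  "em_left b d = vpre V M (FOb T (FOb G b)) (FOb G b) (FOb G d) (FHom G (FOb F (FOb G b)) b \<cdot> \<epsilon> b)"

definition em_right :: "'b \<Rightarrow> 'b \<Rightarrow> 'm" where
  "em_right b d = vpost V M (FOb T (FOb G b)) (FOb T (FOb G d)) (FOb G d) (FHom G (FOb F (FOb G d)) d \<cdot> \<epsilon> d)
     \<cdot> FHom T (FOb G b) (FOb G d)"

lemma em_pair_types [simp]:
  assumes "b \<in> VOb B" "d \<in> VOb B"
  shows "em_left b d \<in> Arr V" "Dom V (em_left b d) = VHom M (FOb G b) (FOb G d)"
    "Cod V (em_left b d) = VHom M (FOb G (FOb F (FOb G b))) (FOb G d)"
    "em_right b d \<in> Arr V" "Dom V (em_right b d) = VHom M (FOb G b) (FOb G d)"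
    "Cod V (em_right b d) = VHom M (FOb G (FOb F (FOb G b))) (FOb G d)"
  using assms by (simp_all add: em_left_def em_right_def)

lemma G_equalizes:
  assumes [simp]: "b \<in> VOb B" "d \<in> VOb B"
  shows "em_left b d \<cdot> FHom G b d = em_right b d \<cdot> FHom G b d"
  using G.FHom_vpost[of "FOb F (FOb G b)" "FOb F (FOb G d)" d "\<epsilon> d" "FHom F (FOb G b) (FOb G d) \<cdot> FHom G b d"]
    G.FHom_vpre[of "FOb F (FOb G b)" b d "\<epsilon> b" "Idn V (VHom B b d)"]
    \<epsilon>_natural[of b d "Idn V (VHom B b d)"]
  by (simp add: em_left_def em_right_def)

lemma em_equalizer_comparison:
  "em_equalizer V M T (C b) (C d) = equalizer V (em_left b d) (em_right b d)"
  by (simp add: em_equalizer_def comparison_ob_def em_left_def em_right_def)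

text \<open>
  If \<open>G\<close> exhibits each hom object of \<open>B\<close> as the equalizer that defines the hom object of the
  comparison algebras, then the comparison is invertible on hom objects because equalizers are unique
  up to isomorphism.  As every algebra is a comparison algebra, this also provides all the equalizers
  from which \<open>em_vcat\<close> is built.
\<close>

lemma strictly_monadicI:
  assumes eq: "\<And>b d. \<lbrakk>b \<in> VOb B; d \<in> VOb B\<rbrakk>
      \<Longrightarrow> is_equalizer V (em_left b d) (em_right b d) (VHom B b d) (FHom G b d)"
    and bij: "bij_betw C (VOb B) algebras"
  shows "strictly_monadic V M B F G \<eta> \<epsilon>"
proof -
  let ?E = "em_vcat V M T \<eta> \<mu>"
  let ?h = "em_hom V M T" and ?i = "em_incl V M T"
  have VObE: "VOb ?E = algebras" by (simp add: em_vcat_def)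
  have VHomE: "VHom ?E = ?h" by (simp add: em_vcat_def)
  have fstC [simp]: "fst (C b) = FOb G b" for b by (simp add: comparison_ob_def)
  have is_eq: "is_equalizer V (em_left b d) (em_right b d) (?h (C b) (C d)) (?i (C b) (C d))"
    if "b \<in> VOb B" "d \<in> VOb B" for b d
  proof -
    have "\<exists>x. case x of (E, e) \<Rightarrow> is_equalizer V (em_left b d) (em_right b d) E e"
      using eq[OF that] by auto
    from someI_ex[OF this] show ?thesis
      unfolding em_equalizer_comparison equalizer_def by (auto split: prod.splits)
  qed
  have i [simp]: "?i (C b) (C d) \<in> Arr V" "Dom V (?i (C b) (C d)) = ?h (C b) (C d)"
    "Cod V (?i (C b) (C d)) = VHom M (FOb G b) (FOb G d)" if "b \<in> VOb B" "d \<in> VOb B" for b d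
    using is_eq[OF that] that by (simp_all add: is_equalizer_def)
  have h [simp]: "?h (C b) (C d) \<in> Obj V" if "b \<in> VOb B" "d \<in> VOb B" for b d
    using F.Dom_Cod_in(1)[OF i(1)[OF that]] that by simp
  have mono: "f = g" if "b \<in> VOb B" "d \<in> VOb B" "f \<in> Arr V" "g \<in> Arr V" "Dom V f = Dom V g"
      "Cod V f = ?h (C b) (C d)" "Cod V g = ?h (C b) (C d)" "?i (C b) (C d) \<cdot> f = ?i (C b) (C d) \<cdot> g" for b d f g
    by (rule F.equalizer_mono[OF is_eq[OF that(1,2)] that(3-8)]) (use that in simp_all)
  define k where "k b d = (THE k. k \<in> hom V (VHom B b d) (?h (C b) (C d)) \<and> ?i (C b) (C d) \<cdot> k = FHom G b d)" for b d
  have k': "k b d \<in> hom V (VHom B b d) (?h (C b) (C d)) \<and> ?i (C b) (C d) \<cdot> k b d = FHom G b d"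
    if bd: "b \<in> VOb B" "d \<in> VOb B" for b d
  proof -
    have "FHom G b d \<in> hom V (VHom B b d) (Dom V (em_left b d))" using bd by simp
    hence "\<exists>!k. k \<in> hom V (VHom B b d) (?h (C b) (C d)) \<and> ?i (C b) (C d) \<cdot> k = FHom G b d"
      using is_eq[OF bd] G_equalizes[OF bd] unfolding is_equalizer_def by blast
    from theI'[OF this] show ?thesis unfolding k_def .
  qed
  have k [simp]: "k b d \<in> Arr V" "Dom V (k b d) = VHom B b d" "Cod V (k b d) = ?h (C b) (C d)"
    "?i (C b) (C d) \<cdot> k b d = FHom G b d" if "b \<in> VOb B" "d \<in> VOb B" for b d
    using k'[OF that] by simp_all
  have k_tail: "?i (C b) (C d) \<cdot> (k b d \<cdot> f) = FHom G b d \<cdot> f"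
    if "b \<in> VOb B" "d \<in> VOb B" "f \<in> Arr V" "Cod V f = VHom B b d" for b d f
    using F.comp_tail[OF k(4)[OF that(1,2)], of f] that by simp
  have k_iso: "is_iso V (k b d)" if "b \<in> VOb B" "d \<in> VOb B" for b d
    by (rule F.equalizer_iso[OF is_eq[OF that] eq[OF that]]) (use that k'[OF that] in simp_all)
  define l where "l b d = inverse_arr V (k b d)" for b d
  have l [simp]: "l b d \<in> Arr V" "Cod V (l b d) = VHom B b d" "Dom V (l b d) = ?h (C b) (C d)"
    "FHom G b d \<cdot> l b d = ?i (C b) (C d)" if "b \<in> VOb B" "d \<in> VOb B" for b d
  proof -
    note kk = F.inverse_types[OF k_iso[OF that]] F.inverse_cancel[OF k_iso[OF that]]
    show l: "l b d \<in> Arr V" "Cod V (l b d) = VHom B b d" "Dom V (l b d) = ?h (C b) (C d)"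
      using kk that by (simp_all add: l_def)
    have "FHom G b d \<cdot> l b d = ?i (C b) (C d) \<cdot> (k b d \<cdot> l b d)" using k_tail that l by simp
    thus "FHom G b d \<cdot> l b d = ?i (C b) (C d)" using kk that by (simp add: l_def)
  qed
  have algE: "\<exists>b \<in> VOb B. p = C b" if "p \<in> algebras" for p
    using bij that unfolding bij_betw_def by blast
  have VIdE: "VId ?E (C b) \<in> hom V \<one> (?h (C b) (C b)) \<and> ?i (C b) (C b) \<cdot> VId ?E (C b) = VId M (FOb G b)"
    if [simp]: "b \<in> VOb B" for b
  proof -
    have "VId ?E (C b) = (THE i. i \<in> hom V \<one> (?h (C b) (C b)) \<and> ?i (C b) (C b) \<cdot> i = VId M (FOb G b))"
      by (simp add: em_vcat_def)
    also have "\<dots> = k b b \<cdot> VId B b"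
      by (rule the_equality) (simp add: k_tail, rule mono[of b b], simp_all add: k_tail)
    finally show ?thesis by (simp add: k_tail)
  qed
  have VCmpE: "VCmp ?E (C b) (C c) (C d) \<in> hom V (?h (C c) (C d) \<odot> ?h (C b) (C c)) (?h (C b) (C d)) \<and>
      ?i (C b) (C d) \<cdot> VCmp ?E (C b) (C c) (C d)
        = VCmp M (FOb G b) (FOb G c) (FOb G d) \<cdot> (?i (C c) (C d) \<otimes> ?i (C b) (C c))"
    if [simp]: "b \<in> VOb B" "c \<in> VOb B" "d \<in> VOb B" for b c d
  proof -
    let ?c = "k b d \<cdot> (VCmp B b c d \<cdot> (l c d \<otimes> l b c))"
    have c: "?i (C b) (C d) \<cdot> ?c = VCmp M (FOb G b) (FOb G c) (FOb G d) \<cdot> (?i (C c) (C d) \<otimes> ?i (C b) (C c))"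
      by (simp add: k_tail G.FHom_VCmp_el)
    have "VCmp ?E (C b) (C c) (C d) = (THE m. m \<in> hom V (?h (C c) (C d) \<odot> ?h (C b) (C c)) (?h (C b) (C d)) \<and>
      ?i (C b) (C d) \<cdot> m = VCmp M (FOb G b) (FOb G c) (FOb G d) \<cdot> (?i (C c) (C d) \<otimes> ?i (C b) (C c)))"
      by (simp add: em_vcat_def)
    also have "\<dots> = ?c"
      by (rule the_equality) (use c in simp, rule mono[of b d], use c in simp_all)
    finally show ?thesis using c by simp
  qed
  have proj: "vcategory V ?E \<and> vfunctor V ?E M (mk_vfun ?E fst ?i)"
  proof -
    have ex: "p \<in> VOb ?E \<Longrightarrow> \<exists>b \<in> VOb B. p = C b" for p using algE VObE by simp
    have 1: "fst p \<in> VOb M" if "p \<in> VOb ?E" for p using ex[OF that] by auto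
    have 2: "VHom ?E p q \<in> Obj V" if "p \<in> VOb ?E" "q \<in> VOb ?E" for p q
      using ex[OF that(1)] ex[OF that(2)] by (auto simp: VHomE)
    have 3: "?i p q \<in> hom V (VHom ?E p q) (VHom M (fst p) (fst q))" if "p \<in> VOb ?E" "q \<in> VOb ?E" for p q
      using ex[OF that(1)] ex[OF that(2)] by (auto simp: VHomE)
    have 4: "f = g" if pq: "p \<in> VOb ?E" "q \<in> VOb ?E" and fg: "f \<in> Arr V" "g \<in> Arr V" "Dom V f = Dom V g"
        "Cod V f = VHom ?E p q" "Cod V g = VHom ?E p q"
        "\<And>s. s \<in> (UNIV :: unit set) \<Longrightarrow> ?i p q \<cdot> f = ?i p q \<cdot> g" for p q f g
    proof -
      obtain b d where "b \<in> VOb B" "d \<in> VOb B" "p = C b" "q = C d" using ex[OF pq(1)] ex[OF pq(2)] by auto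
      thus ?thesis using mono[of b d f g] fg by (simp add: VHomE)
    qed
    have 5: "VId ?E p \<in> hom V \<one> (VHom ?E p p)" "?i p p \<cdot> VId ?E p = VId M (fst p)" if "p \<in> VOb ?E" for p
      using ex[OF that] VIdE by (auto simp: VHomE simp del: F.in_hom_iff)
    have 6: "VCmp ?E p q r \<in> hom V (VHom ?E q r \<odot> VHom ?E p q) (VHom ?E p r)"
      "?i p r \<cdot> VCmp ?E p q r = VCmp M (fst p) (fst q) (fst r) \<cdot> (?i q r \<otimes> ?i p q)"
      if "p \<in> VOb ?E" "q \<in> VOb ?E" "r \<in> VOb ?E" for p q r
      using ex[OF that(1)] ex[OF that(2)] ex[OF that(3)] VCmpE by (auto simp: VHomE simp del: F.in_hom_iff)
    note * = F.vcategory_of_projections[of M "UNIV :: unit set" ?E "\<lambda>_. fst" "\<lambda>_. ?i", OF F.vcategory_axioms]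
    show ?thesis
      by (intro conjI; rule *) (assumption | rule 1 2 3 4 5 6 UNIV_I)+
  qed
  interpret E: vcategory V ?E using proj by simp
  have comp: "comparison V M B F G \<epsilon> = mk_vfun B C k"
    unfolding comparison_def k_def Let_def by simp
  have K: "vfunctor V B ?E (mk_vfun B C k)"
  proof (rule F.vfunctor_mk_vfun)
    show "vcategory V B" "vcategory V ?E" by (simp_all add: F.B.vcategory_axioms E.vcategory_axioms)
    show "C b \<in> VOb ?E" if "b \<in> VOb B" for b
      using comparison_ob_algebra[OF that] VObE by simp
    show "k b d \<in> hom V (VHom B b d) (VHom ?E (C b) (C d))" if "b \<in> VOb B" "d \<in> VOb B" for b d
      using that by (simp add: VHomE)
  next
    fix b c d assume bcd [simp]: "b \<in> VOb B" "c \<in> VOb B" "d \<in> VOb B"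
    note m = VCmpE[OF bcd]
    have "?i (C b) (C d) \<cdot> (VCmp ?E (C b) (C c) (C d) \<cdot> (k c d \<otimes> k b c))
      = VCmp M (FOb G b) (FOb G c) (FOb G d) \<cdot> (FHom G c d \<otimes> FHom G b c)"
      using F.comp_tail[OF conjunct2[OF m], of "k c d \<otimes> k b c"] m by simp
    also have "\<dots> = ?i (C b) (C d) \<cdot> (k b d \<cdot> VCmp B b c d)"
      by (simp add: k_tail G.FHom_VCmp)
    finally have e: "?i (C b) (C d) \<cdot> (VCmp ?E (C b) (C c) (C d) \<cdot> (k c d \<otimes> k b c))
      = ?i (C b) (C d) \<cdot> (k b d \<cdot> VCmp B b c d)" .
    have t: "VCmp ?E (C b) (C c) (C d) \<in> hom V (?h (C c) (C d) \<odot> ?h (C b) (C c)) (?h (C b) (C d))"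
      using m by blast
    show "k b d \<cdot> VCmp B b c d = VCmp ?E (C b) (C c) (C d) \<cdot> (k c d \<otimes> k b c)"
      by (rule mono[OF _ _ _ _ _ _ _ e[symmetric]]) (use t in simp_all)
  next
    fix b assume [simp]: "b \<in> VOb B"
    show "k b b \<cdot> VId B b = VId ?E (C b)"
      by (rule mono[of b b]) (use VIdE[of b] in \<open>simp_all add: k_tail\<close>)
  qed
  have "iso_vfunctor V B ?E (mk_vfun B C k)"
  proof (rule iso_vfunctorI[OF K])
    have "bij_betw (FOb (mk_vfun B C k)) (VOb B) (VOb ?E) \<longleftrightarrow> bij_betw C (VOb B) (VOb ?E)"
      by (rule bij_betw_cong) simp
    thus "bij_betw (FOb (mk_vfun B C k)) (VOb B) (VOb ?E)" using bij by (simp add: VObE)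
  qed (simp add: k_iso)
  moreover have "vfun_comp V B (em_forget V M T \<eta> \<mu>) (mk_vfun B C k) = G"
  proof (rule vfun_eqI[OF vfunctor_vfun_comp[OF K] G.vfunctor_axioms])
    show "vfunctor V ?E M (em_forget V M T \<eta> \<mu>)" using proj by (simp add: em_forget_def)
    have CE: "b \<in> VOb B \<Longrightarrow> C b \<in> VOb ?E" for b using comparison_ob_algebra[of b] VObE by simp
    show "FOb (vfun_comp V B (em_forget V M T \<eta> \<mu>) (mk_vfun B C k)) b = FOb G b" if "b \<in> VOb B" for b
      using that CE[OF that] by (simp add: em_forget_def)
    show "FHom (vfun_comp V B (em_forget V M T \<eta> \<mu>) (mk_vfun B C k)) b d = FHom G b d"
      if "b \<in> VOb B" "d \<in> VOb B" for b d
      using that CE by (simp add: em_forget_def)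
  qed
  ultimately show ?thesis
    unfolding strictly_monadic_def adj_em_def comp using vmonad_adjunction vadjunction_axioms by simp
qed

end

section \<open>Algebras for the Kan adjunction\<close>

locale ob_adjunction = ob_restriction V P L +
  adj: V_adjunction V "functor_vcat V (ob_vcat V P) L" "functor_vcat V P L" Lan "ob_restrict V P L" \<eta> \<epsilon>
  for V :: "('o, 'm) smc" (structure)
    and P :: "('p, 'o, 'm) vcat" and L :: "('l, 'o, 'm) vcat" and Lan \<eta> \<epsilon>
begin

abbreviation "Mproj \<equiv> fun_proj V K L"
abbreviation "Bproj \<equiv> fun_proj V P L"
abbreviation "N x \<equiv> FOb Lan x"

lemma vfunctor_N [simp]: "vfunctor V K L x \<Longrightarrow> vfunctor V P L (N x)"
  using adj.F.FOb_type[of x] by simp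

lemma vfunctor_FOb [simp]:
  "\<lbrakk>vfunctor V P L b; a \<in> VOb P\<rbrakk> \<Longrightarrow> FOb b a \<in> VOb L"
  by (rule vfunctor.FOb_in)

lemma vfunctor_FHom [simp]:
  assumes "vfunctor V P L b" "a \<in> VOb P" "c \<in> VOb P"
  shows "FHom b a c \<in> Arr V" "Dom V (FHom b a c) = VHom P a c" "Cod V (FHom b a c) = VHom L (FOb b a) (FOb b c)"
  using vfunctor.FHom_in[OF assms] by simp_all

lemma K_FOb [simp]: "\<lbrakk>vfunctor V K L x; a \<in> VOb P\<rbrakk> \<Longrightarrow> FOb x a \<in> VOb L"
  by (rule K_functor_FOb)

definition unit_at :: "('p, 'l, 'm) vfun \<Rightarrow> 'p \<Rightarrow> 'm" where
  "unit_at x a = Mproj x (FOb G (N x)) a \<cdot> \<eta> x"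

definition counit_at :: "('p, 'l, 'm) vfun \<Rightarrow> 'p \<Rightarrow> 'm" where
  "counit_at b a = Bproj (N (FOb G b)) b a \<cdot> \<epsilon> b"

definition lan_coproj :: "('p, 'l, 'm) vfun \<Rightarrow> 'p \<Rightarrow> 'p \<Rightarrow> 'm" where
  "lan_coproj x a c = vpre V L (FOb x a) (FOb (N x) a) (FOb (N x) c) (unit_at x a) \<cdot> FHom (N x) a c"

lemma unit_at_types [simp]:
  assumes [simp]: "vfunctor V K L x" "a \<in> VOb P"
  shows "unit_at x a \<in> Arr V" "Dom V (unit_at x a) = \<one>" "Cod V (unit_at x a) = VHom L (FOb x a) (FOb (N x) a)"
  by (simp_all add: unit_at_def)

lemma counit_at_types [simp]:
  assumes [simp]: "vfunctor V P L b" "a \<in> VOb P"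
  shows "counit_at b a \<in> Arr V" "Dom V (counit_at b a) = \<one>"
    "Cod V (counit_at b a) = VHom L (FOb (N (FOb G b)) a) (FOb b a)"
  by (simp_all add: counit_at_def)

lemma lan_coproj_types [simp]:
  assumes [simp]: "vfunctor V K L x" "a \<in> VOb P" "c \<in> VOb P"
  shows "lan_coproj x a c \<in> Arr V" "Dom V (lan_coproj x a c) = VHom P a c"
    "Cod V (lan_coproj x a c) = VHom L (FOb x a) (FOb (N x) c)"
  by (simp_all add: lan_coproj_def)

lemma element_natural:
  assumes "vfunctor V P L b" "vfunctor V P L d" "e \<in> Arr V" "Dom V e = \<one>" "Cod V e = VHom B b d"
    "a \<in> VOb P" "c \<in> VOb P" "f \<in> Arr V" "Cod V f = VHom P a c"
  shows "vpost V L (FOb b a) (FOb b c) (FOb d c) (Bproj b d c \<cdot> e) \<cdot> (FHom b a c \<cdot> f)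
    = vpre V L (FOb b a) (FOb d a) (FOb d c) (Bproj b d a \<cdot> e) \<cdot> (FHom d a c \<cdot> f)"
  by (rule vnat.vnat_natural_el[OF R.CB.vnat_of_element[OF assms(1-5)] assms(6-9)])

lemma triangle_at:
  assumes [simp]: "vfunctor V P L b" "a \<in> VOb P"
  shows "vpost V L (FOb b a) (FOb (N (FOb G b)) a) (FOb b a) (counit_at b a) \<cdot> unit_at (FOb G b) a = VId L (FOb b a)"
proof -
  let ?x = "FOb G b"
  have "VId L (FOb b a) = Mproj ?x ?x a \<cdot> VId M ?x" by (simp add: R.AB.VId_FC)
  also have "\<dots> = Mproj ?x ?x a \<cdot> (vpost V M ?x (FOb G (N ?x)) ?x (FHom G (N ?x) b \<cdot> \<epsilon> b) \<cdot> \<eta> ?x)"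
    using adj.triangle_G_el[of b] by simp
  also have "\<dots> = vpost V L (FOb b a) (FOb (N ?x) a) (FOb b a) (counit_at b a) \<cdot> unit_at ?x a"
    by (simp add: R.AB.proj_vpost proj_G unit_at_def counit_at_def)
  finally show ?thesis by simp
qed

lemma unit_natural_at:
  assumes [simp]: "vfunctor V K L x" "vfunctor V K L y" "f \<in> Arr V" "Cod V f = VHom M x y" "a \<in> VOb P"
  shows "vpost V L (FOb x a) (FOb y a) (FOb (N y) a) (unit_at y a) \<cdot> (Mproj x y a \<cdot> f)
    = vpre V L (FOb x a) (FOb (N x) a) (FOb (N y) a) (unit_at x a) \<cdot> (Bproj (N x) (N y) a \<cdot> (FHom Lan x y \<cdot> f))"
proof -
  have "vpost V L (FOb x a) (FOb y a) (FOb (N y) a) (unit_at y a) \<cdot> (Mproj x y a \<cdot> f)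
     = Mproj x (FOb G (N y)) a \<cdot> (vpost V M x y (FOb G (N y)) (\<eta> y) \<cdot> f)"
    by (simp add: R.AB.proj_vpost unit_at_def)
  also have "\<dots> = Mproj x (FOb G (N y)) a \<cdot> (vpre V M x (FOb G (N x)) (FOb G (N y)) (\<eta> x) \<cdot>
      (FHom G (N x) (N y) \<cdot> (FHom Lan x y \<cdot> f)))"
    by (simp add: adj.\<eta>_natural)
  also have "\<dots> = vpre V L (FOb x a) (FOb (N x) a) (FOb (N y) a) (unit_at x a) \<cdot>
      (Bproj (N x) (N y) a \<cdot> (FHom Lan x y \<cdot> f))"
    by (simp add: R.AB.proj_vpre proj_G unit_at_def)
  finally show ?thesis .
qed

text \<open>
  Move \<open>\<epsilon>\<^sub>b\<close> past the action by naturality over \<open>P\<close>; the triangle identity then cancels it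
  against the unit.
\<close>

lemma counit_lan_coproj:
  assumes [simp]: "vfunctor V P L b" "a \<in> VOb P" "c \<in> VOb P"
  shows "vpost V L (FOb b a) (FOb (N (FOb G b)) c) (FOb b c) (counit_at b c) \<cdot> lan_coproj (FOb G b) a c = FHom b a c"
proof -
  let ?N = "N (FOb G b)" let ?h = "unit_at (FOb G b) a"
  have "vpost V L (FOb b a) (FOb ?N c) (FOb b c) (counit_at b c) \<cdot> lan_coproj (FOb G b) a c
    = vpre V L (FOb b a) (FOb ?N a) (FOb b c) ?h \<cdot> (vpost V L (FOb ?N a) (FOb ?N c) (FOb b c) (counit_at b c) \<cdot> FHom ?N a c)"
    by (simp add: lan_coproj_def L.vpost_vpre)
  also have "\<dots> = vpre V L (FOb b a) (FOb ?N a) (FOb b c) ?h \<cdot> (vpre V L (FOb ?N a) (FOb b a) (FOb b c) (counit_at b a) \<cdot> FHom b a c)"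
    using element_natural[of ?N b "\<epsilon> b" a c "Idn V (VHom P a c)"] by (simp add: counit_at_def)
  also have "\<dots> = vpre V L (FOb b a) (FOb b a) (FOb b c) (VId L (FOb b a)) \<cdot> FHom b a c"
    by (subst L.vpre_vpre) (simp_all add: L.vpost_eq_vpre[symmetric] triangle_at)
  finally show ?thesis by simp
qed

text \<open>
  Replace the action of \<open>b\<close> by counit after coprojection (\<open>counit_lan_coproj\<close>).  The homomorphism
  equation trades the counit at \<open>b\<close> for the counit at \<open>d\<close> and \<open>x\<close> for \<open>Lan x\<close>, which is natural over
  \<open>P\<close>; then naturality of the unit brings \<open>x\<close> back, and the action of \<open>d\<close> appears.
\<close>

lemma equalizing_family:
  assumes [simp]: "vfunctor V P L b" "vfunctor V P L d" "x \<in> Arr V" "Cod V x = VHom M (FOb G b) (FOb G d)"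
    and e: "adj.em_left b d \<cdot> x = adj.em_right b d \<cdot> x"
  shows "vnat_family V P L b d (Dom V x) (\<lambda>a. Mproj (FOb G b) (FOb G d) a \<cdot> x)"
  unfolding vnat_family_def
proof (intro conjI ballI)
  let ?b = "FOb G b" let ?d = "FOb G d"
  define X where "X a = Mproj ?b ?d a \<cdot> x" for a
  define Y where "Y a = Bproj (N ?b) (N ?d) a \<cdot> (FHom Lan ?b ?d \<cdot> x)" for a
  have X [simp]: "X a \<in> Arr V" "Dom V (X a) = Dom V x" "Cod V (X a) = VHom L (FOb b a) (FOb d a)" if "a \<in> VOb P" for a
    using that by (simp_all add: X_def)
  have Y [simp]: "Y a \<in> Arr V" "Dom V (Y a) = Dom V x" "Cod V (Y a) = VHom L (FOb (N ?b) a) (FOb (N ?d) a)"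
    if "a \<in> VOb P" for a using that by (simp_all add: Y_def)
  show "Dom V x \<in> Obj V" by simp
  fix a assume [simp]: "a \<in> VOb P"
  show "Mproj ?b ?d a \<cdot> x \<in> hom V (Dom V x) (VHom L (FOb b a) (FOb d a))"
    by simp
  fix c assume [simp]: "c \<in> VOb P"
  let ?Q = "VHom P a c"
  \<comment> \<open>the homomorphism equation at \<open>c\<close>\<close>
  have XY: "vpre V L (FOb (N ?b) c) (FOb b c) (FOb d c) (counit_at b c) \<cdot> X c
     = vpost V L (FOb (N ?b) c) (FOb (N ?d) c) (FOb d c) (counit_at d c) \<cdot> Y c"
  proof -
    have "Mproj (FOb G (N ?b)) ?d c \<cdot> (vpre V M (FOb G (N ?b)) ?b ?d (FHom G (N ?b) b \<cdot> \<epsilon> b) \<cdot> x)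
      = Mproj (FOb G (N ?b)) ?d c \<cdot> (vpost V M (FOb G (N ?b)) (FOb G (N ?d)) ?d (FHom G (N ?d) d \<cdot> \<epsilon> d) \<cdot>
          (FHom G (N ?b) (N ?d) \<cdot> (FHom Lan ?b ?d \<cdot> x)))"
      using e by (simp add: adj.em_left_def adj.em_right_def)
    thus ?thesis
      by (simp add: R.AB.proj_vpre R.AB.proj_vpost proj_G counit_at_def X_def Y_def)
  qed
  \<comment> \<open>naturality of the unit at \<open>a\<close>\<close>
  have YX: "vpre V L (FOb b a) (FOb (N ?b) a) (FOb (N ?d) a) (unit_at ?b a) \<cdot> Y a
     = vpost V L (FOb b a) (FOb d a) (FOb (N ?d) a) (unit_at ?d a) \<cdot> X a"
    using unit_natural_at[of ?b ?d x a] by (simp add: X_def Y_def)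
  have Y_nat: "VCmp L (FOb (N ?b) a) (FOb (N ?b) c) (FOb (N ?d) c) \<cdot> ((Y c \<otimes> FHom (N ?b) a c) \<cdot> sym V ?Q (Dom V x))
     = VCmp L (FOb (N ?b) a) (FOb (N ?d) a) (FOb (N ?d) c) \<cdot> (FHom (N ?d) a c \<otimes> Y a)"
    using R.CB.proj_natural[of "N ?b" "N ?d" a c "Idn V ?Q" "FHom Lan ?b ?d \<cdot> x"] by (simp add: Y_def)
  have "VCmp L (FOb b a) (FOb b c) (FOb d c) \<cdot> (X c \<otimes> FHom b a c)
    = VCmp L (FOb b a) (FOb b c) (FOb d c) \<cdot>
      (X c \<otimes> (vpost V L (FOb b a) (FOb (N ?b) c) (FOb b c) (counit_at b c) \<cdot> lan_coproj ?b a c))"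
    by (simp add: counit_lan_coproj)
  also have "\<dots> = VCmp L (FOb b a) (FOb (N ?b) c) (FOb d c) \<cdot>
      ((vpost V L (FOb (N ?b) c) (FOb (N ?d) c) (FOb d c) (counit_at d c) \<cdot> Y c) \<otimes> lan_coproj ?b a c)"
    by (subst L.VCmp_middle[symmetric]) (simp_all add: XY)
  also have "\<dots> = vpost V L (FOb b a) (FOb (N ?d) c) (FOb d c) (counit_at d c) \<cdot>
      (vpre V L (FOb b a) (FOb (N ?b) a) (FOb (N ?d) c) (unit_at ?b a) \<cdot>
       (VCmp L (FOb (N ?b) a) (FOb (N ?b) c) (FOb (N ?d) c) \<cdot> (Y c \<otimes> FHom (N ?b) a c)))"
    by (simp add: L.VCmp_vpost lan_coproj_def L.VCmp_vpre L.vpost_vpre)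
  finally have 1: "VCmp L (FOb b a) (FOb b c) (FOb d c) \<cdot> (X c \<otimes> FHom b a c)
    = vpost V L (FOb b a) (FOb (N ?d) c) (FOb d c) (counit_at d c) \<cdot>
      (vpre V L (FOb b a) (FOb (N ?b) a) (FOb (N ?d) c) (unit_at ?b a) \<cdot>
       (VCmp L (FOb (N ?b) a) (FOb (N ?b) c) (FOb (N ?d) c) \<cdot> (Y c \<otimes> FHom (N ?b) a c)))" .
  have "VCmp L (FOb b a) (FOb b c) (FOb d c) \<cdot> ((X c \<otimes> FHom b a c) \<cdot> sym V ?Q (Dom V x))
    = (VCmp L (FOb b a) (FOb b c) (FOb d c) \<cdot> (X c \<otimes> FHom b a c)) \<cdot> sym V ?Q (Dom V x)"
    by simp
  also have "\<dots> = vpost V L (FOb b a) (FOb (N ?d) c) (FOb d c) (counit_at d c) \<cdot>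
      (vpre V L (FOb b a) (FOb (N ?b) a) (FOb (N ?d) c) (unit_at ?b a) \<cdot>
       (VCmp L (FOb (N ?b) a) (FOb (N ?d) a) (FOb (N ?d) c) \<cdot> (FHom (N ?d) a c \<otimes> Y a)))"
    unfolding 1 Y_nat[symmetric] by simp
  also have "\<dots> = vpost V L (FOb b a) (FOb (N ?d) c) (FOb d c) (counit_at d c) \<cdot>
      (VCmp L (FOb b a) (FOb (N ?d) a) (FOb (N ?d) c) \<cdot> (FHom (N ?d) a c \<otimes>
        (vpost V L (FOb b a) (FOb d a) (FOb (N ?d) a) (unit_at ?d a) \<cdot> X a)))"
    by (subst L.VCmp_vpre[symmetric]) (simp_all add: YX)
  also have "\<dots> = vpost V L (FOb b a) (FOb (N ?d) c) (FOb d c) (counit_at d c) \<cdot>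
      (VCmp L (FOb b a) (FOb d a) (FOb (N ?d) c) \<cdot> (lan_coproj ?d a c \<otimes> X a))"
    by (subst L.VCmp_middle[symmetric]) (simp_all add: lan_coproj_def)
  also have "\<dots> = VCmp L (FOb b a) (FOb d a) (FOb d c) \<cdot> (FHom d a c \<otimes> X a)"
    by (subst L.VCmp_vpost[symmetric]) (simp_all add: counit_lan_coproj)
  finally show "VCmp L (FOb b a) (FOb d a) (FOb d c) \<cdot> (FHom d a c \<otimes> (Mproj ?b ?d a \<cdot> x))
    = VCmp L (FOb b a) (FOb b c) (FOb d c) \<cdot> (((Mproj ?b ?d c \<cdot> x) \<otimes> FHom b a c) \<cdot> sym V ?Q (Dom V x))"
    by (simp add: X_def)
qed

lemma G_is_equalizer:
  assumes [simp]: "vfunctor V P L b" "vfunctor V P L d"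
  shows "is_equalizer V (adj.em_left b d) (adj.em_right b d) (VHom B b d) (FHom G b d)"
  unfolding is_equalizer_def
proof (intro conjI allI impI)
  show "FHom G b d \<in> hom V (VHom B b d) (Dom V (adj.em_left b d))" by simp
  show "adj.em_left b d \<cdot> FHom G b d = adj.em_right b d \<cdot> FHom G b d"
    by (rule adj.G_equalizes) simp_all
  fix X x assume x: "x \<in> hom V X (Dom V (adj.em_left b d)) \<and> adj.em_left b d \<cdot> x = adj.em_right b d \<cdot> x"
  hence xt [simp]: "x \<in> Arr V" "Dom V x = X" "Cod V x = VHom M (FOb G b) (FOb G d)" by simp_all
  have "vnat_family V P L b d X (\<lambda>a. Mproj (FOb G b) (FOb G d) a \<cdot> x)"
    using equalizing_family[of b d x] x by simp
  then obtain h where h: "h \<in> Arr V" "Dom V h = X" "Cod V h = VHom B b d"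
    "\<And>a. a \<in> VOb P \<Longrightarrow> Bproj b d a \<cdot> h = Mproj (FOb G b) (FOb G d) a \<cdot> x"
    using R.CB.proj_lift[OF assms] by blast
  show "\<exists>!h. h \<in> hom V X (VHom B b d) \<and> FHom G b d \<cdot> h = x"
  proof (rule ex1I[of _ h])
    have "FHom G b d \<cdot> h = x"
      by (rule R.AB.proj_eqI[of "FOb G b" "FOb G d"]) (simp_all add: h proj_G)
    thus "h \<in> hom V X (VHom B b d) \<and> FHom G b d \<cdot> h = x" using h by simp
    fix h' assume h': "h' \<in> hom V X (VHom B b d) \<and> FHom G b d \<cdot> h' = x"
    show "h' = h"
    proof (rule R.CB.proj_eqI[OF assms])
      fix a assume "a \<in> VOb P"
      thus "Bproj b d a \<cdot> h' = Bproj b d a \<cdot> h"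
        using h(4)[of a] h' proj_G[of b d a h'] by simp
    qed (use h h' in simp_all)
  qed
qed

text \<open>
  By \<open>counit_lan_coproj\<close> the action of \<open>b\<close> is built from \<open>G b\<close> and \<open>G \<epsilon>\<^sub>b\<close> alone.
\<close>

lemma comparison_inj: "inj_on adj.C (VOb B)"
proof (rule inj_onI)
  fix b d assume "b \<in> VOb B" "d \<in> VOb B"
  hence bd [simp]: "vfunctor V P L b" "vfunctor V P L d" by simp_all
  assume "adj.C b = adj.C d"
  hence "FOb G b = FOb G d \<and> FHom G (N (FOb G b)) b \<cdot> \<epsilon> b = FHom G (N (FOb G d)) d \<cdot> \<epsilon> d"
    unfolding comparison_ob_def prod.inject .
  hence e: "FOb G b = FOb G d" "FHom G (N (FOb G b)) b \<cdot> \<epsilon> b = FHom G (N (FOb G d)) d \<cdot> \<epsilon> d"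
    by (rule conjunct1, rule conjunct2)
  have ob: "FOb b a = FOb d a" if "a \<in> VOb P" for a
    using that e(1) G_ob_types(2)[OF bd(1) that] G_ob_types(2)[OF bd(2) that] by simp
  have co: "counit_at b c = counit_at d c" if "c \<in> VOb P" for c
    using that e proj_G[of "N (FOb G b)" b c "\<epsilon> b"] proj_G[of "N (FOb G d)" d c "\<epsilon> d"]
    by (simp add: counit_at_def)
  show "b = d"
  proof (rule vfun_eqI[OF bd ob])
    fix a c assume "a \<in> VOb P" "c \<in> VOb P"
    thus "FHom b a c = FHom d a c"
      using counit_lan_coproj[of b a c] counit_lan_coproj[of d a c] co ob e(1) by simp
  qed simp
qed

text \<open>
  The components \<open>k\<close> of the algebra structure turn the coprojections into an action \<open>bh\<close> of \<open>P\<close> on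
  \<open>x\<close>.  Both the composition law for \<open>bh\<close> and naturality of \<open>k\<close> reduce to the fact \<open>act\<close>: the action
  on \<open>Lan x\<close>, followed by \<open>k\<close>, may be computed by first applying \<open>k\<close>.  This in turn is the
  associativity law of the algebra.
\<close>

lemma algebra_is_comparison:
  assumes alg: "is_algebra V M adj.T \<eta> adj.\<mu> x h"
  shows "\<exists>b \<in> VOb B. adj.C b = (x, h)"
proof -
  have x [simp]: "vfunctor V K L x" using alg by (simp add: is_algebra_def)
  let ?Gx = "FOb G (N x)" let ?N2 = "N ?Gx"
  have h [simp]: "h \<in> Arr V" "Dom V h = \<one>" "Cod V h = VHom M ?Gx x"
    using alg by (simp_all add: is_algebra_def)
  have h_unit: "vpost V M x ?Gx x h \<cdot> \<eta> x = VId M x"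
    and h_mult: "vpost V M (FOb G ?N2) ?Gx x h \<cdot> (FHom G ?N2 (N x) \<cdot> \<epsilon> (N x))
      = vpost V M (FOb G ?N2) ?Gx x h \<cdot> (FHom G ?N2 (N x) \<cdot> (FHom Lan ?Gx x \<cdot> h))"
    using alg by (simp_all add: is_algebra_def adj_mult_def adj.F.vcomp_eq_vpost)
  define k where "k a = Mproj ?Gx x a \<cdot> h" for a
  \<comment> \<open>the components of \<open>Lan h\<close>, an arrow of \<open>B\<close>\<close>
  define t where "t a = Bproj ?N2 (N x) a \<cdot> (FHom Lan ?Gx x \<cdot> h)" for a
  have k [simp]: "k a \<in> Arr V" "Dom V (k a) = \<one>" "Cod V (k a) = VHom L (FOb (N x) a) (FOb x a)"
    if "a \<in> VOb P" for a using that by (simp_all add: k_def)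
  have t [simp]: "t a \<in> Arr V" "Dom V (t a) = \<one>" "Cod V (t a) = VHom L (FOb ?N2 a) (FOb (N x) a)"
    if "a \<in> VOb P" for a using that by (simp_all add: t_def)
  have k_unit: "vpost V L (FOb x a) (FOb (N x) a) (FOb x a) (k a) \<cdot> unit_at x a = VId L (FOb x a)"
    if [simp]: "a \<in> VOb P" for a
  proof -
    have "Mproj x x a \<cdot> (vpost V M x ?Gx x h \<cdot> \<eta> x) = VId L (FOb x a)"
      unfolding h_unit by (simp add: R.AB.VId_FC)
    thus ?thesis by (simp add: R.AB.proj_vpost k_def unit_at_def)
  qed
  have k_mult: "vpost V L (FOb ?N2 a) (FOb (N x) a) (FOb x a) (k a) \<cdot> counit_at (N x) a
    = vpost V L (FOb ?N2 a) (FOb (N x) a) (FOb x a) (k a) \<cdot> t a" if [simp]: "a \<in> VOb P" for a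
  proof -
    have "Mproj (FOb G ?N2) x a \<cdot> (vpost V M (FOb G ?N2) ?Gx x h \<cdot> (FHom G ?N2 (N x) \<cdot> \<epsilon> (N x)))
      = Mproj (FOb G ?N2) x a \<cdot> (vpost V M (FOb G ?N2) ?Gx x h \<cdot> (FHom G ?N2 (N x) \<cdot> (FHom Lan ?Gx x \<cdot> h)))"
      unfolding h_mult ..
    thus ?thesis by (simp add: R.AB.proj_vpost proj_G k_def t_def counit_at_def)
  qed
  have pre_lan_coproj: "vpre V L (FOb (N x) a) (FOb x a) (FOb (N x) c) (k a) \<cdot> lan_coproj x a c
    = vpost V L (FOb (N x) a) (FOb ?N2 c) (FOb (N x) c) (t c) \<cdot> lan_coproj ?Gx a c"
    if [simp]: "a \<in> VOb P" "c \<in> VOb P" for a c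
  proof -
    have ut: "vpre V L (FOb (N x) a) (FOb x a) (FOb (N x) a) (k a) \<cdot> unit_at x a
      = vpre V L (FOb (N x) a) (FOb ?N2 a) (FOb (N x) a) (unit_at ?Gx a) \<cdot> t a"
      using unit_natural_at[of ?Gx x h a]
      by (simp add: k_def[symmetric] t_def[symmetric] L.vpost_eq_vpre)
    have "vpre V L (FOb (N x) a) (FOb x a) (FOb (N x) c) (k a) \<cdot> lan_coproj x a c
      = vpre V L (FOb (N x) a) (FOb (N x) a) (FOb (N x) c)
          (vpre V L (FOb (N x) a) (FOb x a) (FOb (N x) a) (k a) \<cdot> unit_at x a) \<cdot> FHom (N x) a c"
      unfolding lan_coproj_def by (rule L.vpre_vpre) simp_all
    also have "\<dots> = vpre V L (FOb (N x) a) (FOb ?N2 a) (FOb (N x) c) (unit_at ?Gx a) \<cdot>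
        (vpre V L (FOb ?N2 a) (FOb (N x) a) (FOb (N x) c) (t a) \<cdot> FHom (N x) a c)"
      unfolding ut by (rule L.vpre_vpre[symmetric]) simp_all
    also have "\<dots> = vpre V L (FOb (N x) a) (FOb ?N2 a) (FOb (N x) c) (unit_at ?Gx a) \<cdot>
        (vpost V L (FOb ?N2 a) (FOb ?N2 c) (FOb (N x) c) (t c) \<cdot> FHom ?N2 a c)"
      using element_natural[of ?N2 "N x" "FHom Lan ?Gx x \<cdot> h" a c "Idn V (VHom P a c)"]
      by (simp add: t_def)
    also have "\<dots> = vpost V L (FOb (N x) a) (FOb ?N2 c) (FOb (N x) c) (t c) \<cdot> lan_coproj ?Gx a c"
      by (simp add: lan_coproj_def L.vpost_vpre)
    finally show ?thesis .
  qed
  have act: "vpost V L (FOb (N x) a) (FOb (N x) c) (FOb x c) (k c) \<cdot>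
      (vpre V L (FOb (N x) a) (FOb x a) (FOb (N x) c) (k a) \<cdot> lan_coproj x a c)
    = vpost V L (FOb (N x) a) (FOb (N x) c) (FOb x c) (k c) \<cdot> FHom (N x) a c"
    if [simp]: "a \<in> VOb P" "c \<in> VOb P" for a c
  proof -
    have "vpost V L (FOb (N x) a) (FOb (N x) c) (FOb x c) (k c) \<cdot>
      (vpre V L (FOb (N x) a) (FOb x a) (FOb (N x) c) (k a) \<cdot> lan_coproj x a c)
      = vpost V L (FOb (N x) a) (FOb ?N2 c) (FOb x c)
          (vpost V L (FOb ?N2 c) (FOb (N x) c) (FOb x c) (k c) \<cdot> t c) \<cdot> lan_coproj ?Gx a c"
      unfolding pre_lan_coproj[OF that] by (rule L.vpost_vpost) simp_all
    also have "\<dots> = vpost V L (FOb (N x) a) (FOb (N x) c) (FOb x c) (k c) \<cdot>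
        (vpost V L (FOb (N x) a) (FOb ?N2 c) (FOb (N x) c) (counit_at (N x) c) \<cdot> lan_coproj ?Gx a c)"
      unfolding k_mult[OF that(2), symmetric] by (rule L.vpost_vpost[symmetric]) simp_all
    finally show ?thesis by (simp add: counit_lan_coproj)
  qed
  define bh where "bh a c = vpost V L (FOb x a) (FOb (N x) c) (FOb x c) (k c) \<cdot> lan_coproj x a c" for a c
  have bh [simp]: "bh a c \<in> Arr V" "Dom V (bh a c) = VHom P a c" "Cod V (bh a c) = VHom L (FOb x a) (FOb x c)"
    if "a \<in> VOb P" "c \<in> VOb P" for a c using that by (simp_all add: bh_def)
  have k_bh: "vpre V L (FOb (N x) a) (FOb x a) (FOb x c) (k a) \<cdot> bh a c
     = vpost V L (FOb (N x) a) (FOb (N x) c) (FOb x c) (k c) \<cdot> FHom (N x) a c"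
    if [simp]: "a \<in> VOb P" "c \<in> VOb P" for a c
    unfolding act[OF that, symmetric] bh_def by (rule L.vpost_vpre[symmetric]) simp_all
  define b where "b = mk_vfun P (FOb x) bh"
  have b [simp]: "vfunctor V P L b" unfolding b_def
  proof (rule vfunctor_mk_vfun)
    fix a c d assume [simp]: "a \<in> VOb P" "c \<in> VOb P" "d \<in> VOb P"
    interpret Nx: vfunctor V P L "N x" by (rule vfunctor_N) simp
    have "VCmp L (FOb x a) (FOb x c) (FOb x d) \<cdot> (bh c d \<otimes> bh a c)
      = VCmp L (FOb x a) (FOb (N x) c) (FOb x d) \<cdot>
        ((vpre V L (FOb (N x) c) (FOb x c) (FOb x d) (k c) \<cdot> bh c d) \<otimes> lan_coproj x a c)"
      by (subst bh_def[of a c], subst L.VCmp_middle) simp_all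
    also have "\<dots> = vpost V L (FOb x a) (FOb (N x) d) (FOb x d) (k d) \<cdot>
        (VCmp L (FOb x a) (FOb (N x) c) (FOb (N x) d) \<cdot> (FHom (N x) c d \<otimes> lan_coproj x a c))"
      by (simp add: k_bh L.VCmp_vpost)
    also have "\<dots> = bh a d \<cdot> VCmp P a c d"
      by (simp add: bh_def lan_coproj_def L.VCmp_vpre Nx.FHom_VCmp)
    finally show "bh a d \<cdot> VCmp P a c d = VCmp L (FOb x a) (FOb x c) (FOb x d) \<cdot> (bh c d \<otimes> bh a c)" by simp
  next
    fix a assume [simp]: "a \<in> VOb P"
    interpret Nx: vfunctor V P L "N x" by (rule vfunctor_N) simp
    show "bh a a \<cdot> VId P a = VId L (FOb x a)"
      by (simp add: bh_def lan_coproj_def k_unit)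
  qed (simp_all add: P.vcategory_axioms L.vcategory_axioms)
  have bob [simp]: "a \<in> VOb P \<Longrightarrow> FOb b a = FOb x a" "a \<in> VOb P \<Longrightarrow> c \<in> VOb P \<Longrightarrow> FHom b a c = bh a c" for a c
    by (simp_all add: b_def)
  have Gb [simp]: "FOb G b = x"
    using discrete_vfun_eqI[OF G_ob_types(1)[OF b, unfolded ob_vcat_def] x[unfolded ob_vcat_def]] by simp
  have "vnat V P L (N x) b k"
    by (intro vnat.intro vnat_axioms.intro vfunctor_N x b) (simp_all add: k_bh)
  hence "vnat_family V P L (N x) b \<one> k"
    by (subst vnat_iff_vnat_family[symmetric]) simp_all
  then obtain m where m [simp]: "m \<in> Arr V" "Dom V m = \<one>" "Cod V m = VHom B (N x) b"
    and m_k: "\<And>a. a \<in> VOb P \<Longrightarrow> Bproj (N x) b a \<cdot> m = k a"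
    using R.CB.proj_lift[of "N x" b \<one> k] by auto
  have Gm: "FHom G (N x) b \<cdot> m = h"
  proof (rule R.AB.proj_eqI[of ?Gx x])
    fix a assume "a \<in> VOb K"
    thus "Mproj ?Gx x a \<cdot> (FHom G (N x) b \<cdot> m) = Mproj ?Gx x a \<cdot> h"
      using proj_G[of "N x" b a m] by (simp add: m_k k_def)
  qed (use G_hom_types[of "N x" b] in simp_all)
  \<comment> \<open>\<open>\<epsilon>\<^sub>b\<close> and \<open>m\<close> both have the identity of \<open>x\<close> as transpose\<close>
  have "\<epsilon> b = m"
  proof (rule adj.transpose_inject[of x b])
    have "vpre V M x ?Gx x (\<eta> x) \<cdot> (FHom G (N x) b \<cdot> \<epsilon> b) = VId M x"
      using adj.triangle_G_el[of b] G_hom_types[of "N x" b] adj.\<epsilon>_types[of b]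
      by (simp add: adj.F.vpost_eq_vpre)
    moreover have "vpre V M x ?Gx x (\<eta> x) \<cdot> h = VId M x"
      using h_unit by (simp add: adj.F.vpost_eq_vpre)
    ultimately show "vpre V M x (FOb G (N x)) (FOb G b) (\<eta> x) \<cdot> (FHom G (N x) b \<cdot> \<epsilon> b)
      = vpre V M x (FOb G (N x)) (FOb G b) (\<eta> x) \<cdot> (FHom G (N x) b \<cdot> m)"
      by (simp add: Gm)
  qed (use adj.\<epsilon>_types[of b] in simp_all)
  hence "adj.C b = (x, h)" by (simp add: comparison_ob_def Gm)
  thus ?thesis using b by auto
qed

lemma strictly_monadic_restriction: "strictly_monadic V M B Lan G \<eta> \<epsilon>"
proof (rule adj.strictly_monadicI)
  show "is_equalizer V (adj.em_left b d) (adj.em_right b d) (VHom B b d) (FHom G b d)"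
    if "b \<in> VOb B" "d \<in> VOb B" for b d
    by (rule G_is_equalizer) (use that in simp_all)
  show "bij_betw adj.C (VOb B) adj.algebras"
  proof (rule bij_betw_imageI[OF comparison_inj])
    show "adj.C ` VOb B = adj.algebras"
    proof (rule subset_antisym)
      show "adj.C ` VOb B \<subseteq> adj.algebras"
        by (rule image_subsetI) (rule adj.comparison_ob_algebra)
      show "adj.algebras \<subseteq> adj.C ` VOb B"
      proof
        fix p assume "p \<in> adj.algebras"
        then obtain x h where p: "p = (x, h)" and "is_algebra V M adj.T \<eta> adj.\<mu> x h" by blast
        from algebra_is_comparison[OF this(2)] obtain b where b: "b \<in> VOb B" "adj.C b = (x, h)" ..
        show "p \<in> adj.C ` VOb B" unfolding p b(2)[symmetric] using b(1) by (rule imageI)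
      qed
    qed
  qed
qed

end

theorem theorem4:
  fixes U :: "'u set"
    and V :: "('o, 'm) smc"
    and P :: "('p, 'o, 'm) vcat"
    and L :: "('l, 'o, 'm) vcat"
  assumes "size_universe U"
    and "sym_monoidal_closed V"
    and "complete_cat U V"
    and "cocomplete_cat U V"
    and "locally_small U V"
    and "vcategory V P"
    and "small U (VOb P)"
    and "vcategory V L"
    and "cocomplete_vcat U V L"
  shows "(\<exists>Lan \<eta> \<epsilon>. kan_adjunction V P L Lan \<eta> \<epsilon>) \<and>
    (\<forall>Lan \<eta> \<epsilon>. kan_adjunction V P L Lan \<eta> \<epsilon> \<longrightarrow>
       strictly_monadic V (functor_vcat V (ob_vcat V P) L) (functor_vcat V P L)
         Lan (ob_restrict V P L) \<eta> \<epsilon> \<and>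
       isomorphic_vcat V (functor_vcat V P L)
         (adj_em V (functor_vcat V (ob_vcat V P) L) Lan (ob_restrict V P L) \<eta> \<epsilon>))"
proof -
  interpret sym_monoidal_closed V by fact
  interpret smc_initial V by (rule smc_initialI[OF assms(1,4)])
  interpret P: vcategory V P by fact
  interpret L: vcategory V L by fact
  have ends: "\<exists>E p. is_end V A L F G E p"
    if "small U (VOb A)" "vfunctor V A L F" "vfunctor V A L G" for A :: "('p, 'o, 'm) vcat" and F G
    by (rule end_exists[OF assms(1,3) that])
  interpret ob_restriction V P L
    by unfold_locales (rule ends; use assms(7) in \<open>simp add: ob_vcat_def\<close>)+
  have "\<exists>Lan \<eta> \<epsilon>. kan_adjunction V P L Lan \<eta> \<epsilon>"
  proof (rule kan_adjunction_exists)
    fix F c assume "vfunctor V K L F" "c \<in> VOb P"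
    thus "\<exists>t n. copower_colimit L (VOb P) (\<lambda>a. VHom P a c) (FOb F) t n"
      by (intro copower_colimit_exists[OF assms(9) L.vcategory_axioms assms(7)])
         (simp_all add: K_functor_FOb)
  qed
  moreover have "strictly_monadic V M B Lan G \<eta> \<epsilon> \<and> isomorphic_vcat V B (adj_em V M Lan G \<eta> \<epsilon>)"
    if "kan_adjunction V P L Lan \<eta> \<epsilon>" for Lan \<eta> \<epsilon>
  proof -
    have "vadjunction V M B Lan G \<eta> \<epsilon>" using that by (simp add: kan_adjunction_def)
    then interpret ob_adjunction V P L Lan \<eta> \<epsilon>
      by (intro ob_adjunction.intro V_adjunction.intro ob_restriction_axioms)
    show ?thesis using strictly_monadic_restriction
      unfolding strictly_monadic_def isomorphic_vcat_def by blast
  qed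
  ultimately show ?thesis by blast
qed

end
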